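(* Let $q$ be real with $0<q^2<1$, and let $\rho:SU_q(2)\to C(S^1)$ be the canonical surjection onto the maximal classical compact subgroup $S^1$ of $SU_q(2)$. Then for any $\theta\in\operatorname{Aut}(SU_q(2))=\operatorname{Aut}_\chi(SU_q(2))$ the diagram formed by $\theta$, $\rho$ and the identity of $C(S^1)$ commutes, i.e. $\rho\circ\theta=\mathrm{id}\circ\rho=\rho$.
   Context: $SU_q(2)$ denotes the universal $C^*$-algebra generated by $\alpha,\gamma$ with relations $\alpha^*\alpha+\gamma^*\gamma=1$, $\alpha\alpha^*+q^2\gamma\gamma^*=1$, $\alpha\gamma=q\gamma\alpha$, $\alpha\gamma^*=q\gamma^*\alpha$, $\gamma\gamma^*=\gamma^*\gamma$, which is a compact quantum group with comultiplication $\Phi$ determined by $\Phi(u_{ij})=\sum_k u_{ik}\otimes u_{kj}$, where $u=\begin{pmatrix}\alpha&-q\gamma^*\\ \gamma&\alpha^*\end{pmatrix}$. The canonical surjection $\rho:SU_q(2)\to C(S^1)$ is given by $\rho(\alpha)=z$, $\rho(\gamma)=0$, where $z$ is the coordinate function on $S^1$. For a compact quantum group $G=(A,\Phi)$, $\operatorname{Aut}(G)$ is the group of $C^*$-algebra automorphisms $\theta$ of $A$ with $(\theta\otimes\theta)\Phi=\Phi\circ\theta$, and $\operatorname{Aut}_\chi(G)$ is the subgroup of those fixing the character $\chi_v=\sum_i v_{ii}$ of every irreducible (finite-dimensional unitary) representation $v$ of $G$. *)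

theory Defs
  imports "HOL-Analysis.Analysis" "HOL-Library.Poly_Mapping"
begin

section \<open>Unital C*-algebras\<close>

class scaleC =
  fixes scaleC :: "complex \<Rightarrow> 'a \<Rightarrow> 'a" (infixr \<open>*\<^sub>C\<close> 75)

text \<open>As \<^class>\<open>real_normed_algebra_1\<close> requires \<open>norm 1 = 1\<close>, the zero algebra is excluded.\<close>

class cstar_algebra = scaleC + real_normed_algebra_1 + banach +
  fixes adj :: "'a \<Rightarrow> 'a"
  assumes scaleR_scaleC: "r *\<^sub>R x = complex_of_real r *\<^sub>C x"
    and scaleC_add_right: "c *\<^sub>C (x + y) = c *\<^sub>C x + c *\<^sub>C y"
    and scaleC_add_left: "(c + d) *\<^sub>C x = c *\<^sub>C x + d *\<^sub>C x"
    and scaleC_scaleC: "c *\<^sub>C (d *\<^sub>C x) = (c * d) *\<^sub>C x"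
    and scaleC_one: "1 *\<^sub>C x = x"
    and mult_scaleC_left: "(c *\<^sub>C x) * y = c *\<^sub>C (x * y)"
    and mult_scaleC_right: "x * (c *\<^sub>C y) = c *\<^sub>C (x * y)"
    and norm_scaleC: "norm (c *\<^sub>C x) = cmod c * norm x"
    and adj_adj: "adj (adj x) = x"
    and adj_add: "adj (x + y) = adj x + adj y"
    and adj_scaleC: "adj (c *\<^sub>C x) = cnj c *\<^sub>C adj x"
    and adj_mult: "adj (x * y) = adj y * adj x"
    and cstar_identity: "norm (adj x * x) = (norm x)\<^sup>2"

text \<open>Homomorphisms are unital; continuity is not assumed, as it is automatic.\<close>

definition star_hom :: "('a::cstar_algebra \<Rightarrow> 'b::cstar_algebra) \<Rightarrow> bool" where
  "star_hom f \<longleftrightarrow>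
     (\<forall>x y. f (x + y) = f x + f y) \<and>
     (\<forall>c x. f (c *\<^sub>C x) = c *\<^sub>C f x) \<and>
     (\<forall>x y. f (x * y) = f x * f y) \<and>
     f 1 = 1 \<and>
     (\<forall>x. f (adj x) = adj (f x))"

text \<open>C*-seminorms on a \<open>*\<close>-subalgebra \<open>S\<close> of a complex \<open>*\<close>-algebra whose scalar multiplication
  and involution are \<open>sc\<close> and \<open>st\<close>.\<close>

definition cstar_seminorm_on ::
    "'r::ring_1 set \<Rightarrow> (complex \<Rightarrow> 'r \<Rightarrow> 'r) \<Rightarrow> ('r \<Rightarrow> 'r) \<Rightarrow> ('r \<Rightarrow> real) \<Rightarrow> bool" where
  "cstar_seminorm_on S sc st N \<longleftrightarrow>
     (\<forall>x\<in>S. 0 \<le> N x) \<and>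
     (\<forall>x\<in>S. \<forall>y\<in>S. N (x + y) \<le> N x + N y) \<and>
     (\<forall>c. \<forall>x\<in>S. N (sc c x) = cmod c * N x) \<and>
     (\<forall>x\<in>S. \<forall>y\<in>S. N (x * y) \<le> N x * N y) \<and>
     (\<forall>x\<in>S. N (st x * x) = (N x)\<^sup>2)"

instantiation complex :: cstar_algebra
begin
definition scaleC_complex :: "complex \<Rightarrow> complex \<Rightarrow> complex" where "scaleC_complex c x = c * x"
definition adj_complex :: "complex \<Rightarrow> complex" where "adj_complex = cnj"
instance
  by standard (auto simp: scaleC_complex_def adj_complex_def algebra_simps norm_mult
      power2_eq_square scaleR_conv_of_real)
end


section \<open>Continuous functions on the circle\<close>

unbundle bcontfun.lifting

instantiation bcontfun :: (metric_space, cstar_algebra) cstar_algebra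
begin

lift_definition one_bcontfun :: "'a \<Rightarrow>\<^sub>C 'b" is "\<lambda>_. 1"
  by (rule const_bcontfun)

lift_definition times_bcontfun :: "('a \<Rightarrow>\<^sub>C 'b) \<Rightarrow> ('a \<Rightarrow>\<^sub>C 'b) \<Rightarrow> 'a \<Rightarrow>\<^sub>C 'b"
  is "\<lambda>f g x. f x * g x"
proof -
  fix f g :: "'a \<Rightarrow> 'b"
  assume f: "f \<in> bcontfun" and g: "g \<in> bcontfun"
  obtain B C where "\<And>x. norm (f x) \<le> B" "\<And>x. norm (g x) \<le> C"
    using f g by (auto simp: bcontfun_def bounded_iff)
  then have "norm (f x * g x) \<le> B * C" for x
    by (meson mult_mono norm_ge_zero norm_mult_ineq order_trans)
  then show "(\<lambda>x. f x * g x) \<in> bcontfun"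
    using f g by (intro bcontfun_normI) (auto simp: bcontfun_def intro!: continuous_intros)
qed

lift_definition scaleC_bcontfun :: "complex \<Rightarrow> ('a \<Rightarrow>\<^sub>C 'b) \<Rightarrow> 'a \<Rightarrow>\<^sub>C 'b"
  is "\<lambda>c f x. c *\<^sub>C f x"
proof -
  fix c and f :: "'a \<Rightarrow> 'b"
  assume f: "f \<in> bcontfun"
  have eq: "c *\<^sub>C y = (c *\<^sub>C 1) * y" for y :: 'b
    by (simp add: mult_scaleC_left)
  obtain B where B: "\<And>x. norm (f x) \<le> B"
    using f by (auto simp: bcontfun_def bounded_iff)
  have "continuous_on UNIV (\<lambda>x. (c *\<^sub>C 1) * f x)"
    using f by (auto simp: bcontfun_def intro!: continuous_intros)
  then have "continuous_on UNIV (\<lambda>x. c *\<^sub>C f x)"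
    by (subst eq)
  moreover have "norm (c *\<^sub>C f x) \<le> cmod c * B" for x
    by (simp add: norm_scaleC B mult_left_mono)
  ultimately show "(\<lambda>x. c *\<^sub>C f x) \<in> bcontfun"
    by (rule bcontfun_normI)
qed

lift_definition adj_bcontfun :: "('a \<Rightarrow>\<^sub>C 'b) \<Rightarrow> 'a \<Rightarrow>\<^sub>C 'b" is "\<lambda>f x. adj (f x)"
proof -
  fix f :: "'a \<Rightarrow> 'b"
  assume f: "f \<in> bcontfun"
  have le: "norm y \<le> norm (adj y)" for y :: 'b
  proof (cases "norm y = 0")
    case False
    have "norm y * norm y \<le> norm (adj y) * norm y"
      using norm_mult_ineq[of "adj y" y] by (simp add: cstar_identity power2_eq_square)
    then show ?thesis using False by simp
  qed simp
  have eq: "norm (adj y) = norm y" for y :: 'b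
    using le[of y] le[of "adj y"] by (simp add: adj_adj)
  have "bounded_linear (adj :: 'b \<Rightarrow> 'b)"
    by (rule bounded_linear_intro[where K = 1])
      (simp_all add: adj_add adj_scaleC scaleR_scaleC eq)
  from bounded_linear.continuous_on[OF this] have "continuous_on UNIV (\<lambda>x. adj (f x))"
    using f by (auto simp: bcontfun_def)
  moreover obtain B where "\<And>x. norm (f x) \<le> B"
    using f by (auto simp: bcontfun_def bounded_iff)
  ultimately show "(\<lambda>x. adj (f x)) \<in> bcontfun"
    by (intro bcontfun_normI) (auto simp: eq)
qed

instance
proof
  fix r :: real and c d :: complex and x y z :: "'a \<Rightarrow>\<^sub>C 'b"
  show "x * y * z = x * (y * z)" by transfer (simp add: mult.assoc)
  show "(x + y) * z = x * z + y * z" by transfer (simp add: distrib_right)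
  show "x * (y + z) = x * y + x * z" by transfer (simp add: distrib_left)
  show "r *\<^sub>R x * y = r *\<^sub>R (x * y)" by transfer simp
  show "x * r *\<^sub>R y = r *\<^sub>R (x * y)" by transfer simp
  show "1 * x = x" by transfer simp
  show "x * 1 = x" by transfer simp
  show "(0 :: 'a \<Rightarrow>\<^sub>C 'b) \<noteq> 1" by transfer (simp add: fun_eq_iff)
  show "norm (x * y) \<le> norm x * norm y"
  proof (rule norm_bound)
    fix t
    have "norm (apply_bcontfun x t * apply_bcontfun y t) \<le> norm x * norm y"
      by (meson mult_mono norm_bounded norm_ge_zero norm_mult_ineq order_trans)
    then show "norm (apply_bcontfun (x * y) t) \<le> norm x * norm y"
      by (simp add: times_bcontfun.rep_eq)
  qed
  show "norm (1 :: 'a \<Rightarrow>\<^sub>C 'b) = 1"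
  proof (rule antisym)
    show "norm (1 :: 'a \<Rightarrow>\<^sub>C 'b) \<le> 1"
      by (rule norm_bound) (simp add: one_bcontfun.rep_eq)
    show "1 \<le> norm (1 :: 'a \<Rightarrow>\<^sub>C 'b)"
      using norm_bounded[of "1 :: 'a \<Rightarrow>\<^sub>C 'b"] by (simp add: one_bcontfun.rep_eq)
  qed
  show "r *\<^sub>R x = complex_of_real r *\<^sub>C x" by transfer (simp add: scaleR_scaleC)
  show "c *\<^sub>C (x + y) = c *\<^sub>C x + c *\<^sub>C y" by transfer (simp add: scaleC_add_right)
  show "(c + d) *\<^sub>C x = c *\<^sub>C x + d *\<^sub>C x" by transfer (simp add: scaleC_add_left)
  show "c *\<^sub>C (d *\<^sub>C x) = (c * d) *\<^sub>C x" by transfer (simp add: scaleC_scaleC)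
  show "1 *\<^sub>C x = x" by transfer (simp add: scaleC_one)
  show "(c *\<^sub>C x) * y = c *\<^sub>C (x * y)" by transfer (simp add: mult_scaleC_left)
  show "x * (c *\<^sub>C y) = c *\<^sub>C (x * y)" by transfer (simp add: mult_scaleC_right)
  show "adj (adj x) = x" by transfer (simp add: adj_adj)
  show "adj (x + y) = adj x + adj y" by transfer (simp add: adj_add)
  show "adj (c *\<^sub>C x) = cnj c *\<^sub>C adj x" by transfer (simp add: adj_scaleC)
  show "adj (x * y) = adj y * adj x" by transfer (simp add: adj_mult)
  have scale_le: "norm (a *\<^sub>C u) \<le> cmod a * norm u" for a and u :: "'a \<Rightarrow>\<^sub>C 'b"
    by (rule norm_bound) (simp add: scaleC_bcontfun.rep_eq norm_scaleC norm_bounded mult_left_mono)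
  show "norm (c *\<^sub>C x) = cmod c * norm x"
  proof (cases "c = 0")
    case True
    then show ?thesis using scale_le[of c x] by simp
  next
    case False
    have "inverse c *\<^sub>C (c *\<^sub>C x) = x"
      using False by transfer (simp add: scaleC_scaleC scaleC_one)
    then have "norm x \<le> cmod (inverse c) * norm (c *\<^sub>C x)"
      using scale_le[of "inverse c" "c *\<^sub>C x"] by simp
    then have "cmod c * norm x \<le> norm (c *\<^sub>C x)"
      using False by (simp add: norm_inverse norm_divide field_simps)
    then show ?thesis using scale_le[of c x] by simp
  qed
  show "norm (adj x * x) = (norm x)\<^sup>2"
  proof (rule antisym)
    show "norm (adj x * x) \<le> (norm x)\<^sup>2"
      by (rule norm_bound)
        (simp add: times_bcontfun.rep_eq adj_bcontfun.rep_eq cstar_identity norm_bounded power_mono)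
    have "(norm (apply_bcontfun x t))\<^sup>2 \<le> norm (adj x * x)" for t
      using norm_bounded[of "adj x * x" t]
      by (simp add: times_bcontfun.rep_eq adj_bcontfun.rep_eq cstar_identity)
    then have "norm x \<le> sqrt (norm (adj x * x))"
      by (intro norm_bound real_le_rsqrt)
    then show "(norm x)\<^sup>2 \<le> norm (adj x * x)"
      by (metis norm_ge_zero power_mono real_sqrt_pow2)
  qed
qed

end

typedef circle = "sphere (0::complex) 1"
  by (auto intro!: exI[of _ 1])

instantiation circle :: metric_space
begin
definition dist_circle :: "circle \<Rightarrow> circle \<Rightarrow> real" where
  "dist_circle x y = dist (Rep_circle x) (Rep_circle y)"
definition uniformity_circle :: "(circle \<times> circle) filter" where
  "uniformity_circle = (INF e\<in>{0<..}. principal {(x, y). dist x y < e})"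
definition open_circle :: "circle set \<Rightarrow> bool" where
  "open_circle U \<longleftrightarrow> (\<forall>x\<in>U. eventually (\<lambda>(x', y). x' = x \<longrightarrow> y \<in> U) uniformity)"
instance
  by standard (auto simp: dist_circle_def uniformity_circle_def open_circle_def
      Rep_circle_inject dist_triangle2)
end

text \<open>Every continuous function on the circle is bounded, so \<open>circle \<Rightarrow>\<^sub>C complex\<close>, with the
  supremum norm and the pointwise operations, is all of \<open>C(S\<^sup>1)\<close>.\<close>

lemma continuous_on_Rep_circle: "continuous_on UNIV Rep_circle"
  unfolding continuous_on_iff by (auto simp: dist_circle_def)

lift_definition circle_coord :: "circle \<Rightarrow>\<^sub>C complex" is Rep_circle
  by (rule bcontfun_normI[where b = 1]) (use Rep_circle continuous_on_Rep_circle in auto)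


lifting_forget bcontfun.lifting


section \<open>Universal C*-algebras\<close>

text \<open>The free unital \<open>*\<close>-algebra on \<open>'g\<close>: finitely supported complex functions on the words in
  the letters \<open>(g, False)\<close>, standing for \<open>g\<close>, and \<open>(g, True)\<close>, standing for \<open>g\<^sup>*\<close>. Its ring structure
  is the convolution product of \<^type>\<open>poly_mapping\<close> over the free monoid.\<close>

datatype 'g star_word = Star_Word (letters: "('g \<times> bool) list")

instantiation star_word :: (type) monoid_add
begin
definition zero_star_word :: "'a star_word" where "0 = Star_Word []"
definition plus_star_word :: "'a star_word \<Rightarrow> 'a star_word \<Rightarrow> 'a star_word" where
  "v + w = Star_Word (letters v @ letters w)"
instance
  by standard (auto simp: zero_star_word_def plus_star_word_def)
end

type_synonym 'g free_alg = "'g star_word \<Rightarrow>\<^sub>0 complex"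

definition free_gen :: "'g \<Rightarrow> 'g free_alg" where
  "free_gen g = Poly_Mapping.single (Star_Word [(g, False)]) 1"

definition free_scale :: "complex \<Rightarrow> 'g free_alg \<Rightarrow> 'g free_alg" where
  "free_scale c p = Poly_Mapping.single 0 c * p"

definition free_adj :: "'g free_alg \<Rightarrow> 'g free_alg" where
  "free_adj p = (\<Sum>w\<in>Poly_Mapping.keys p.
     Poly_Mapping.single (Star_Word (rev (map (\<lambda>(g, b). (g, \<not> b)) (letters w))))
       (cnj (Poly_Mapping.lookup p w)))"

definition free_eval :: "('g \<Rightarrow> 'a::cstar_algebra) \<Rightarrow> 'g free_alg \<Rightarrow> 'a" where
  "free_eval e p = (\<Sum>w\<in>Poly_Mapping.keys p. Poly_Mapping.lookup p w *\<^sub>C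
     prod_list (map (\<lambda>(g, b). if b then adj (e g) else e g) (letters w)))"

text \<open>\<open>'a\<close> with generators \<open>e g\<close> is the universal unital C*-algebra with relations \<open>r = 0\<close>, \<open>r \<in> R\<close>,
  i.e. the Hausdorff completion of the free unital \<open>*\<close>-algebra in the largest C*-seminorm
  that vanishes on \<open>R\<close>. The first conjunct makes \<open>norm \<circ> free_eval e\<close> such a seminorm, and the
  third one says that it is the largest.\<close>

definition universal_cstar :: "'g free_alg set \<Rightarrow> ('g \<Rightarrow> 'a::cstar_algebra) \<Rightarrow> bool" where
  "universal_cstar R e \<longleftrightarrow>
     (\<forall>r\<in>R. free_eval e r = 0) \<and>
     closure (range (free_eval e)) = UNIV \<and>
     (\<forall>N. cstar_seminorm_on UNIV free_scale free_adj N \<and> (\<forall>r\<in>R. N r = 0) \<longrightarrow>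
        (\<forall>p. N p \<le> norm (free_eval e p)))"


section \<open>The minimal tensor product\<close>

definition alg_tensor ::
    "('a::cstar_algebra \<Rightarrow> 'b::cstar_algebra \<Rightarrow> 'c::cstar_algebra) \<Rightarrow> 'c set" where
  "alg_tensor tens = {x. \<exists>(n::nat) a b. x = (\<Sum>i<n. tens (a i) (b i))}"

text \<open>\<open>'c\<close>, with \<open>tens a b\<close> in the role of \<open>a \<otimes> b\<close>, is the minimal C*-tensor product of \<open>'a\<close> and \<open>'b\<close>:
  \<open>tens\<close> embeds the algebraic tensor product as the dense \<open>*\<close>-subalgebra \<^term>\<open>alg_tensor tens\<close> (the
  clause on linearly independent \<open>b i\<close> is injectivity), on which the norm of \<open>'c\<close> is the smallest
  of all C*-norms.\<close>

definition min_tensor ::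
    "('a::cstar_algebra \<Rightarrow> 'b::cstar_algebra \<Rightarrow> 'c::cstar_algebra) \<Rightarrow> bool" where
  "min_tensor tens \<longleftrightarrow>
     (\<forall>a a' b. tens (a + a') b = tens a b + tens a' b) \<and>
     (\<forall>a b b'. tens a (b + b') = tens a b + tens a b') \<and>
     (\<forall>c a b. tens (c *\<^sub>C a) b = c *\<^sub>C tens a b) \<and>
     (\<forall>c a b. tens a (c *\<^sub>C b) = c *\<^sub>C tens a b) \<and>
     (\<forall>a a' b b'. tens a b * tens a' b' = tens (a * a') (b * b')) \<and>
     tens 1 1 = 1 \<and>
     (\<forall>a b. adj (tens a b) = tens (adj a) (adj b)) \<and>
     (\<forall>(n::nat) a b.
        (\<forall>c. (\<Sum>i<n. c i *\<^sub>C b i) = 0 \<longrightarrow> (\<forall>i<n. c i = 0)) \<and> (\<Sum>i<n. tens (a i) (b i)) = 0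
        \<longrightarrow> (\<forall>i<n. a i = 0)) \<and>
     closure (alg_tensor tens) = UNIV \<and>
     (\<forall>N. cstar_seminorm_on (alg_tensor tens) scaleC adj N \<and>
          (\<forall>x\<in>alg_tensor tens. N x = 0 \<longrightarrow> x = 0) \<longrightarrow>
        (\<forall>x\<in>alg_tensor tens. norm x \<le> N x))"

text \<open>\<open>F = f \<otimes> g\<close>; by density and continuity there is at most one such \<open>F\<close>.\<close>

definition is_tensor_hom where
  "is_tensor_hom tens f g F \<longleftrightarrow> star_hom F \<and> (\<forall>a b. F (tens a b) = tens (f a) (g b))"


section \<open>Representations, characters and automorphisms of compact quantum groups\<close>

text \<open>A compact quantum group is given by its comultiplication \<open>\<Phi> :: 'a \<Rightarrow> 'c\<close>, where \<open>'c\<close> is the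
  tensor square of \<open>'a\<close> via \<open>tens\<close>. An \<open>n\<close>-dimensional representation is an \<open>n \<times> n\<close> matrix \<open>v\<close> over \<open>'a\<close>;
  only the entries \<open>v i j\<close> with \<open>i, j < n\<close> matter.\<close>

definition unitary_rep ::
    "('a::cstar_algebra \<Rightarrow> 'a \<Rightarrow> 'c::cstar_algebra) \<Rightarrow> ('a \<Rightarrow> 'c) \<Rightarrow> nat \<Rightarrow> (nat \<Rightarrow> nat \<Rightarrow> 'a) \<Rightarrow> bool"
  where
  "unitary_rep tens \<Phi> n v \<longleftrightarrow>
     (\<forall>i<n. \<forall>j<n. (\<Sum>k<n. v i k * adj (v j k)) = (if i = j then 1 else 0)) \<and>
     (\<forall>i<n. \<forall>j<n. (\<Sum>k<n. adj (v k i) * v k j) = (if i = j then 1 else 0)) \<and>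
     (\<forall>i<n. \<forall>j<n. \<Phi> (v i j) = (\<Sum>k<n. tens (v i k) (v k j)))"

text \<open>A subspace of \<open>\<complex>\<^sup>n\<close> is represented by its orthogonal projection \<open>p\<close>; it is invariant under \<open>v\<close>
  iff \<open>(p \<otimes> 1) v (p \<otimes> 1) = v (p \<otimes> 1)\<close>.\<close>

definition orth_projection :: "nat \<Rightarrow> (nat \<Rightarrow> nat \<Rightarrow> complex) \<Rightarrow> bool" where
  "orth_projection n p \<longleftrightarrow>
     (\<forall>i<n. \<forall>j<n. p i j = cnj (p j i) \<and> (\<Sum>k<n. p i k * p k j) = p i j)"

definition invariant_subspace ::
    "nat \<Rightarrow> (nat \<Rightarrow> nat \<Rightarrow> 'a::cstar_algebra) \<Rightarrow> (nat \<Rightarrow> nat \<Rightarrow> complex) \<Rightarrow> bool" where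
  "invariant_subspace n v p \<longleftrightarrow> orth_projection n p \<and>
     (\<forall>i<n. \<forall>j<n. (\<Sum>k<n. \<Sum>l<n. (p i k * p l j) *\<^sub>C v k l) = (\<Sum>l<n. p l j *\<^sub>C v i l))"

definition irreducible_unitary_rep ::
    "('a::cstar_algebra \<Rightarrow> 'a \<Rightarrow> 'c::cstar_algebra) \<Rightarrow> ('a \<Rightarrow> 'c) \<Rightarrow> nat \<Rightarrow> (nat \<Rightarrow> nat \<Rightarrow> 'a) \<Rightarrow> bool"
  where
  "irreducible_unitary_rep tens \<Phi> n v \<longleftrightarrow> 0 < n \<and> unitary_rep tens \<Phi> n v \<and>
     (\<forall>p. invariant_subspace n v p \<longrightarrow>
        (\<forall>i<n. \<forall>j<n. p i j = 0) \<or> (\<forall>i<n. \<forall>j<n. p i j = (if i = j then 1 else 0)))"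

definition rep_character :: "nat \<Rightarrow> (nat \<Rightarrow> nat \<Rightarrow> 'a::cstar_algebra) \<Rightarrow> 'a" where
  "rep_character n v = (\<Sum>i<n. v i i)"

definition Aut :: "('a::cstar_algebra \<Rightarrow> 'a \<Rightarrow> 'c::cstar_algebra) \<Rightarrow> ('a \<Rightarrow> 'c) \<Rightarrow> ('a \<Rightarrow> 'a) set"
  where
  "Aut tens \<Phi> = {\<theta>. star_hom \<theta> \<and> bij \<theta> \<and> (\<exists>F. is_tensor_hom tens \<theta> \<theta> F \<and> F \<circ> \<Phi> = \<Phi> \<circ> \<theta>)}"

definition Aut_chi :: "('a::cstar_algebra \<Rightarrow> 'a \<Rightarrow> 'c::cstar_algebra) \<Rightarrow> ('a \<Rightarrow> 'c) \<Rightarrow> ('a \<Rightarrow> 'a) set"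
  where
  "Aut_chi tens \<Phi> = {\<theta> \<in> Aut tens \<Phi>. \<forall>n v. irreducible_unitary_rep tens \<Phi> n v \<longrightarrow>
     \<theta> (rep_character n v) = rep_character n v}"


section \<open>The quantum group \<open>SU\<^sub>q(2)\<close>\<close>

datatype SUq2_gen = Alpha | Gamma

definition SUq2_relators :: "real \<Rightarrow> SUq2_gen free_alg set" where
  "SUq2_relators q =
     (let a = free_gen Alpha; c = free_gen Gamma; a' = free_adj a; c' = free_adj c;
          q' = complex_of_real q
      in {a' * a + c' * c - 1,
          a * a' + free_scale (q'\<^sup>2) (c * c') - 1,
          a * c - free_scale q' (c * a),
          a * c' - free_scale q' (c' * a),
          c * c' - c' * c})"

definition is_SUq2 :: "real \<Rightarrow> 'a::cstar_algebra \<Rightarrow> 'a \<Rightarrow> bool" where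
  "is_SUq2 q \<alpha> \<gamma> \<longleftrightarrow>
     universal_cstar (SUq2_relators q) (\<lambda>g. case g of Alpha \<Rightarrow> \<alpha> | Gamma \<Rightarrow> \<gamma>)"

definition SUq2_matrix :: "real \<Rightarrow> 'a::cstar_algebra \<Rightarrow> 'a \<Rightarrow> nat \<Rightarrow> nat \<Rightarrow> 'a" where
  "SUq2_matrix q \<alpha> \<gamma> i j =
     (if i = 0 then (if j = 0 then \<alpha> else - (complex_of_real q *\<^sub>C adj \<gamma>))
      else (if j = 0 then \<gamma> else adj \<alpha>))"

definition is_SUq2_comult ::
    "real \<Rightarrow> 'a::cstar_algebra \<Rightarrow> 'a \<Rightarrow> ('a \<Rightarrow> 'a \<Rightarrow> 'c::cstar_algebra) \<Rightarrow> ('a \<Rightarrow> 'c) \<Rightarrow> bool" where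
  "is_SUq2_comult q \<alpha> \<gamma> tens \<Phi> \<longleftrightarrow> star_hom \<Phi> \<and>
     (let u = SUq2_matrix q \<alpha> \<gamma>
      in \<forall>i<2. \<forall>j<2. \<Phi> (u i j) = (\<Sum>k<2. tens (u i k) (u k j)))"

definition is_canonical_surjection ::
    "'a::cstar_algebra \<Rightarrow> 'a \<Rightarrow> ('a \<Rightarrow> (circle \<Rightarrow>\<^sub>C complex)) \<Rightarrow> bool" where
  "is_canonical_surjection \<alpha> \<gamma> \<rho> \<longleftrightarrow> star_hom \<rho> \<and> \<rho> \<alpha> = circle_coord \<and> \<rho> \<gamma> = 0"

end

theory Submission
  imports Defs
begin

text \<open>
  Let \<open>h = \<gamma>\<^sup>*\<gamma>\<close>. The commutation relations give \<open>h\<^sup>n (1 - h) = q\<^bsup>2n\<^esup> \<alpha>\<^sup>* h\<^sup>n \<alpha>\<close>, so \<open>h\<^sup>n\<close> converges in norm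
  to a projection \<open>p\<close> with \<open>h p = p\<close> and \<open>\<alpha> p = 0\<close>, and the \<open>e\<^sub>k = \<alpha>\<^sup>*\<^sup>k p\<close> satisfy
  \<open>h e\<^sub>k = q\<^bsup>2k\<^esup> e\<^sub>k\<close>. For a unit complex number \<open>z\<close> let \<open>L\<^sub>z\<close>, \<open>R\<^sub>z\<close> be the left and right translations by \<open>z\<close>,
  an element of the circle \<open>S\<^sup>1\<close>. They satisfy \<open>(R\<^sub>z \<otimes> id) \<Phi> = (id \<otimes> L\<^sub>z) \<Phi>\<close>, hence act on every unitary
  representation \<open>v\<close> by \<open>L\<^sub>z v = D v\<close>, \<open>R\<^sub>z v = v D\<close> with one scalar matrix \<open>D\<close>; in particular
  \<open>L\<^sub>z \<chi>\<^sub>v = R\<^sub>z \<chi>\<^sub>v\<close>.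

  For an automorphism \<open>\<theta>\<close> and \<open>v = \<theta>(u)\<close> the matrix \<open>D\<close> is diagonal since \<open>q\<^sup>2 \<noteq> 1\<close>, so \<open>\<theta>(\<alpha>)\<close> and
  \<open>\<theta>(\<gamma>)\<close> are homogeneous for the two circle actions. Homogeneity determines \<open>\<theta>\<close> on the \<open>e\<^sub>k\<close>: the
  weight cannot be negative, as this would force \<open>p = 0\<close>, and comparing \<open>\<theta>\<close> with its inverse shows that
  \<open>\<theta>(p) = p\<close>, \<open>\<theta>(e\<^sub>k) = c\<^sub>k e\<^sub>k\<close> and \<open>\<theta>(\<gamma>) p = \<mu> \<gamma> p\<close> with \<open>\<bar>\<mu>\<bar> = 1\<close>. Homogeneous elements that kill all
  \<open>e\<^sub>k\<close> vanish, whence \<open>\<theta>(h) = h\<close>; comparing coefficients in \<open>\<Phi>(h) (e\<^sub>k \<otimes> p)\<close> and \<open>\<Phi>(\<alpha>) (p \<otimes> p)\<close> yields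
  \<open>c\<^sub>k = 1\<close>. Thus \<open>\<theta>(\<alpha>) = \<alpha>\<close> and \<open>\<theta>(\<gamma>) = \<mu> \<gamma>\<close>, i.e. \<open>\<theta> = L\<^sub>z R\<^bsub>1/z\<^esub>\<close> with \<open>z\<^bsup>-2\<^esup> = \<mu>\<close>, which fixes all
  characters and is invisible to \<open>\<rho>\<close>.
\<close>

section \<open>C*-algebras and their homomorphisms\<close>

text \<open>The algebra is accessible only through its universal property, so facts usually read off
  from a faithful representation are extracted from the relations by norm estimates. The one
  concrete input is an action on finitely supported sequences, which gives \<open>norm h = 1\<close>
  and hence \<open>p \<noteq> 0\<close>. After that, the \<open>e k\<close> imitate the basis
  vectors inside the algebra, where automorphisms act on them directly. Two circle actions are taken
  because the pair of weights fixes both the signed degree in \<alpha> and the difference of the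
  exponents of \<gamma> and its adjoint; only powers of \<open>h\<close> remain free. One rotation
  \<open>z0\<close> of infinite order separates all weights, and averages over its powers take the
  place of integrals over the circle. The main obstacle is that a homogeneous \<open>y\<close> with
  \<open>y * e k = 0\<close> for all \<open>k\<close> vanishes. Passing to \<open>adj y * y\<close>
  leads to limits of polynomials in \<open>h\<close>, where the eigenvalues \<open>t ^ k\<close>
  accumulate at 0. So two things are shown in turn: such an element is annihilated by
  \<open>h\<close>, and its value at 0 is the limit of its values at the
  \<open>t ^ k\<close>.\<close>

lemma scaleC_zero_right [simp]: "c *\<^sub>C (0::'a::cstar_algebra) = 0"
  using scaleC_add_right[of c "0::'a" 0] by simp

lemma scaleC_zero_left [simp]: "0 *\<^sub>C (x::'a::cstar_algebra) = 0"
  using scaleC_add_left[of 0 0 x] by simp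

lemma scaleC_minus_right: "c *\<^sub>C (- (x::'a::cstar_algebra)) = - (c *\<^sub>C x)"
  by (metis add.right_inverse add_eq_0_iff scaleC_add_right scaleC_zero_right)

lemma scaleC_minus_left: "(- c) *\<^sub>C (x::'a::cstar_algebra) = - (c *\<^sub>C x)"
  by (metis add.right_inverse add_eq_0_iff scaleC_add_left scaleC_zero_left)

lemma scaleC_diff_right: "c *\<^sub>C ((x::'a::cstar_algebra) - y) = c *\<^sub>C x - c *\<^sub>C y"
  by (metis diff_conv_add_uminus scaleC_add_right scaleC_minus_right)

lemma scaleC_diff_left: "(c - d) *\<^sub>C (x::'a::cstar_algebra) = c *\<^sub>C x - d *\<^sub>C x"
  by (metis diff_conv_add_uminus scaleC_add_left scaleC_minus_left)

lemma scaleC_eq_0_iff: "c *\<^sub>C (x::'a::cstar_algebra) = 0 \<longleftrightarrow> c = 0 \<or> x = 0"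
  by (metis mult_eq_0_iff norm_eq_zero norm_scaleC)

lemma scaleC_cancel: "c *\<^sub>C (x::'a::cstar_algebra) = d *\<^sub>C x \<Longrightarrow> x \<noteq> 0 \<Longrightarrow> c = d"
  by (metis eq_iff_diff_eq_0 scaleC_diff_left scaleC_eq_0_iff)

lemma adj_zero [simp]: "adj (0::'a::cstar_algebra) = 0"
  using adj_add[of "0::'a" 0] by simp

lemma adj_minus: "adj (- (x::'a::cstar_algebra)) = - adj x"
  by (metis add.right_inverse add_eq_0_iff adj_add adj_zero)

lemma adj_diff: "adj ((x::'a::cstar_algebra) - y) = adj x - adj y"
  by (metis diff_conv_add_uminus adj_add adj_minus)

lemma adj_one [simp]: "adj (1::'a::cstar_algebra) = 1"
  by (metis adj_adj adj_mult mult.right_neutral mult_1)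

lemma adj_scaleR: "adj (r *\<^sub>R (x::'a::cstar_algebra)) = r *\<^sub>R adj x"
  by (simp add: scaleR_scaleC adj_scaleC)

lemma norm_adj [simp]: "norm (adj (x::'a::cstar_algebra)) = norm x"
proof -
  have le: "norm w \<le> norm (adj w)" for w :: 'a
  proof (cases "norm w = 0")
    case False
    have "norm w * norm w \<le> norm (adj w) * norm w"
      using norm_mult_ineq[of "adj w" w] by (simp add: cstar_identity power2_eq_square)
    then show ?thesis using False by simp
  qed simp
  show ?thesis using le[of x] le[of "adj x"] by (simp add: adj_adj)
qed

lemma adj_mult_eq_0: "adj (x::'a::cstar_algebra) * x = 0 \<Longrightarrow> x = 0"
  by (metis cstar_identity norm_eq_zero zero_eq_power2)

lemma norm_sq_selfadj: "adj (x::'a::cstar_algebra) = x \<Longrightarrow> norm (x * x) = (norm x)\<^sup>2"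
  by (metis cstar_identity)

lemma adj_sum: "adj (sum f A) = (\<Sum>i\<in>A. adj (f i :: 'a::cstar_algebra))"
  by (induction A rule: infinite_finite_induct) (auto simp: adj_add)

lemma adj_power: "adj (x ^ n) = (adj x :: 'a::cstar_algebra) ^ n"
  by (induction n) (auto simp: adj_mult power_commutes)

lemma scaleC_sum_right: "c *\<^sub>C sum f A = (\<Sum>i\<in>A. c *\<^sub>C (f i :: 'a::cstar_algebra))"
  by (induction A rule: infinite_finite_induct) (auto simp: scaleC_add_right)

lemma scaleC_sum_left: "sum c A *\<^sub>C x = (\<Sum>i\<in>A. c i *\<^sub>C (x :: 'a::cstar_algebra))"
  by (induction A rule: infinite_finite_induct) (auto simp: scaleC_add_left)

lemma scaleC_power: "(c *\<^sub>C x) ^ n = (c ^ n) *\<^sub>C ((x :: 'a::cstar_algebra) ^ n)"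
  by (induction n) (auto simp: mult_scaleC_left mult_scaleC_right scaleC_scaleC scaleC_one mult.commute)

lemma bounded_linear_adj: "bounded_linear (adj :: 'a::cstar_algebra \<Rightarrow> 'a)"
  by (rule bounded_linear_intro[where K = 1]) (auto simp: adj_add adj_scaleR)

lemma scaleC_scaleR_commute: "c *\<^sub>C (r *\<^sub>R x) = r *\<^sub>R (c *\<^sub>C (x::'a::cstar_algebra))"
  by (simp add: scaleR_scaleC scaleC_scaleC mult.commute)

lemma bounded_linear_scaleC: "bounded_linear (\<lambda>x :: 'a::cstar_algebra. c *\<^sub>C x)"
  by (rule bounded_linear_intro[where K = "cmod c"])
    (auto simp: scaleC_add_right norm_scaleC scaleC_scaleR_commute)

lemmas continuous_on_adj [continuous_intros] = bounded_linear.continuous_on[OF bounded_linear_adj]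
lemmas continuous_on_scaleC [continuous_intros] = bounded_linear.continuous_on[OF bounded_linear_scaleC]
lemmas tendsto_adj = bounded_linear.tendsto[OF bounded_linear_adj]

section \<open>Norms of powers, square roots and contractivity of homomorphisms\<close>

lemma selfadj_norm_pow2:
  fixes x :: "'a::cstar_algebra"
  assumes "adj x = x"
  shows "norm (x ^ (2 ^ i)) = norm x ^ (2 ^ i)"
proof (induction i)
  case (Suc i)
  have "adj (x ^ (2 ^ i)) = x ^ (2 ^ i)"
    using assms by (simp add: adj_power)
  then have "norm (x ^ (2 ^ i) * x ^ (2 ^ i)) = (norm (x ^ (2 ^ i)))\<^sup>2"
    by (rule norm_sq_selfadj)
  then show ?case
    using Suc by (simp add: power_mult power2_eq_square power_mult_distrib mult.commute[of 2])
qed simp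

text \<open>The C*-identity only reaches exponents that are powers of two. Splitting
  \<open>x ^ (2 ^ n)\<close> as \<open>x ^ n * x ^ (2 ^ n - n)\<close> and cancelling the second
  factor carries the equality to every exponent.\<close>

lemma selfadj_norm_power:
  fixes x :: "'a::cstar_algebra"
  assumes "adj x = x"
  shows "norm (x ^ n) = norm x ^ n"
proof (cases "norm x = 0")
  case True
  then show ?thesis by (cases n) auto
next
  case False
  have le: "n \<le> 2 ^ n" by (simp add: less_imp_le)
  have "norm x ^ (2 ^ n) = norm (x ^ n * x ^ (2 ^ n - n))"
    using le by (simp add: selfadj_norm_pow2[OF assms] flip: power_add)
  also have "\<dots> \<le> norm (x ^ n) * norm x ^ (2 ^ n - n)"
    by (meson norm_mult_ineq norm_power_ineq mult_left_mono norm_ge_zero order_trans)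
  finally have "norm x ^ n * norm x ^ (2 ^ n - n) \<le> norm (x ^ n) * norm x ^ (2 ^ n - n)"
    using le by (simp flip: power_add)
  then have "norm x ^ n \<le> norm (x ^ n)"
    using False by simp
  then show ?thesis using norm_power_ineq[of x n] by simp
qed

context
  fixes f :: "'a::cstar_algebra \<Rightarrow> 'b::cstar_algebra"
  assumes f: "star_hom f"
begin

lemma star_hom_add: "f (x + y) = f x + f y"
  using f by (simp add: star_hom_def)

lemma star_hom_scaleC: "f (c *\<^sub>C x) = c *\<^sub>C f x"
  using f by (simp add: star_hom_def)

lemma star_hom_mult: "f (x * y) = f x * f y"
  using f by (simp add: star_hom_def)

lemma star_hom_one: "f 1 = 1"
  using f by (simp add: star_hom_def)

lemma star_hom_adj: "f (adj x) = adj (f x)"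
  using f by (simp add: star_hom_def)

lemma star_hom_zero: "f 0 = 0"
  using star_hom_scaleC[of 0 0] by simp

lemma star_hom_minus: "f (- x) = - f x"
  by (metis add.right_inverse add_eq_0_iff star_hom_add star_hom_zero)

lemma star_hom_diff: "f (x - y) = f x - f y"
  by (metis diff_conv_add_uminus star_hom_add star_hom_minus)

lemma star_hom_sum: "f (sum g A) = (\<Sum>i\<in>A. f (g i))"
  by (induction A rule: infinite_finite_induct) (auto simp: star_hom_add star_hom_zero)

lemma star_hom_power: "f (x ^ n) = f x ^ n"
  by (induction n) (auto simp: star_hom_mult star_hom_one)

lemmas star_hom_simps = star_hom_add star_hom_scaleC star_hom_mult star_hom_one star_hom_adj
  star_hom_zero star_hom_minus star_hom_diff star_hom_sum star_hom_power

end

text \<open>This crude bound is what lets a geometric series dominate the binomial series of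
  exponent 1/2 inside the open unit ball.\<close>

lemma abs_half_gbinomial_le_1: "\<bar>(1/2 :: real) gchoose n\<bar> \<le> 1"
proof (induction n)
  case (Suc n)
  have eq: "(1/2 :: real) gchoose Suc n = (1/2 gchoose n) * ((1/2 - n) / (n + 1))"
    using gbinomial_absorb_comp[of "1/2::real" n] gbinomial_absorption'[of "Suc n" "1/2::real"]
    by (simp add: gbinomial_mult_1' field_simps gbinomial_Suc_rec gbinomial_prod_rev prod.atLeast0_lessThan_Suc fact_Suc)
  have "\<bar>(1/2 - real n) / (n + 1)\<bar> \<le> 1"
    by (simp add: field_simps abs_if)
  then show ?case
    unfolding eq abs_mult using Suc by (intro mult_le_one) auto
qed simp

text \<open>The binomial series of \<open>(1 - a\<^sup>2)\<^sup>1\<^sup>/\<^sup>2\<close>.\<close>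

lemma selfadj_sqrt:
  fixes a :: "'a::cstar_algebra"
  assumes "adj a = a" and "norm a < 1"
  obtains b where "adj b = b" "a * b = b * a" "a * a + b * b = 1"
proof -
  define t where "t n = ((1/2::real) gchoose n) *\<^sub>R (- (a * a)) ^ n" for n
  have lt: "norm a * norm a < 1"
    using assms(2) by (metis mult_less_cancel_left1 mult_strict_mono' norm_ge_zero mult_1 zero_less_one)
  have le: "norm (t n) \<le> (norm a * norm a) ^ n" for n
  proof -
    have "norm ((- (a * a)) ^ n) \<le> (norm a * norm a) ^ n"
      by (metis norm_power_ineq norm_minus_cancel norm_mult_ineq norm_ge_zero order_trans power_mono)
    then show ?thesis
      unfolding t_def norm_scaleR using abs_half_gbinomial_le_1[of n]
      by (meson abs_ge_zero mult_left_le_one_le norm_ge_zero order_trans)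
  qed
  have sn: "summable (\<lambda>n. norm (t n))"
    by (rule summable_comparison_test'[of "\<lambda>n. (norm a * norm a) ^ n" 0])
      (use lt le in \<open>auto intro: summable_geometric\<close>)
  then have s: "summable t" by (rule summable_norm_cancel)
  define b where "b = suminf t"
  have adjt: "adj (t n) = t n" for n
    by (simp add: t_def adj_scaleR adj_power adj_minus adj_mult assms(1))
  have com: "a * t n = t n * a" for n
    unfolding t_def by (simp add: power_commuting_commutes mult.assoc)
  have 1: "adj b = b"
    unfolding b_def using bounded_linear.suminf[OF bounded_linear_adj s] by (simp add: adjt)
  have 2: "a * b = b * a"
    unfolding b_def using s by (simp add: suminf_mult[symmetric] suminf_mult2 com)
  \<comment> \<open>Vandermonde's identity turns the Cauchy square of the series of exponent 1/2
    into the binomial series of exponent 1, which stops after \<open>k = 1\<close>.\<close>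
  have coef: "(\<Sum>i\<le>k. t i * t (k - i)) = ((1::real) gchoose k) *\<^sub>R (- (a * a)) ^ k" for k
  proof -
    have "(\<Sum>i\<le>k. t i * t (k - i)) = (\<Sum>i\<le>k. ((1/2 gchoose i) * (1/2 gchoose (k - i))) *\<^sub>R (- (a * a)) ^ k)"
      by (rule sum.cong) (auto simp: t_def simp flip: power_add)
    also have "\<dots> = (\<Sum>i\<le>k. (1/2 gchoose i) * ((1/2::real) gchoose (k - i))) *\<^sub>R (- (a * a)) ^ k"
      by (simp add: scaleR_left.sum)
    also have "(\<Sum>i\<le>k. (1/2 gchoose i) * ((1/2::real) gchoose (k - i))) = 1 gchoose k"
      using gbinomial_Vandermonde[of "1/2::real" "1/2" k] by (simp add: atMost_atLeast0)
    finally show ?thesis .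
  qed
  have z: "((1::real) gchoose k) = 0" if "k \<notin> {0,1}" for k
  proof -
    have "((1::real) gchoose k) = of_nat (1 choose k)"
      by (metis binomial_gbinomial of_nat_1)
    then show ?thesis using that by (auto simp: binomial_eq_0)
  qed
  have "b * b = suminf (\<lambda>k. ((1::real) gchoose k) *\<^sub>R (- (a * a)) ^ k)"
    unfolding b_def by (subst Cauchy_product[OF sn sn]) (simp only: coef)
  also have "\<dots> = (\<Sum>k\<in>{0,1}. ((1::real) gchoose k) *\<^sub>R (- (a * a)) ^ k)"
    by (rule suminf_finite) (auto simp: z)
  also have "\<dots> = 1 - a * a" by simp
  finally have "b * b = 1 - a * a" .
  then show ?thesis using that[OF 1 2] by simp
qed

text \<open>If \<open>a\<^sup>2 + b\<^sup>2 = 1\<close> then \<open>f a\<close> is the real part of the unitary \<open>f a + i f b\<close>; this makes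
  continuity of homomorphisms automatic without any spectral theory.\<close>

lemma star_hom_norm_le:
  fixes f :: "'a::cstar_algebra \<Rightarrow> 'b::cstar_algebra"
  assumes f: "star_hom f"
  shows "norm (f x) \<le> norm x"
proof -
  note simps = star_hom_simps[OF f]
  have selfadj: "norm (f a) \<le> 1" if a: "adj a = a" "norm a < 1" for a
  proof -
    obtain b where b: "adj b = b" "a * b = b * a" "a * a + b * b = 1"
      using selfadj_sqrt[OF a] by blast
    define u where "u = f a + \<i> *\<^sub>C f b"
    have adju: "adj u = f a - \<i> *\<^sub>C f b"
      using a b by (simp add: u_def adj_add adj_scaleC scaleC_minus_left flip: simps)
    have "adj u * u = (f a - \<i> *\<^sub>C f b) * (f a + \<i> *\<^sub>C f b)"
      by (simp only: adju) (simp only: u_def)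
    also have "\<dots> = f (a * a + b * b) + \<i> *\<^sub>C f (a * b - b * a)"
      by (simp add: simps algebra_simps mult_scaleC_left mult_scaleC_right scaleC_scaleC
          scaleC_minus_left scaleC_one scaleC_diff_right)
    finally have "norm (adj u * u) = 1"
      by (simp add: b simps)
    then have nu: "norm u = 1"
      by (simp add: cstar_identity power2_eq_1_iff) (metis norm_ge_zero not_one_le_zero neg_0_le_iff_le)
    have "(2::real) *\<^sub>R f a = u + adj u"
      by (simp only: adju) (simp add: u_def scaleR_2)
    then have "2 * norm (f a) \<le> 2"
      using norm_triangle_ineq[of u "adj u"] nu by (metis norm_adj norm_scaleR abs_numeral one_add_one)
    then show ?thesis by simp
  qed
  have lt: "norm (f y) \<le> 1" if "norm y < 1" for y
  proof -
    have "norm (adj y * y) < 1"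
      using that by (simp add: cstar_identity power_less_one_iff abs_square_less_1)
    then have "norm (f (adj y * y)) \<le> 1"
      by (intro selfadj) (auto simp: adj_mult adj_adj)
    then show ?thesis
      by (simp add: simps cstar_identity power_le_one_iff)
  qed
  show ?thesis
  proof (rule field_le_epsilon)
    fix e :: real assume e: "e > 0"
    \<comment> \<open>The extra \<open>e\<close> keeps the rescaled element strictly inside the unit
      ball, where the square root series converges; it also covers \<open>x = 0\<close>.\<close>
    define r where "r = norm x + e"
    have r: "r > 0" using e by (simp add: r_def add_nonneg_pos)
    have "norm ((1/r) *\<^sub>R x) < 1"
      using r e by (simp add: r_def field_simps)
    then have "norm (f ((1/r) *\<^sub>R x)) \<le> 1" by (rule lt)
    then have "norm (f x) / r \<le> 1"
      using r by (simp add: scaleR_scaleC simps norm_scaleC norm_divide)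
    then show "norm (f x) \<le> norm x + e"
      using r by (simp add: r_def field_simps)
  qed
qed

lemma star_hom_bounded_linear: "star_hom f \<Longrightarrow> bounded_linear f"
  by (rule bounded_linear_intro[where K = 1])
    (simp_all add: star_hom_add star_hom_scaleC scaleR_scaleC star_hom_norm_le)

lemmas continuous_on_star_hom = bounded_linear.continuous_on[OF star_hom_bounded_linear]
lemmas tendsto_star_hom = bounded_linear.tendsto[OF star_hom_bounded_linear]

lemma star_hom_comp:
  assumes "star_hom f" "star_hom g"
  shows "star_hom (\<lambda>x. f (g x))"
  unfolding star_hom_def by (simp add: star_hom_simps[OF assms(1)] star_hom_simps[OF assms(2)])

lemma star_hom_id: "star_hom (\<lambda>x::'b::cstar_algebra. x)"
  by (simp add: star_hom_def)

lemma star_hom_inv: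
  assumes "star_hom f" "bij f"
  shows "star_hom (inv f)"
proof -
  have s: "f (inv f y) = y" for y using assms(2) by (simp add: bij_is_surj surj_f_inv_f)
  have inj: "f a = f b \<Longrightarrow> a = b" for a b using assms(2) by (simp add: bij_is_inj inj_eq)
  show ?thesis
    unfolding star_hom_def by (intro conjI allI; rule inj) (simp_all add: s star_hom_simps[OF assms(1)])
qed

section \<open>Density arguments and extension by continuity\<close>

lemma dense_induct:
  assumes "closure S = UNIV" "closed {x. P x}" "\<And>x. x \<in> S \<Longrightarrow> P x"
  shows "P x"
proof -
  have "closure S \<subseteq> {x. P x}" using assms by (intro closure_minimal) auto
  then show ?thesis using assms(1) by auto
qed

text \<open>Contractivity makes \<open>f\<close> uniformly continuous on \<open>S\<close>, so it
  extends to the closure; each identity then passes to the limit in one variable at a time. It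
  serves both the universal property and the construction of tensor products of maps.\<close>

lemma star_hom_extension:
  fixes f :: "'a::cstar_algebra \<Rightarrow> 'b::cstar_algebra"
  assumes dense: "closure S = UNIV"
    and S: "1 \<in> S" "\<And>x y. x \<in> S \<Longrightarrow> y \<in> S \<Longrightarrow> x + y \<in> S"
      "\<And>x y. x \<in> S \<Longrightarrow> y \<in> S \<Longrightarrow> x * y \<in> S" "\<And>c x. x \<in> S \<Longrightarrow> c *\<^sub>C x \<in> S" "\<And>x. x \<in> S \<Longrightarrow> adj x \<in> S"
    and f: "f 1 = 1" "\<And>x y. x \<in> S \<Longrightarrow> y \<in> S \<Longrightarrow> f (x + y) = f x + f y"
      "\<And>x y. x \<in> S \<Longrightarrow> y \<in> S \<Longrightarrow> f (x * y) = f x * f y" "\<And>c x. x \<in> S \<Longrightarrow> f (c *\<^sub>C x) = c *\<^sub>C f x"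
      "\<And>x. x \<in> S \<Longrightarrow> f (adj x) = adj (f x)"
    and le: "\<And>x. x \<in> S \<Longrightarrow> norm (f x) \<le> norm x"
  obtains g where "star_hom g" "\<And>x. x \<in> S \<Longrightarrow> g x = f x"
proof -
  have minus: "x - y = x + (- 1) *\<^sub>C y" for x y :: "'c::cstar_algebra"
    by (simp add: scaleC_minus_left scaleC_one)
  have diff: "f x - f y = f (x - y)" "x - y \<in> S" if "x \<in> S" "y \<in> S" for x y
    using that S f by (simp_all only: minus)
  have uf: "uniformly_continuous_on S f"
    unfolding uniformly_continuous_on_def dist_norm
  proof (intro allI impI exI conjI ballI)
    fix e :: real and x y assume "0 < e" "x \<in> S" "y \<in> S" "norm (y - x) < e"
    then show "norm (f y - f x) < e"
      using le[OF diff(2)[of y x]] diff(1)[of y x] by simp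
  qed
  obtain g where uc: "uniformly_continuous_on (closure S) g" and gf: "\<And>x. x \<in> S \<Longrightarrow> f x = g x"
    by (rule uniformly_continuous_on_extension_on_closure[OF uf]) (rule that; assumption)
  have cg: "continuous_on UNIV g"
    using uc dense uniformly_continuous_imp_continuous by metis
  have c [continuous_intros]: "continuous_on UNIV (\<lambda>x. g (h x))" if "continuous_on UNIV h" for h :: "'a \<Rightarrow> 'a"
    using continuous_on_compose2[OF cg that] by auto
  have add: "g (x + y) = g x + g y" for x y
  proof (rule dense_induct[OF dense, where x = y])
    fix y assume y: "y \<in> S"
    show "g (x + y) = g x + g y"
      by (rule dense_induct[OF dense, where x = x])
        (auto simp: S f y simp flip: gf intro!: closed_Collect_eq continuous_intros cg)
  qed (intro closed_Collect_eq continuous_intros cg)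
  have mult: "g (x * y) = g x * g y" for x y
  proof (rule dense_induct[OF dense, where x = y])
    fix y assume y: "y \<in> S"
    show "g (x * y) = g x * g y"
      by (rule dense_induct[OF dense, where x = x])
        (auto simp: S f y simp flip: gf intro!: closed_Collect_eq continuous_intros cg)
  qed (intro closed_Collect_eq continuous_intros cg)
  have scale: "g (c *\<^sub>C x) = c *\<^sub>C g x" for c x
    by (rule dense_induct[OF dense, where x = x])
      (auto simp: S f simp flip: gf intro!: closed_Collect_eq continuous_intros cg)
  have adj: "g (adj x) = adj (g x)" for x
    by (rule dense_induct[OF dense, where x = x])
      (auto simp: S f simp flip: gf intro!: closed_Collect_eq continuous_intros cg)
  have "star_hom g"
    unfolding star_hom_def using add mult scale adj S f gf by metis
  with gf show ?thesis by (metis that)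
qed

section \<open>Free and universal algebras\<close>

text \<open>An element is the sum of its monomials. In the free algebra this acts as an induction
  principle that reduces identities to single words.\<close>

lemma additive_poly_mapping_eq:
  fixes f g :: "('w \<Rightarrow>\<^sub>0 'b::comm_monoid_add) \<Rightarrow> 'c::comm_monoid_add"
  assumes "\<And>p q. f (p + q) = f p + f q" "\<And>p q. g (p + q) = g p + g q"
    and "f 0 = g 0" "\<And>w c. f (Poly_Mapping.single w c) = g (Poly_Mapping.single w c)"
  shows "f p = g p"
proof -
  have "f (sum h A) = g (sum h A)" if "\<And>w. w \<in> A \<Longrightarrow> f (h w) = g (h w)" for h and A :: "'w set"
    using that by (induction A rule: infinite_finite_induct) (auto simp: assms(1-3))
  moreover have "p = (\<Sum>w\<in>Poly_Mapping.keys p. Poly_Mapping.single w (Poly_Mapping.lookup p w))"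
    by (rule poly_mapping_eqI) (simp add: lookup_sum lookup_single when_def in_keys_iff)
  ultimately show ?thesis using assms(4) by metis
qed

lemma sum_keys_single:
  assumes "\<And>w. T w 0 = (0::'c::comm_monoid_add)"
  shows "(\<Sum>w\<in>Poly_Mapping.keys (Poly_Mapping.single v c). T w (Poly_Mapping.lookup (Poly_Mapping.single v c) w)) = T v c"
  using assms by (cases "c = 0") auto

text \<open>Cancellation may make the support of \<open>p + q\<close> smaller than the union of the
  supports, so all three sums are first extended to that union by zero terms.\<close>

lemma sum_keys_add:
  assumes "\<And>w. T w 0 = (0::'c::comm_monoid_add)" "\<And>w c d. T w (c + d) = T w c + T w d"
  shows "(\<Sum>w\<in>Poly_Mapping.keys (p + q). T w (Poly_Mapping.lookup (p + q) w)) =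
    (\<Sum>w\<in>Poly_Mapping.keys p. T w (Poly_Mapping.lookup p w)) +
    (\<Sum>w\<in>Poly_Mapping.keys q. T w (Poly_Mapping.lookup q w))"
proof -
  let ?S = "Poly_Mapping.keys p \<union> Poly_Mapping.keys q"
  have *: "(\<Sum>w\<in>Poly_Mapping.keys r. T w (Poly_Mapping.lookup r w)) = (\<Sum>w\<in>?S. T w (Poly_Mapping.lookup r w))"
    if "Poly_Mapping.keys r \<subseteq> ?S" for r
    by (rule sum.mono_neutral_left) (use that assms(1) in \<open>auto simp: in_keys_iff\<close>)
  show ?thesis
    by (subst (1 2 3) *) (auto simp: Poly_Mapping.keys_add lookup_add assms(2) sum.distrib
        dest: subsetD[OF Poly_Mapping.keys_add])
qed

section \<open>Evaluation of words and of free algebra elements\<close>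

definition word_eval :: "('g \<Rightarrow> 'a::cstar_algebra) \<Rightarrow> 'g star_word \<Rightarrow> 'a" where
  "word_eval e w = prod_list (map (\<lambda>(g, b). if b then adj (e g) else e g) (letters w))"

definition word_adj :: "'g star_word \<Rightarrow> 'g star_word" where
  "word_adj w = Star_Word (rev (map (\<lambda>(g, b). (g, \<not> b)) (letters w)))"

lemma word_eval_plus: "word_eval e (v + w) = word_eval e v * word_eval e w"
  by (simp add: word_eval_def plus_star_word_def)

lemma word_eval_zero [simp]: "word_eval e 0 = 1"
  by (simp add: word_eval_def zero_star_word_def)

lemma word_eval_adj: "word_eval e (word_adj w) = adj (word_eval e w)"
proof -
  have "prod_list (map (\<lambda>(g, b). if b then adj (e g) else e g) (rev (map (\<lambda>(g, b). (g, \<not> b)) l)))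
    = adj (prod_list (map (\<lambda>(g, b). if b then adj (e g) else e g) l))" for l
    by (induction l) (auto simp: adj_mult adj_adj split: if_splits)
  then show ?thesis by (simp add: word_eval_def word_adj_def)
qed

lemma free_eval_word: "free_eval e p = (\<Sum>w\<in>Poly_Mapping.keys p. Poly_Mapping.lookup p w *\<^sub>C word_eval e w)"
  by (simp add: free_eval_def word_eval_def)

lemma free_eval_single [simp]: "free_eval e (Poly_Mapping.single w c) = c *\<^sub>C word_eval e w"
  unfolding free_eval_word by (rule sum_keys_single) simp

lemma free_eval_add: "free_eval e (p + q) = free_eval e p + free_eval e q"
  unfolding free_eval_word by (rule sum_keys_add) (simp_all add: scaleC_add_left)

lemma free_eval_zero [simp]: "free_eval e 0 = 0"
  by (simp add: free_eval_word)

lemma free_eval_uminus: "free_eval e (- p) = - free_eval e p"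
  by (metis add.right_inverse add_eq_0_iff free_eval_add free_eval_zero)

lemma free_eval_diff: "free_eval e (p - q) = free_eval e p - free_eval e q"
  by (metis diff_conv_add_uminus free_eval_add free_eval_uminus)

lemma free_eval_one [simp]: "free_eval e 1 = 1"
  by (simp add: scaleC_one flip: single_one)

lemma free_eval_mult: "free_eval e (p * q) = free_eval e p * free_eval e q"
proof (rule additive_poly_mapping_eq[where p = p])
  fix v c
  show "free_eval e (Poly_Mapping.single v c * q) = free_eval e (Poly_Mapping.single v c) * free_eval e q"
    by (rule additive_poly_mapping_eq[where p = q])
      (auto simp: distrib_left free_eval_add mult_single word_eval_plus mult_scaleC_left
        mult_scaleC_right scaleC_scaleC mult.commute)
qed (auto simp: distrib_right free_eval_add)

lemma free_eval_scale: "free_eval e (free_scale c p) = c *\<^sub>C free_eval e p"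
  by (simp add: free_scale_def free_eval_mult mult_scaleC_left)

lemma free_adj_single: "free_adj (Poly_Mapping.single w c) = Poly_Mapping.single (word_adj w) (cnj c)"
  unfolding free_adj_def word_adj_def[symmetric] by (rule sum_keys_single) simp

lemma free_adj_add: "free_adj (p + q) = free_adj p + free_adj q"
  unfolding free_adj_def by (rule sum_keys_add) (simp_all add: single_add)

lemma free_adj_zero [simp]: "free_adj 0 = 0"
  by (simp add: free_adj_def)

lemma free_eval_adj: "free_eval e (free_adj p) = adj (free_eval e p)"
  by (rule additive_poly_mapping_eq[where p = p])
    (auto simp: free_adj_add free_eval_add adj_add free_adj_single word_eval_adj adj_scaleC)

lemma free_eval_gen [simp]: "free_eval e (free_gen g) = e g"
  by (simp add: free_gen_def word_eval_def scaleC_one)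

lemmas free_eval_simps = free_eval_add free_eval_diff free_eval_mult free_eval_scale free_eval_adj

text \<open>The norm pulled back along \<open>e'\<close> is one of the competing seminorms, so
  maximality bounds it by the norm pulled back along \<open>e\<close>. The same inequality shows
  that the chosen preimage in \<open>f\<close> does not matter and that \<open>f\<close> is
  contractive.\<close>

lemma universal_cstar_lift:
  fixes e :: "'g \<Rightarrow> 'a::cstar_algebra" and e' :: "'g \<Rightarrow> 'b::cstar_algebra"
  assumes u: "universal_cstar R e" and rel: "\<And>r. r \<in> R \<Longrightarrow> free_eval e' r = 0"
  obtains f where "star_hom f" "\<And>g. f (e g) = e' g"
proof -
  have "cstar_seminorm_on UNIV free_scale free_adj (\<lambda>p. norm (free_eval e' p))"
    by (simp add: cstar_seminorm_on_def free_eval_simps norm_triangle_ineq norm_scaleC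
        norm_mult_ineq cstar_identity)
  then have le: "norm (free_eval e' p) \<le> norm (free_eval e p)" for p
    using u rel unfolding universal_cstar_def by auto
  define f where "f x = free_eval e' (SOME p. free_eval e p = x)" for x
  have f: "f (free_eval e p) = free_eval e' p" for p
  proof -
    define p' where "p' = (SOME p'. free_eval e p' = free_eval e p)"
    have "free_eval e p' = free_eval e p" unfolding p'_def by (rule someI) simp
    then have "free_eval e' (p' - p) = 0"
      using le[of "p' - p"] by (simp add: free_eval_diff)
    then show ?thesis by (simp add: f_def p'_def free_eval_diff)
  qed
  obtain F where F: "star_hom F" "\<And>x. x \<in> range (free_eval e) \<Longrightarrow> F x = f x"
  proof (rule star_hom_extension[of "range (free_eval e)" f])
    show "closure (range (free_eval e)) = UNIV" using u by (simp add: universal_cstar_def)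
    show "1 \<in> range (free_eval e)" by (metis free_eval_one rangeI)
    show "f 1 = 1" by (metis f free_eval_one)
  qed (auto simp: f le simp flip: free_eval_simps)
  show ?thesis
    by (rule that[of F]) (use F f in \<open>metis free_eval_gen rangeI\<close>)+
qed

section \<open>The minimal tensor product\<close>

lemma min_tensor_indep_lessThan:
  assumes "min_tensor tens" "\<And>c. (\<Sum>i<n. c i *\<^sub>C b i) = 0 \<Longrightarrow> \<forall>i<n. c i = 0"
    and "(\<Sum>i<(n::nat). tens (a i) (b i)) = 0"
  shows "\<forall>i<n. a i = 0"
proof -
  have "\<forall>(n::nat) a b.
        (\<forall>c. (\<Sum>i<n. c i *\<^sub>C b i) = 0 \<longrightarrow> (\<forall>i<n. c i = 0)) \<and> (\<Sum>i<n. tens (a i) (b i)) = 0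
        \<longrightarrow> (\<forall>i<n. a i = 0)"
    using iffD1[OF min_tensor_def assms(1)] by (elim conjE)
  then show ?thesis using assms(2,3) by blast
qed

lemma min_tensor_minimal:
  assumes "min_tensor tens" "cstar_seminorm_on (alg_tensor tens) scaleC adj N"
    and "\<And>x. x \<in> alg_tensor tens \<Longrightarrow> N x = 0 \<Longrightarrow> x = 0" "x \<in> alg_tensor tens"
  shows "norm x \<le> N x"
proof -
  have "\<forall>N. cstar_seminorm_on (alg_tensor tens) scaleC adj N \<and>
          (\<forall>x\<in>alg_tensor tens. N x = 0 \<longrightarrow> x = 0) \<longrightarrow>
        (\<forall>x\<in>alg_tensor tens. norm x \<le> N x)"
    using iffD1[OF min_tensor_def assms(1)] by (elim conjE)
  then show ?thesis using assms(2-4) by blast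
qed

lemma min_tensor_indep:
  assumes "min_tensor tens" "finite I"
    and "\<And>c. (\<Sum>i\<in>I. c i *\<^sub>C b i) = 0 \<Longrightarrow> \<forall>i\<in>I. c i = 0"
    and "(\<Sum>i\<in>I. tens (a i) (b i)) = 0" "i \<in> I"
  shows "a i = 0"
proof -
  obtain h where h: "bij_betw h {..<card I} I"
    using ex_bij_betw_nat_finite[OF assms(2)] by (auto simp: atLeast0LessThan)
  have sum_h: "(\<Sum>k<card I. F (h k)) = (\<Sum>i\<in>I. F i)" for F :: "_ \<Rightarrow> 'z::comm_monoid_add"
    using sum.reindex_bij_betw[OF h, of F] by simp
  have "\<forall>k<card I. c k = 0" if "(\<Sum>k<card I. c k *\<^sub>C b (h k)) = 0" for c
  proof -
    have inv: "inv_into {..<card I} h (h k) = k" if "k < card I" for k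
      using h that by (auto simp: bij_betw_def)
    have "(\<Sum>i\<in>I. c (inv_into {..<card I} h i) *\<^sub>C b i) = 0"
      using that by (simp add: inv flip: sum_h)
    from assms(3)[OF this] show ?thesis
      using h inv by (metis bij_betwE lessThan_iff)
  qed
  moreover have "(\<Sum>k<card I. tens (a (h k)) (b (h k))) = 0"
    using assms(4) sum_h[of "\<lambda>i. tens (a i) (b i)"] by simp
  ultimately have "\<forall>k<card I. a (h k) = 0"
    by (intro min_tensor_indep_lessThan[OF assms(1)])
  then show ?thesis
    using h assms(5) by (metis bij_betw_imp_surj_on imageE lessThan_iff)
qed

context
  fixes tens :: "'a::cstar_algebra \<Rightarrow> 'b::cstar_algebra \<Rightarrow> 'c::cstar_algebra"
  assumes tens: "min_tensor tens"
begin

lemma tens_add_left: "tens (a + a') b = tens a b + tens a' b"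
  and tens_add_right: "tens a (b + b') = tens a b + tens a b'"
  and tens_scaleC_left: "tens (c *\<^sub>C a) b = c *\<^sub>C tens a b"
  and tens_scaleC_right: "tens a (c *\<^sub>C b) = c *\<^sub>C tens a b"
  and tens_mult: "tens a b * tens a' b' = tens (a * a') (b * b')"
  and tens_one: "tens 1 1 = 1"
  and tens_adj: "adj (tens a b) = tens (adj a) (adj b)"
  and tens_dense: "closure (alg_tensor tens) = UNIV"
proof -
  note parts = iffD1[OF min_tensor_def tens]
  show "tens (a + a') b = tens a b + tens a' b" using conjunct1[OF parts] by blast
  note parts = conjunct2[OF parts]
  show "tens a (b + b') = tens a b + tens a b'" using conjunct1[OF parts] by blast
  note parts = conjunct2[OF parts]
  show "tens (c *\<^sub>C a) b = c *\<^sub>C tens a b" using conjunct1[OF parts] by blast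
  note parts = conjunct2[OF parts]
  show "tens a (c *\<^sub>C b) = c *\<^sub>C tens a b" using conjunct1[OF parts] by blast
  note parts = conjunct2[OF parts]
  show "tens a b * tens a' b' = tens (a * a') (b * b')" using conjunct1[OF parts] by blast
  note parts = conjunct2[OF parts]
  show "tens 1 1 = 1" by (rule conjunct1[OF parts])
  note parts = conjunct2[OF parts]
  show "adj (tens a b) = tens (adj a) (adj b)" using conjunct1[OF parts] by blast
  note parts = conjunct2[OF conjunct2[OF parts]]
  show "closure (alg_tensor tens) = UNIV" by (rule conjunct1[OF parts])
qed

lemma tens_zero_left: "tens 0 b = 0"
  using tens_scaleC_left[of 0 0 b] by simp

lemma tens_zero_right: "tens a 0 = 0"
  using tens_scaleC_right[of a 0 0] by simp

lemma tens_minus_left: "tens (- a) b = - tens a b"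
  using tens_scaleC_left[of "- 1" a b] by (simp add: scaleC_minus_left scaleC_one)

lemma tens_sum_left: "tens (sum f I) b = (\<Sum>i\<in>I. tens (f i) b)"
  by (induction I rule: infinite_finite_induct) (auto simp: tens_zero_left tens_add_left)

lemma tens_sum_right: "tens a (sum f I) = (\<Sum>i\<in>I. tens a (f i))"
  by (induction I rule: infinite_finite_induct) (auto simp: tens_zero_right tens_add_right)

lemma tens_eq_0_imp: "tens a b = 0 \<Longrightarrow> b \<noteq> 0 \<Longrightarrow> a = 0"
  using min_tensor_indep[OF tens, of "{()}" "\<lambda>_. b" "\<lambda>_. a" "()"] by (auto simp: scaleC_eq_0_iff)

text \<open>If \<open>y\<close> were no scalar, \<open>1\<close> and \<open>y\<close> would be
  linearly independent. Reading the equation as a vanishing combination with left factors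
  \<open>- x\<close> and \<open>1\<close> would then force \<open>1 = 0\<close>. The Boolean index
  enumerates this two-element family.\<close>

lemma tens_one_eq_imp_scalar:
  assumes "tens x 1 = tens 1 y"
  obtains d where "x = d *\<^sub>C 1" "y = d *\<^sub>C 1"
proof (cases "\<exists>d. y = d *\<^sub>C 1")
  case True
  then obtain d where d: "y = d *\<^sub>C 1" by blast
  have "tens (x - d *\<^sub>C 1) 1 = 0"
    using assms tens_add_left[of x "- (d *\<^sub>C 1)" 1]
    by (simp add: d tens_scaleC_right tens_scaleC_left tens_minus_left)
  then have "x - d *\<^sub>C 1 = 0" by (rule tens_eq_0_imp) simp
  with d show ?thesis using that by simp
next
  case False
  let ?b = "\<lambda>i::bool. if i then y else 1" and ?a = "\<lambda>i::bool. if i then 1 else - x"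
  have "c i = 0" if "(\<Sum>i\<in>UNIV. c i *\<^sub>C ?b i) = 0" for c i
  proof -
    have s: "c True *\<^sub>C y + c False *\<^sub>C 1 = 0"
      using that by (simp add: UNIV_bool add.commute)
    have t: "c True = 0"
    proof (rule ccontr)
      assume t: "c True \<noteq> 0"
      have "y = (- c False / c True) *\<^sub>C 1"
      proof -
        have "c True *\<^sub>C y = - (c False *\<^sub>C 1)"
          using s by (simp only: eq_neg_iff_add_eq_0)
        then have "inverse (c True) *\<^sub>C (c True *\<^sub>C y) = inverse (c True) *\<^sub>C (- (c False *\<^sub>C 1))"
          by simp
        then show ?thesis
          using t by (simp add: scaleC_scaleC scaleC_one divide_inverse mult.commute
              scaleC_minus_left scaleC_minus_right)
      qed
      then show False using False by blast
    qed
    then have "c False = 0"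
      using s by (simp add: scaleC_eq_0_iff)
    with t show ?thesis by (cases i) auto
  qed
  then have "?a True = 0"
    using assms by (intro min_tensor_indep[OF tens, of UNIV ?b ?a])
      (auto simp: UNIV_bool tens_minus_left)
  then show ?thesis by simp
qed

section \<open>Tensor products of maps on the algebraic tensor product\<close>

lemma tens_sum_eliminate:
  assumes "finite I" "j \<in> I" "b j = (\<Sum>i\<in>I - {j}. d i *\<^sub>C b i)"
  shows "(\<Sum>i\<in>I. tens (a i) (b i)) = (\<Sum>i\<in>I - {j}. tens (a i + d i *\<^sub>C a j) (b i))"
  using assms by (simp add: sum.remove tens_add_left sum.distrib tens_sum_right tens_scaleC_left
      tens_scaleC_right add.commute)

text \<open>Well-definedness of \<open>f \<otimes> g\<close> on the algebraic tensor product: linear dependences among the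
  \<open>b i\<close> are eliminated one at a time.\<close>

lemma tens_map_eq_0:
  assumes f: "star_hom f" and g: "star_hom g"
    and "finite I" "(\<Sum>i\<in>I. tens (a i) (b i)) = 0"
  shows "(\<Sum>i\<in>I. tens (f (a i)) (g (b i))) = 0"
  using assms(3,4)
proof (induction "card I" arbitrary: I a rule: less_induct)
  case less
  show ?case
  proof (cases "\<forall>c. (\<Sum>i\<in>I. c i *\<^sub>C b i) = 0 \<longrightarrow> (\<forall>i\<in>I. c i = 0)")
    case True
    then have "a i = 0" if "i \<in> I" for i
      using min_tensor_indep[OF tens less.prems(1) _ less.prems(2) that] by blast
    then show ?thesis by (simp add: star_hom_zero[OF f] tens_zero_left)
  next
    case False
    then obtain c j where c: "(\<Sum>i\<in>I. c i *\<^sub>C b i) = 0" "j \<in> I" "c j \<noteq> 0" by blast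
    define d where "d i = - c i / c j" for i
    have "c j *\<^sub>C b j = - (\<Sum>i\<in>I - {j}. c i *\<^sub>C b i)"
      using c less.prems(1) by (simp add: sum.remove eq_neg_iff_add_eq_0)
    then have "inverse (c j) *\<^sub>C (c j *\<^sub>C b j) = inverse (c j) *\<^sub>C - (\<Sum>i\<in>I - {j}. c i *\<^sub>C b i)"
      by simp
    then have b: "b j = (\<Sum>i\<in>I - {j}. d i *\<^sub>C b i)"
      using c by (simp add: d_def scaleC_scaleC scaleC_one scaleC_minus_right scaleC_sum_right
          scaleC_minus_left divide_inverse mult.commute sum_negf)
    then have gb: "g (b j) = (\<Sum>i\<in>I - {j}. d i *\<^sub>C g (b i))"
      by (simp add: star_hom_simps[OF g])
    have "(\<Sum>i\<in>I - {j}. tens (a i + d i *\<^sub>C a j) (b i)) = 0"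
      using tens_sum_eliminate[OF less.prems(1) c(2), of b d a, OF b] less.prems(2) by simp
    then have "(\<Sum>i\<in>I - {j}. tens (f (a i + d i *\<^sub>C a j)) (g (b i))) = 0"
      using less.prems(1) c(2) by (intro less.hyps) (auto intro: card_Diff1_less simp del: card_Diff_insert)
    then show ?thesis
      using tens_sum_eliminate[OF less.prems(1) c(2), of "\<lambda>i. g (b i)" d "\<lambda>i. f (a i)", OF gb]
      by (simp add: star_hom_simps[OF f])
  qed
qed

text \<open>The graph of the map f \<otimes> g on algebraic tensors. As a relation it can be shown
  compatible with all operations before it is known to be a function, well-definedness reduces to
  the pairs starting with 0, and inverting the map is a swap of arguments.\<close>

definition tens_rel :: "('a \<Rightarrow> 'a) \<Rightarrow> ('b \<Rightarrow> 'b) \<Rightarrow> 'c \<Rightarrow> 'c \<Rightarrow> bool" where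
  "tens_rel f g x y \<longleftrightarrow> (\<exists>(n::nat) a b. x = (\<Sum>i<n. tens (a i) (b i)) \<and> y = (\<Sum>i<n. tens (f (a i)) (g (b i))))"

text \<open>General finite index sets let sums and products of tensors be indexed by disjoint unions
  and Cartesian products.\<close>

lemma tens_relI:
  assumes "finite I" "x = (\<Sum>i\<in>I. tens (a i) (b i))" "y = (\<Sum>i\<in>I. tens (f (a i)) (g (b i)))"
  shows "tens_rel f g x y"
proof -
  obtain h where h: "bij_betw h {..<card I} I"
    using ex_bij_betw_nat_finite[OF assms(1)] by (auto simp: atLeast0LessThan)
  have sum_h: "(\<Sum>k<card I. F (h k)) = (\<Sum>i\<in>I. F i)" for F :: "_ \<Rightarrow> 'z::comm_monoid_add"
    using sum.reindex_bij_betw[OF h, of F] by simp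
  show ?thesis
    unfolding tens_rel_def assms(2,3)
    by (intro exI[of _ "card I"] exI[of _ "\<lambda>k. a (h k)"] exI[of _ "\<lambda>k. b (h k)"])
      (simp add: sum_h[of "\<lambda>i. tens (a i) (b i)"] sum_h[of "\<lambda>i. tens (f (a i)) (g (b i))"])
qed

lemma tens_rel_tens: "tens_rel f g (tens a b) (tens (f a) (g b))"
  by (rule tens_relI[of "{()}" _ "\<lambda>_. a" "\<lambda>_. b"]) auto

lemma tens_rel_dom: "x \<in> alg_tensor tens \<longleftrightarrow> (\<exists>y. tens_rel f g x y)"
  by (auto simp: alg_tensor_def tens_rel_def)

lemma tens_rel_inverse:
  assumes "\<And>a. f' (f a) = a" "\<And>b. g' (g b) = b" and "tens_rel f g x y"
  shows "tens_rel f' g' y x"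
proof -
  obtain n a b where 1: "x = (\<Sum>i<(n::nat). tens (a i) (b i))" "y = (\<Sum>i<n. tens (f (a i)) (g (b i)))"
    using assms(3) unfolding tens_rel_def by blast
  show ?thesis
    by (rule tens_relI[of "{..<n}" _ "\<lambda>i. f (a i)" "\<lambda>i. g (b i)"]) (simp_all add: 1 assms)
qed

lemma tens_rel_inv:
  assumes "bij f" "bij g"
  shows "tens_rel f g x y \<longleftrightarrow> tens_rel (inv f) (inv g) y x"
proof -
  have 1: "inv f (f a) = a" "inv g (g b) = b" "f (inv f a) = a" "g (inv g b) = b" for a b
    using assms by (simp_all add: bij_is_inj bij_is_surj surj_f_inv_f)
  show ?thesis
    using tens_rel_inverse[of "inv f" f "inv g" g x y, OF 1(1,2)]
      tens_rel_inverse[of f "inv f" g "inv g" y x, OF 1(3,4)] by (rule iffI)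
qed

context
  fixes f :: "'a \<Rightarrow> 'a" and g :: "'b \<Rightarrow> 'b"
  assumes f: "star_hom f" and g: "star_hom g"
begin

lemma tens_rel_add:
  assumes "tens_rel f g x y" "tens_rel f g x' y'"
  shows "tens_rel f g (x + x') (y + y')"
proof -
  obtain n a b where 1: "x = (\<Sum>i<(n::nat). tens (a i) (b i))" "y = (\<Sum>i<n. tens (f (a i)) (g (b i)))"
    using assms(1) unfolding tens_rel_def by blast
  obtain m a' b' where 2: "x' = (\<Sum>i<(m::nat). tens (a' i) (b' i))" "y' = (\<Sum>i<m. tens (f (a' i)) (g (b' i)))"
    using assms(2) unfolding tens_rel_def by blast
  show ?thesis
    by (rule tens_relI[of "{..<n} <+> {..<m}" _ "case_sum a a'" "case_sum b b'"])
      (auto simp: sum.Plus 1 2)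
qed

lemma tens_rel_mult:
  assumes "tens_rel f g x y" "tens_rel f g x' y'"
  shows "tens_rel f g (x * x') (y * y')"
proof -
  obtain n a b where 1: "x = (\<Sum>i<(n::nat). tens (a i) (b i))" "y = (\<Sum>i<n. tens (f (a i)) (g (b i)))"
    using assms(1) unfolding tens_rel_def by blast
  obtain m a' b' where 2: "x' = (\<Sum>i<(m::nat). tens (a' i) (b' i))" "y' = (\<Sum>i<m. tens (f (a' i)) (g (b' i)))"
    using assms(2) unfolding tens_rel_def by blast
  show ?thesis
    by (rule tens_relI[of "{..<n} \<times> {..<m}" _ "\<lambda>(i, j). a i * a' j" "\<lambda>(i, j). b i * b' j"])
      (auto simp: 1 2 sum_product tens_mult star_hom_mult[OF f] star_hom_mult[OF g] sum.cartesian_product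
        intro!: sum.cong)
qed

lemma tens_rel_scaleC:
  assumes "tens_rel f g x y"
  shows "tens_rel f g (c *\<^sub>C x) (c *\<^sub>C y)"
proof -
  obtain n a b where 1: "x = (\<Sum>i<(n::nat). tens (a i) (b i))" "y = (\<Sum>i<n. tens (f (a i)) (g (b i)))"
    using assms unfolding tens_rel_def by blast
  show ?thesis
    by (rule tens_relI[of "{..<n}" _ "\<lambda>i. c *\<^sub>C a i" b])
      (simp_all add: 1 scaleC_sum_right tens_scaleC_left star_hom_scaleC[OF f])
qed

lemma tens_rel_adj:
  assumes "tens_rel f g x y"
  shows "tens_rel f g (adj x) (adj y)"
proof -
  obtain n a b where 1: "x = (\<Sum>i<(n::nat). tens (a i) (b i))" "y = (\<Sum>i<n. tens (f (a i)) (g (b i)))"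
    using assms unfolding tens_rel_def by blast
  show ?thesis
    by (rule tens_relI[of "{..<n}" _ "\<lambda>i. adj (a i)" "\<lambda>i. adj (b i)"])
      (simp_all add: 1 adj_sum tens_adj star_hom_adj[OF f] star_hom_adj[OF g])
qed

lemma tens_rel_one: "tens_rel f g 1 1"
  using tens_rel_tens[of f g 1 1] by (simp add: tens_one star_hom_one[OF f] star_hom_one[OF g])

lemma tens_rel_zero: "tens_rel f g 0 y \<Longrightarrow> y = 0"
  unfolding tens_rel_def using tens_map_eq_0[OF f g] by (metis finite_lessThan)

lemma tens_rel_unique:
  assumes "tens_rel f g x y" "tens_rel f g x y'"
  shows "y = y'"
proof -
  have "tens_rel f g (x + (- 1) *\<^sub>C x) (y + (- 1) *\<^sub>C y')"
    by (intro tens_rel_add tens_rel_scaleC assms)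
  then have "y - y' = 0"
    by (intro tens_rel_zero) (simp add: scaleC_minus_left scaleC_one)
  then show ?thesis by simp
qed

definition "tens_fun x = (THE y. tens_rel f g x y)"

lemma tens_fun_eq: "tens_rel f g x y \<Longrightarrow> tens_fun x = y"
  unfolding tens_fun_def using tens_rel_unique by blast

lemma tens_rel_tens_fun: "x \<in> alg_tensor tens \<Longrightarrow> tens_rel f g x (tens_fun x)"
  using tens_rel_dom[of x f g] tens_fun_eq by metis

end

text \<open>Pulling the norm back along f \<otimes> g gives a C*-norm on the algebraic tensor
  product, definite because the inverse maps undo f \<otimes> g. The norm of the minimal tensor
  product lies below it.\<close>

lemma tens_rel_norm_le:
  assumes f: "star_hom f" "bij f" and g: "star_hom g" "bij g" and "tens_rel f g x y"
  shows "norm x \<le> norm y"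
proof -
  define T where "T = tens_fun f g"
  note eq = tens_fun_eq[OF f(1) g(1), folded T_def]
  note rel = tens_rel_tens_fun[OF f(1) g(1), folded T_def]
  have T: "T (x + y) = T x + T y" "T (c *\<^sub>C x) = c *\<^sub>C T x" "T (x * y) = T x * T y" "T (adj x) = adj (T x)"
    if "x \<in> alg_tensor tens" "y \<in> alg_tensor tens" for x y c
    using that by (auto intro!: eq tens_rel_add tens_rel_mult tens_rel_scaleC tens_rel_adj rel f g)
  have in_alg: "adj x * x \<in> alg_tensor tens" "adj x \<in> alg_tensor tens" if "x \<in> alg_tensor tens" for x
    using tens_rel_mult[OF f(1) g(1) tens_rel_adj[OF f(1) g(1) rel[OF that]] rel[OF that]]
      tens_rel_adj[OF f(1) g(1) rel[OF that]] tens_rel_dom by blast+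
  have "cstar_seminorm_on (alg_tensor tens) scaleC adj (\<lambda>x. norm (T x))"
    unfolding cstar_seminorm_on_def
    by (auto simp: T in_alg norm_triangle_ineq norm_mult_ineq norm_scaleC cstar_identity)
  moreover have "x = 0" if "x \<in> alg_tensor tens" "norm (T x) = 0" for x
  proof -
    have "tens_rel (inv f) (inv g) 0 x"
      using rel[OF that(1)] that(2) tens_rel_inv[OF f(2) g(2)] by simp
    then show ?thesis by (rule tens_rel_zero[OF star_hom_inv[OF f] star_hom_inv[OF g]])
  qed
  ultimately have "\<forall>x\<in>alg_tensor tens. norm x \<le> norm (T x)"
    using min_tensor_minimal[OF tens] by blast
  then show ?thesis
    using assms(5) eq tens_rel_dom by metis
qed

text \<open>Minimality only bounds the norm of the argument by that of its image. Bijectivity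
  supplies the opposite bound, by applying the same inequality to \<open>inv f\<close> and
  \<open>inv g\<close>; hence the algebraic map is isometric and extends.\<close>

lemma tens_automorphism:
  assumes f: "star_hom f" "bij f" and g: "star_hom g" "bij g"
  obtains T where "star_hom T" "\<And>a b. T (tens a b) = tens (f a) (g b)"
proof -
  define T0 where "T0 = tens_fun f g"
  note eq = tens_fun_eq[OF f(1) g(1), folded T0_def]
  note rel = tens_rel_tens_fun[OF f(1) g(1), folded T0_def]
  note inA = tens_rel_dom[of _ f g]
  have le: "norm (T0 x) \<le> norm x" if "x \<in> alg_tensor tens" for x
    using rel[OF that] tens_rel_inv[OF f(2) g(2)]
      tens_rel_norm_le[OF star_hom_inv[OF f] bij_imp_bij_inv[OF f(2)] star_hom_inv[OF g] bij_imp_bij_inv[OF g(2)]]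
    by blast
  note rules = tens_rel_add[OF f(1) g(1)] tens_rel_mult[OF f(1) g(1)] tens_rel_scaleC[OF f(1) g(1)]
    tens_rel_adj[OF f(1) g(1)] tens_rel_one[OF f(1) g(1)] rel
  obtain T where T: "star_hom T" "\<And>x. x \<in> alg_tensor tens \<Longrightarrow> T x = T0 x"
  proof (rule star_hom_extension[of "alg_tensor tens" T0])
    show "1 \<in> alg_tensor tens"
      unfolding inA by (rule exI, rule rules)
    show "x + y \<in> alg_tensor tens" "x * y \<in> alg_tensor tens"
      if "x \<in> alg_tensor tens" "y \<in> alg_tensor tens" for x y
      unfolding inA using that by (rule_tac [!] exI, rule_tac [!] rules; blast intro: rel)+
    show "c *\<^sub>C x \<in> alg_tensor tens" "adj x \<in> alg_tensor tens" if "x \<in> alg_tensor tens" for x c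
      unfolding inA using that by (rule_tac [!] exI, rule_tac [!] rules; blast intro: rel)+
  qed (auto intro!: tens_dense le eq rules)
  show ?thesis
  proof (rule that[OF T(1)])
    fix a b
    have "tens a b \<in> alg_tensor tens"
      unfolding inA by (rule exI, rule tens_rel_tens)
    then show "T (tens a b) = tens (f a) (g b)"
      using T(2) eq[OF tens_rel_tens] by simp
  qed
qed

end

section \<open>Unitary representations\<close>

lemma sum_delta_scale:
  fixes x :: "nat \<Rightarrow> 'a::cstar_algebra"
  shows "(\<Sum>k<n. (if k = j then 1 else 0) * x k) = (if j < n then x j else 0)"
    and "(\<Sum>k<n. x k * (if k = j then 1 else 0)) = (if j < n then x j else 0)"
    and "(\<Sum>k<n. (if j = k then 1 else 0) * x k) = (if j < n then x j else 0)"
    and "(\<Sum>k<n. x k * (if j = k then 1 else 0)) = (if j < n then x j else 0)"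
  by (auto simp: if_distrib if_distribR cong: if_cong)

text \<open>Cancelling \<open>v\<close> in \<open>R(v) \<otimes> v = v \<otimes> L(v)\<close> gives \<open>v\<^sup>* R(v) \<otimes> 1 = 1 \<otimes> L(v) v\<^sup>*\<close>, so both are the
  same scalar matrix.\<close>

lemma unitary_rep_equivariant:
  fixes tens :: "'a::cstar_algebra \<Rightarrow> 'a \<Rightarrow> 'c::cstar_algebra"
  assumes tens: "min_tensor tens" and v: "unitary_rep tens \<Phi> n v"
    and L: "star_hom L" "star_hom T" "\<And>a b. T (tens a b) = tens a (L b)"
    and R: "star_hom R" "star_hom S" "\<And>a b. S (tens a b) = tens (R a) b"
    and eq: "\<And>x. S (\<Phi> x) = T (\<Phi> x)"
  obtains D where "\<And>i j. i < n \<Longrightarrow> j < n \<Longrightarrow> L (v i j) = (\<Sum>k<n. D i k *\<^sub>C v k j)"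
    "\<And>i j. i < n \<Longrightarrow> j < n \<Longrightarrow> R (v i j) = (\<Sum>k<n. D k j *\<^sub>C v i k)"
    "\<And>i j. i < n \<Longrightarrow> j < n \<Longrightarrow> (\<Sum>k<n. D i k * cnj (D j k)) = (if i = j then 1 else 0)"
proof -
  have v1: "(\<Sum>k<n. v i k * adj (v j k)) = (if i = j then 1 else 0)"
    and v2: "(\<Sum>k<n. adj (v k i) * v k j) = (if i = j then 1 else 0)"
    and v3: "\<Phi> (v i j) = (\<Sum>k<n. tens (v i k) (v k j))" if "i < n" "j < n" for i j
    using v that unfolding unitary_rep_def by blast+
  define X where "X i j = (\<Sum>k<n. adj (v k i) * R (v k j))" for i j
  define Y where "Y i j = (\<Sum>k<n. L (v i k) * adj (v j k))" for i j
  have E: "(\<Sum>k<n. tens (R (v i k)) (v k j)) = (\<Sum>k<n. tens (v i k) (L (v k j)))" if "i < n" "j < n" for i j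
    using eq[of "v i j"] that by (simp add: v3 star_hom_sum[OF R(2)] star_hom_sum[OF L(2)] L R)
  have XY: "tens (X a b) 1 = tens 1 (Y a b)" if ab: "a < n" "b < n" for a b
  proof -
    \<comment> \<open>A unit of the second leg is expanded by unitarity so that the left side of
      \<open>E\<close> appears; after the exchange the first leg contracts by the other unitarity
      relation.\<close>
    have "tens (X a b) 1 = (\<Sum>i<n. \<Sum>k<n. tens (adj (v i a) * R (v i k)) (if k = b then 1 else 0))"
      using ab by (simp add: X_def tens_sum_left[OF tens] if_distrib[of "tens _"] tens_zero_right[OF tens] cong: if_cong)
    also have "\<dots> = (\<Sum>i<n. \<Sum>k<n. tens (adj (v i a) * R (v i k)) (\<Sum>j<n. v k j * adj (v b j)))"
      using ab by (intro sum.cong refl) (simp add: v1)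
    also have "\<dots> = (\<Sum>i<n. \<Sum>k<n. \<Sum>j<n. tens (adj (v i a)) 1 * tens (R (v i k)) (v k j) * tens 1 (adj (v b j)))"
      by (simp add: tens_sum_right[OF tens] tens_mult[OF tens])
    also have "\<dots> = (\<Sum>i<n. \<Sum>j<n. tens (adj (v i a)) 1 * (\<Sum>k<n. tens (R (v i k)) (v k j)) * tens 1 (adj (v b j)))"
      by (subst sum.swap) (simp add: sum_distrib_left sum_distrib_right)
    also have "\<dots> = (\<Sum>i<n. \<Sum>j<n. tens (adj (v i a)) 1 * (\<Sum>k<n. tens (v i k) (L (v k j))) * tens 1 (adj (v b j)))"
      by (simp add: E)
    also have "\<dots> = (\<Sum>j<n. \<Sum>k<n. \<Sum>i<n. tens (adj (v i a) * v i k) (L (v k j) * adj (v b j)))"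
      by (subst sum.swap, subst (2) sum.swap)
        (simp add: sum_distrib_left sum_distrib_right tens_mult[OF tens])
    also have "\<dots> = (\<Sum>j<n. \<Sum>k<n. tens (if a = k then 1 else 0) (L (v k j) * adj (v b j)))"
      using ab by (simp add: v2 flip: tens_sum_left[OF tens])
    also have "\<dots> = tens 1 (Y a b)"
      using ab by (simp add: Y_def tens_sum_right[OF tens] if_distrib[of "\<lambda>x. tens x _"] tens_zero_left[OF tens] cong: if_cong)
    finally show ?thesis .
  qed
  have "\<exists>d. X a b = d *\<^sub>C 1 \<and> Y a b = d *\<^sub>C 1" if "a < n" "b < n" for a b
    using tens_one_eq_imp_scalar[OF tens XY[OF that]] by blast
  then obtain D where D: "X a b = D a b *\<^sub>C 1" "Y a b = D a b *\<^sub>C 1" if "a < n" "b < n" for a b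
    by metis
  have Lv: "L (v i j) = (\<Sum>k<n. D i k *\<^sub>C v k j)" if ij: "i < n" "j < n" for i j
  proof -
    have "(\<Sum>k<n. D i k *\<^sub>C v k j) = (\<Sum>k<n. Y i k * v k j)"
      using ij by (simp add: D mult_scaleC_left)
    also have "\<dots> = (\<Sum>l<n. L (v i l) * (\<Sum>k<n. adj (v k l) * v k j))"
      unfolding Y_def sum_distrib_left sum_distrib_right by (subst sum.swap) (simp add: mult.assoc)
    also have "\<dots> = L (v i j)"
      using ij by (simp add: v2 sum_delta_scale)
    finally show ?thesis by simp
  qed
  have Rv: "R (v i j) = (\<Sum>k<n. D k j *\<^sub>C v i k)" if ij: "i < n" "j < n" for i j
  proof -
    have "(\<Sum>k<n. D k j *\<^sub>C v i k) = (\<Sum>k<n. v i k * X k j)"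
      using ij by (simp add: D mult_scaleC_right)
    also have "\<dots> = (\<Sum>l<n. (\<Sum>k<n. v i k * adj (v l k)) * R (v l j))"
      unfolding X_def sum_distrib_left sum_distrib_right by (subst sum.swap) (simp add: mult.assoc)
    also have "\<dots> = R (v i j)"
      using ij by (simp add: v1 sum_delta_scale)
    finally show ?thesis by simp
  qed
  \<comment> \<open>Unitarity of \<open>D\<close> comes from applying \<open>L\<close> to the
    unitarity relation of \<open>v\<close>: the scalars pull out and the entries of \<open>v\<close>
    contract to 1.\<close>
  have "(\<Sum>k<n. D i k * cnj (D j k)) = (if i = j then 1 else 0)" if ij: "i < n" "j < n" for i j
  proof -
    have "(if i = j then 1 else 0) = L (\<Sum>k<n. v i k * adj (v j k))"
      using ij by (simp add: v1 star_hom_simps[OF L(1)])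
    also have "\<dots> = (\<Sum>k<n. L (v i k) * adj (L (v j k)))"
      by (simp add: star_hom_simps[OF L(1)])
    also have "\<dots> = (\<Sum>k<n. \<Sum>l<n. \<Sum>m<n. (D i l * cnj (D j m)) *\<^sub>C (v l k * adj (v m k)))"
      using ij by (simp add: Lv adj_sum adj_scaleC sum_product mult_scaleC_left mult_scaleC_right scaleC_scaleC mult.commute)
    also have "\<dots> = (\<Sum>l<n. \<Sum>m<n. (D i l * cnj (D j m)) *\<^sub>C (\<Sum>k<n. v l k * adj (v m k)))"
      by (subst sum.swap, rule sum.cong[OF refl], subst sum.swap) (simp add: scaleC_sum_right)
    also have "\<dots> = (\<Sum>l<n. \<Sum>m<n. if l = m then (D i l * cnj (D j m)) *\<^sub>C 1 else 0)"
      by (intro sum.cong refl) (simp add: v1)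
    also have "\<dots> = (\<Sum>k<n. D i k * cnj (D j k)) *\<^sub>C (1::'a)"
      by (simp add: scaleC_sum_left)
    finally have "(\<Sum>k<n. D i k * cnj (D j k)) *\<^sub>C (1::'a) = (if i = j then 1 else 0) *\<^sub>C 1"
      by (simp add: scaleC_one split: if_splits)
    then show ?thesis by (rule scaleC_cancel) simp
  qed
  with Lv Rv show ?thesis by (rule that)
qed

section \<open>The representation on finitely supported sequences\<close>

text \<open>The dense pre-Hilbert space of \<ell>2 on which inner products and norms are finite
  sums; an operator norm can be read off from it as a supremum.\<close>

definition fin_seq :: "(nat \<Rightarrow> complex) set" where
  "fin_seq = {f. \<exists>n. \<forall>k\<ge>n. f k = 0}"

definition seq_ip :: "(nat \<Rightarrow> complex) \<Rightarrow> (nat \<Rightarrow> complex) \<Rightarrow> complex" where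
  "seq_ip f \<eta> = suminf (\<lambda>k. f k * cnj (\<eta> k))"

definition seq_norm :: "(nat \<Rightarrow> complex) \<Rightarrow> real" where
  "seq_norm f = sqrt (suminf (\<lambda>k. (cmod (f k))\<^sup>2))"

lemma seq_ip_eq: "(\<And>k. k \<ge> n \<Longrightarrow> f k = 0) \<Longrightarrow> seq_ip f \<eta> = (\<Sum>k<n. f k * cnj (\<eta> k))"
  unfolding seq_ip_def by (rule suminf_finite) (auto simp: not_less)

lemma seq_norm_eq: "(\<And>k. k \<ge> n \<Longrightarrow> f k = 0) \<Longrightarrow> seq_norm f = L2_set (\<lambda>k. cmod (f k)) {..<n}"
  unfolding seq_norm_def L2_set_def by (subst suminf_finite[of "{..<n}"]) (auto simp: not_less)

lemma fin_seq_bound2: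
  assumes "f \<in> fin_seq" "\<eta> \<in> fin_seq"
  obtains n where "\<And>k. k \<ge> n \<Longrightarrow> f k = 0" "\<And>k. k \<ge> n \<Longrightarrow> \<eta> k = 0"
proof -
  obtain n m where "\<forall>k\<ge>n. f k = 0" "\<forall>k\<ge>m. \<eta> k = 0"
    using assms by (auto simp: fin_seq_def)
  then show ?thesis using that[of "max n m"] by simp
qed

lemma seq_norm_nonneg [simp]:
  assumes "f \<in> fin_seq"
  shows "0 \<le> seq_norm f"
proof -
  obtain n where "\<And>k. k \<ge> n \<Longrightarrow> f k = 0"
    using assms by (auto simp: fin_seq_def)
  then show ?thesis by (simp add: seq_norm_eq[of n])
qed

lemma fin_seq_zero [simp]: "(\<lambda>_. 0) \<in> fin_seq"
  by (auto simp: fin_seq_def)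

lemma seq_norm_zero [simp]: "seq_norm (\<lambda>_. 0) = 0"
  by (simp add: seq_norm_def)

lemma fin_seq_add:
  assumes "f \<in> fin_seq" "\<eta> \<in> fin_seq"
  shows "(\<lambda>k. f k + \<eta> k) \<in> fin_seq"
proof -
  obtain n where "\<And>k. k \<ge> n \<Longrightarrow> f k = 0" "\<And>k. k \<ge> n \<Longrightarrow> \<eta> k = 0"
    using fin_seq_bound2[OF assms] by blast
  then show ?thesis by (auto simp: fin_seq_def intro!: exI[of _ n])
qed

lemma fin_seq_scale: "f \<in> fin_seq \<Longrightarrow> (\<lambda>k. c * f k) \<in> fin_seq"
  unfolding fin_seq_def by fastforce

lemma fin_seq_sum: "(\<And>i. i \<in> I \<Longrightarrow> f i \<in> fin_seq) \<Longrightarrow> (\<lambda>k. \<Sum>i\<in>I. f i k) \<in> fin_seq"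
  by (induction I rule: infinite_finite_induct) (simp_all add: fin_seq_add)

lemma seq_norm_add:
  assumes "f \<in> fin_seq" "\<eta> \<in> fin_seq"
  shows "seq_norm (\<lambda>k. f k + \<eta> k) \<le> seq_norm f + seq_norm \<eta>"
proof -
  obtain n where n: "\<And>k. k \<ge> n \<Longrightarrow> f k = 0" "\<And>k. k \<ge> n \<Longrightarrow> \<eta> k = 0"
    using fin_seq_bound2[OF assms] by blast
  have "L2_set (\<lambda>k. cmod (f k + \<eta> k)) {..<n} \<le> L2_set (\<lambda>k. cmod (f k) + cmod (\<eta> k)) {..<n}"
    by (rule L2_set_mono) (auto simp: norm_triangle_ineq)
  also have "\<dots> \<le> L2_set (\<lambda>k. cmod (f k)) {..<n} + L2_set (\<lambda>k. cmod (\<eta> k)) {..<n}"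
    by (rule L2_set_triangle_ineq)
  finally show ?thesis
    using seq_norm_eq[of n f] seq_norm_eq[of n \<eta>] seq_norm_eq[of n "\<lambda>k. f k + \<eta> k"] n by simp
qed

lemma seq_norm_scale:
  assumes "f \<in> fin_seq"
  shows "seq_norm (\<lambda>k. c * f k) = cmod c * seq_norm f"
proof -
  obtain n where n: "\<And>k. k \<ge> n \<Longrightarrow> f k = 0"
    using assms by (auto simp: fin_seq_def)
  then show ?thesis
    using seq_norm_eq[of n f] seq_norm_eq[of n "\<lambda>k. c * f k"]
    by (simp add: norm_mult L2_set_right_distrib)
qed

lemma seq_norm_ip:
  assumes "f \<in> fin_seq"
  shows "complex_of_real ((seq_norm f)\<^sup>2) = seq_ip f f"
proof -
  obtain n where n: "\<And>k. k \<ge> n \<Longrightarrow> f k = 0"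
    using assms by (auto simp: fin_seq_def)
  then show ?thesis
    by (simp add: seq_norm_eq[of n] seq_ip_eq[of n] L2_set_def sum_nonneg complex_norm_square
        del: of_real_power)
qed

lemma seq_Cauchy_Schwarz:
  assumes "f \<in> fin_seq" "\<eta> \<in> fin_seq"
  shows "cmod (seq_ip f \<eta>) \<le> seq_norm f * seq_norm \<eta>"
proof -
  obtain n where n: "\<And>k. k \<ge> n \<Longrightarrow> f k = 0" "\<And>k. k \<ge> n \<Longrightarrow> \<eta> k = 0"
    using fin_seq_bound2[OF assms] by blast
  have "cmod (seq_ip f \<eta>) \<le> (\<Sum>k<n. \<bar>cmod (f k)\<bar> * \<bar>cmod (\<eta> k)\<bar>)"
    using n by (subst seq_ip_eq[of n]) (auto intro!: order_trans[OF norm_sum] simp: norm_mult)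
  also have "\<dots> \<le> L2_set (\<lambda>k. cmod (f k)) {..<n} * L2_set (\<lambda>k. cmod (\<eta> k)) {..<n}"
    by (rule L2_set_mult_ineq)
  finally show ?thesis
    using n seq_norm_eq[of n f] seq_norm_eq[of n \<eta>] by simp
qed

text \<open>Weights of the standard infinite-dimensional irreducible representation: \<alpha> sends
  the k-th basis vector to this multiple of its predecessor, and \<gamma> multiplies it by
  \<open>q ^ k\<close>. The weight at 0 vanishes, so \<alpha> kills the first basis vector.\<close>

definition shift_weight :: "real \<Rightarrow> nat \<Rightarrow> complex" where
  "shift_weight q k = complex_of_real (sqrt (1 - q ^ (2 * k)))"

fun letter_op :: "real \<Rightarrow> SUq2_gen \<times> bool \<Rightarrow> (nat \<Rightarrow> complex) \<Rightarrow> nat \<Rightarrow> complex" where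
  "letter_op q (Alpha, False) f k = shift_weight q (Suc k) * f (Suc k)"
| "letter_op q (Alpha, True) f k = (if k = 0 then 0 else shift_weight q k * f (k - 1))"
| "letter_op q (Gamma, _) f k = complex_of_real (q ^ k) * f k"

definition word_op :: "real \<Rightarrow> SUq2_gen star_word \<Rightarrow> (nat \<Rightarrow> complex) \<Rightarrow> nat \<Rightarrow> complex" where
  "word_op q w = foldr (letter_op q) (letters w)"

definition alg_op :: "real \<Rightarrow> SUq2_gen free_alg \<Rightarrow> (nat \<Rightarrow> complex) \<Rightarrow> nat \<Rightarrow> complex" where
  "alg_op q p f k = (\<Sum>w\<in>Poly_Mapping.keys p. Poly_Mapping.lookup p w * word_op q w f k)"

section \<open>The action of the free algebra by shifts and diagonal operators\<close>

lemma letter_op_add: "letter_op q l (\<lambda>k. f k + \<eta> k) = (\<lambda>k. letter_op q l f k + letter_op q l \<eta> k)"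
  by (rule ext, cases "(q, l, f, 0::nat)" rule: letter_op.cases) (auto simp: algebra_simps)

lemma letter_op_scale: "letter_op q l (\<lambda>k. c * f k) = (\<lambda>k. c * letter_op q l f k)"
  by (rule ext, cases "(q, l, f, 0::nat)" rule: letter_op.cases) auto

lemma word_op_add: "word_op q w (\<lambda>k. f k + \<eta> k) = (\<lambda>k. word_op q w f k + word_op q w \<eta> k)"
proof -
  have "foldr (letter_op q) l (\<lambda>k. f k + \<eta> k) = (\<lambda>k. foldr (letter_op q) l f k + foldr (letter_op q) l \<eta> k)" for l
    by (induction l) (auto simp: letter_op_add)
  then show ?thesis by (simp add: word_op_def)
qed

lemma word_op_scale: "word_op q w (\<lambda>k. c * f k) = (\<lambda>k. c * word_op q w f k)"
proof -
  have "foldr (letter_op q) l (\<lambda>k. c * f k) = (\<lambda>k. c * foldr (letter_op q) l f k)" for l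
    by (induction l) (auto simp: letter_op_scale)
  then show ?thesis by (simp add: word_op_def)
qed

lemma word_op_plus: "word_op q (v + w) f = word_op q v (word_op q w f)"
  by (simp add: word_op_def plus_star_word_def)

lemma alg_op_single [simp]: "alg_op q (Poly_Mapping.single w c) f = (\<lambda>k. c * word_op q w f k)"
  unfolding alg_op_def by (rule ext, rule sum_keys_single) simp

lemma alg_op_add: "alg_op q (p + r) f = (\<lambda>k. alg_op q p f k + alg_op q r f k)"
  unfolding alg_op_def by (rule ext, rule sum_keys_add) (simp_all add: distrib_right)

lemma alg_op_zero [simp]: "alg_op q 0 f = (\<lambda>_. 0)"
  by (rule ext) (simp add: alg_op_def)

lemma alg_op_diff: "alg_op q (p - r) f = (\<lambda>k. alg_op q p f k - alg_op q r f k)"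
proof -
  have "alg_op q (p - r + r) f = (\<lambda>k. alg_op q (p - r) f k + alg_op q r f k)"
    by (rule alg_op_add)
  then show ?thesis by (simp add: fun_eq_iff)
qed

lemma alg_op_one [simp]: "alg_op q 1 f = f"
  by (simp add: word_op_def zero_star_word_def flip: single_one)

lemma alg_op_mult: "alg_op q (p * r) f = alg_op q p (alg_op q r f)"
proof (rule ext)
  fix k
  show "alg_op q (p * r) f k = alg_op q p (alg_op q r f) k"
  proof (rule additive_poly_mapping_eq[where p = p])
    fix v c
    show "alg_op q (Poly_Mapping.single v c * r) f k = alg_op q (Poly_Mapping.single v c) (alg_op q r f) k"
    proof (rule additive_poly_mapping_eq[where p = r])
      have "alg_op q (Poly_Mapping.single v c) (alg_op q 0 f) k = 0"
        using word_op_scale[of q v 0 "\<lambda>_. 0"] by simp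
      then show "alg_op q (Poly_Mapping.single v c * 0) f k = alg_op q (Poly_Mapping.single v c) (alg_op q 0 f) k"
        by simp
    qed (auto simp: distrib_left alg_op_add mult_single word_op_plus word_op_add word_op_scale algebra_simps)
  qed (auto simp: distrib_right alg_op_add)
qed

lemma alg_op_scale: "alg_op q (free_scale c p) f = (\<lambda>k. c * alg_op q p f k)"
  by (simp add: free_scale_def alg_op_mult word_op_def zero_star_word_def)

lemma alg_op_gen [simp]: "alg_op q (free_gen g) f = letter_op q (g, False) f"
  by (simp add: free_gen_def word_op_def)

lemma alg_op_adj_gen [simp]: "alg_op q (free_adj (free_gen g)) f = letter_op q (g, True) f"
  by (simp add: free_gen_def free_adj_single word_adj_def word_op_def)

lemma letter_op_fin_seq:
  assumes "f \<in> fin_seq"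
  shows "letter_op q l f \<in> fin_seq"
proof -
  obtain n where n: "\<And>k. k \<ge> n \<Longrightarrow> f k = 0"
    using assms by (auto simp: fin_seq_def)
  have "letter_op q l f k = 0" if "k \<ge> Suc n" for k
    using n that by (cases "(q, l, f, k)" rule: letter_op.cases) auto
  then show ?thesis unfolding fin_seq_def by blast
qed

lemma word_op_fin_seq: "f \<in> fin_seq \<Longrightarrow> word_op q w f \<in> fin_seq"
proof -
  assume "f \<in> fin_seq"
  then have "foldr (letter_op q) l f \<in> fin_seq" for l
    by (induction l) (auto simp: letter_op_fin_seq)
  then show ?thesis by (simp add: word_op_def)
qed

lemma alg_op_fin_seq: "f \<in> fin_seq \<Longrightarrow> alg_op q p f \<in> fin_seq"
  using fin_seq_sum[of "Poly_Mapping.keys p" "\<lambda>w k. Poly_Mapping.lookup p w * word_op q w f k"]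
  by (simp add: alg_op_def[abs_def] word_op_fin_seq fin_seq_scale)

lemma seq_ip_commute:
  assumes "f \<in> fin_seq" "\<eta> \<in> fin_seq"
  shows "seq_ip \<eta> f = cnj (seq_ip f \<eta>)"
proof -
  obtain n where "\<And>k. k \<ge> n \<Longrightarrow> f k = 0" "\<And>k. k \<ge> n \<Longrightarrow> \<eta> k = 0"
    using fin_seq_bound2[OF assms] by blast
  then show ?thesis by (simp add: seq_ip_eq[of n] mult.commute)
qed

lemma letter_op_adj_aux:
  assumes "f \<in> fin_seq" "\<eta> \<in> fin_seq"
  shows "seq_ip (letter_op q (g, False) f) \<eta> = seq_ip f (letter_op q (g, True) \<eta>)"
proof -
  obtain n where n: "\<And>k. k \<ge> n \<Longrightarrow> f k = 0" "\<And>k. k \<ge> n \<Longrightarrow> \<eta> k = 0"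
    using fin_seq_bound2[OF assms] by blast
  show ?thesis
  proof (cases g)
    case Alpha
    have "seq_ip (letter_op q (Alpha, False) f) \<eta> = (\<Sum>k<n. shift_weight q (Suc k) * f (Suc k) * cnj (\<eta> k))"
      by (subst seq_ip_eq[of n]) (simp_all add: n)
    \<comment> \<open>One term beyond the support of \<open>f\<close>: splitting off the vanishing
      term at 0 then leaves exactly the index range of the sum above.\<close>
    moreover have "seq_ip f (letter_op q (Alpha, True) \<eta>) =
        (\<Sum>k<Suc n. f k * cnj (letter_op q (Alpha, True) \<eta> k))"
      by (rule seq_ip_eq) (simp add: n)
    moreover have "\<dots> = (\<Sum>k<n. f (Suc k) * cnj (letter_op q (Alpha, True) \<eta> (Suc k)))"
      by (subst sum.lessThan_Suc_shift) simp
    moreover have "cnj (shift_weight q k) = shift_weight q k" for k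
      by (simp add: shift_weight_def)
    ultimately show ?thesis
      unfolding Alpha by (simp add: mult_ac)
  next
    case Gamma
    then show ?thesis
      by (simp add: seq_ip_eq[of n] n mult_ac)
  qed
qed

lemma letter_op_adj:
  assumes "f \<in> fin_seq" "\<eta> \<in> fin_seq"
  shows "seq_ip (letter_op q (g, b) f) \<eta> = seq_ip f (letter_op q (g, \<not> b) \<eta>)"
proof (cases b)
  case True
  have "seq_ip (letter_op q (g, True) f) \<eta> = cnj (seq_ip \<eta> (letter_op q (g, True) f))"
    using assms letter_op_fin_seq by (intro seq_ip_commute) auto
  also have "\<dots> = cnj (seq_ip (letter_op q (g, False) \<eta>) f)"
    using assms by (simp add: letter_op_adj_aux)
  also have "\<dots> = seq_ip f (letter_op q (g, False) \<eta>)"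
    using assms letter_op_fin_seq by (intro seq_ip_commute[symmetric]) auto
  finally show ?thesis using True by simp
qed (use letter_op_adj_aux[OF assms] in simp)

lemma word_op_adj:
  assumes "f \<in> fin_seq" "\<eta> \<in> fin_seq"
  shows "seq_ip (word_op q w f) \<eta> = seq_ip f (word_op q (word_adj w) \<eta>)"
proof -
  have "seq_ip (foldr (letter_op q) l f) \<eta> = seq_ip f (foldr (letter_op q) (rev (map (\<lambda>(g, b). (g, \<not> b)) l)) \<eta>)" for l
    using assms(2)
  proof (induction l arbitrary: \<eta>)
    case (Cons a l)
    have f: "foldr (letter_op q) l f \<in> fin_seq"
      using assms(1) word_op_fin_seq[of f q "Star_Word l"] by (simp add: word_op_def)
    obtain g b where a: "a = (g, b)" by (cases a)
    show ?case
      using Cons.IH[OF letter_op_fin_seq[OF Cons.prems, of q "(g, \<not> b)"]]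
      by (simp add: a letter_op_adj[OF f Cons.prems])
  qed simp
  then show ?thesis by (simp add: word_op_def word_adj_def)
qed

lemma seq_ip_add_left:
  assumes "f \<in> fin_seq" "f' \<in> fin_seq"
  shows "seq_ip (\<lambda>k. f k + f' k) \<eta> = seq_ip f \<eta> + seq_ip f' \<eta>"
proof -
  obtain n where n: "\<And>k. k \<ge> n \<Longrightarrow> f k = 0" "\<And>k. k \<ge> n \<Longrightarrow> f' k = 0"
    using fin_seq_bound2[OF assms] by blast
  show ?thesis
    by (simp add: seq_ip_eq[of n] n distrib_right sum.distrib)
qed

lemma seq_ip_scale_left: "f \<in> fin_seq \<Longrightarrow> seq_ip (\<lambda>k. c * f k) \<eta> = c * seq_ip f \<eta>"
proof -
  assume "f \<in> fin_seq"
  then obtain n where n: "\<And>k. k \<ge> n \<Longrightarrow> f k = 0"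
    by (auto simp: fin_seq_def)
  show ?thesis
    by (simp add: seq_ip_eq[of n] n sum_distrib_left mult.assoc)
qed

lemma seq_ip_scale_right: "f \<in> fin_seq \<Longrightarrow> seq_ip f (\<lambda>k. c * \<eta> k) = cnj c * seq_ip f \<eta>"
proof -
  assume "f \<in> fin_seq"
  then obtain n where n: "\<And>k. k \<ge> n \<Longrightarrow> f k = 0"
    by (auto simp: fin_seq_def)
  show ?thesis
    by (simp add: seq_ip_eq[of n] n sum_distrib_left mult_ac)
qed

lemma seq_ip_add_right: "f \<in> fin_seq \<Longrightarrow> seq_ip f (\<lambda>k. \<eta> k + \<eta>' k) = seq_ip f \<eta> + seq_ip f \<eta>'"
proof -
  assume "f \<in> fin_seq"
  then obtain n where n: "\<And>k. k \<ge> n \<Longrightarrow> f k = 0"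
    by (auto simp: fin_seq_def)
  show ?thesis
    by (simp add: seq_ip_eq[of n] n distrib_left sum.distrib)
qed

lemma seq_ip_zero: "seq_ip (\<lambda>_. 0) \<eta> = 0" "seq_ip f (\<lambda>_. 0) = 0"
  by (simp_all add: seq_ip_def)

lemma alg_op_adj:
  assumes "f \<in> fin_seq" "\<eta> \<in> fin_seq"
  shows "seq_ip (alg_op q p f) \<eta> = seq_ip f (alg_op q (free_adj p) \<eta>)"
  by (rule additive_poly_mapping_eq[where p = p])
    (auto simp: assms alg_op_add free_adj_add alg_op_fin_seq seq_ip_add_left seq_ip_add_right
      free_adj_single word_op_fin_seq seq_ip_scale_left seq_ip_scale_right word_op_adj seq_ip_zero)

section \<open>The operator norm as a C*-seminorm that vanishes on the relators\<close>

context
  fixes q :: real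
  assumes q: "q\<^sup>2 < 1"
begin

lemma even_power_le_1: "q ^ (2 * k) \<le> 1"
  using q by (simp add: power_mult power_le_one)

lemma letter_op_norm_le:
  assumes f: "f \<in> fin_seq"
  shows "seq_norm (letter_op q l f) \<le> seq_norm f"
proof -
  obtain n where n: "\<And>k. k \<ge> n \<Longrightarrow> f k = 0"
    using assms by (auto simp: fin_seq_def)
  have n2: "letter_op q l f k = 0" if "k \<ge> Suc n" for k
    using n that by (cases "(q, l, f, k)" rule: letter_op.cases) auto
  have s: "cmod (shift_weight q k) \<le> 1" for k
    using even_power_le_1[of k] by (simp add: shift_weight_def power_mult)
  have qk: "cmod (q ^ k) \<le> 1" for k
    using q by (simp add: norm_power power_le_one abs_square_less_1 less_imp_le)
  have *: "cmod (a * b) \<le> cmod b" if "cmod a \<le> 1" for a b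
    using that by (simp add: norm_mult mult_left_le_one_le)
  \<comment> \<open>This range contains every index \<open>Suc k\<close> with
    \<open>k < Suc n\<close>, which the backward shift reads.\<close>
  have norm_n: "seq_norm f = L2_set (\<lambda>k. cmod (f k)) {..<Suc (Suc n)}" (is "_ = L2_set _ ?S")
    by (rule seq_norm_eq) (simp add: n)
  have norm_l: "seq_norm (letter_op q l f) = L2_set (\<lambda>k. cmod (letter_op q l f k)) {..<Suc n}"
    by (rule seq_norm_eq) (simp add: n2)
  obtain g b where l: "l = (g, b)" by (cases l)
  consider "l = (Alpha, False)" | "l = (Alpha, True)" | "g = Gamma" unfolding l by (cases g; cases b) auto
  then show ?thesis
  proof cases
    case 1
    have "(\<Sum>k<Suc n. (cmod (letter_op q l f k))\<^sup>2) \<le> (\<Sum>k<Suc n. (cmod (f (Suc k)))\<^sup>2)"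
      unfolding 1 by (intro sum_mono power_mono) (simp_all only: letter_op.simps * s norm_ge_zero)
    also have "\<dots> \<le> (\<Sum>k<Suc (Suc n). (cmod (f k))\<^sup>2)"
      by (subst (2) sum.lessThan_Suc_shift) simp
    finally show ?thesis
      unfolding norm_n norm_l L2_set_def by simp
  next
    case 2
    have "(\<Sum>k<Suc n. (cmod (letter_op q l f k))\<^sup>2) = (\<Sum>k<n. (cmod (letter_op q l f (Suc k)))\<^sup>2)"
      unfolding 2 by (subst sum.lessThan_Suc_shift) simp
    also have "\<dots> \<le> (\<Sum>k<n. (cmod (f k))\<^sup>2)"
      unfolding 2 by (intro sum_mono power_mono) (auto simp only: letter_op.simps * s norm_ge_zero Suc_not_Zero if_False diff_Suc_1)
    also have "\<dots> \<le> (\<Sum>k<Suc (Suc n). (cmod (f k))\<^sup>2)"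
      by simp
    finally show ?thesis
      unfolding norm_n norm_l L2_set_def by simp
  next
    case 3
    have "(\<Sum>k<Suc n. (cmod (letter_op q l f k))\<^sup>2) \<le> (\<Sum>k<Suc n. (cmod (f k))\<^sup>2)"
      unfolding l 3 by (intro sum_mono power_mono) (use * qk in \<open>auto\<close>)
    also have "\<dots> \<le> (\<Sum>k<Suc (Suc n). (cmod (f k))\<^sup>2)"
      by simp
    finally show ?thesis
      unfolding norm_n norm_l L2_set_def by simp
  qed
qed

lemma word_op_norm_le: "f \<in> fin_seq \<Longrightarrow> seq_norm (word_op q w f) \<le> seq_norm f"
proof -
  assume f: "f \<in> fin_seq"
  have "seq_norm (foldr (letter_op q) l f) \<le> seq_norm f \<and> foldr (letter_op q) l f \<in> fin_seq" for l
  proof (induction l)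
    case (Cons a l)
    then show ?case
      using letter_op_norm_le[of "foldr (letter_op q) l f" a] letter_op_fin_seq[of "foldr (letter_op q) l f" q a]
      by simp
  qed (simp add: f)
  then show ?thesis by (simp add: word_op_def)
qed

text \<open>Words act contractively, so the sum of the absolute values of the coefficients is a
  bound. It is what gives the real \<open>Sup\<close> in \<open>op_norm\<close> its meaning.\<close>

lemma alg_op_norm_bounded:
  obtains C where "\<And>f. f \<in> fin_seq \<Longrightarrow> seq_norm (alg_op q p f) \<le> C * seq_norm f"
proof -
  have "seq_norm (\<lambda>k. \<Sum>w\<in>K. Poly_Mapping.lookup p w * word_op q w f k) \<le> (\<Sum>w\<in>K. cmod (Poly_Mapping.lookup p w)) * seq_norm f"
    if f: "f \<in> fin_seq" for K f
  proof (induction K rule: infinite_finite_induct)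
    case (insert w K)
    have "seq_norm (\<lambda>k. Poly_Mapping.lookup p w * word_op q w f k + (\<Sum>w\<in>K. Poly_Mapping.lookup p w * word_op q w f k))
      \<le> seq_norm (\<lambda>k. Poly_Mapping.lookup p w * word_op q w f k) + seq_norm (\<lambda>k. \<Sum>w\<in>K. Poly_Mapping.lookup p w * word_op q w f k)"
      by (intro seq_norm_add fin_seq_scale fin_seq_sum word_op_fin_seq f)
    also have "\<dots> \<le> cmod (Poly_Mapping.lookup p w) * seq_norm f + (\<Sum>w\<in>K. cmod (Poly_Mapping.lookup p w)) * seq_norm f"
      using insert.IH f by (intro add_mono) (simp_all add: seq_norm_scale word_op_fin_seq mult_left_mono word_op_norm_le)
    finally show ?case
      using insert.hyps by (simp add: distrib_right)
  qed auto
  then show ?thesis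
    by (intro that[of "\<Sum>w\<in>Poly_Mapping.keys p. cmod (Poly_Mapping.lookup p w)"]) (simp add: alg_op_def[abs_def])
qed

definition "op_norm p = Sup ((\<lambda>f. seq_norm (alg_op q p f)) ` {f \<in> fin_seq. seq_norm f \<le> 1})"

lemma op_norm_bound:
  assumes f: "f \<in> fin_seq"
  shows "seq_norm (alg_op q p f) \<le> op_norm p * seq_norm f"
proof -
  obtain C where C: "\<And>f. f \<in> fin_seq \<Longrightarrow> seq_norm (alg_op q p f) \<le> C * seq_norm f"
    using alg_op_norm_bounded by blast
  have bdd: "bdd_above ((\<lambda>f. seq_norm (alg_op q p f)) ` {f \<in> fin_seq. seq_norm f \<le> 1})"
  proof (rule bdd_aboveI2)
    fix f assume "f \<in> {f \<in> fin_seq. seq_norm f \<le> 1}"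
    then have "seq_norm (alg_op q p f) \<le> C * seq_norm f" "seq_norm f \<le> 1" "0 \<le> seq_norm f" using C by auto
    then show "seq_norm (alg_op q p f) \<le> \<bar>C\<bar>"
      using mult_mono[of C "\<bar>C\<bar>" "seq_norm f" 1] by (simp add: abs_ge_self)
  qed
  show ?thesis
  proof (cases "seq_norm f = 0")
    case True
    then show ?thesis using C[OF f] by simp
  next
    case False
    define r where "r = seq_norm f"
    have r: "r > 0" using False seq_norm_nonneg[OF f] by (simp add: r_def)
    define c where "c = complex_of_real (1 / r)"
    have c: "cmod c = 1 / r" using r by (simp add: c_def norm_divide)
    have "(\<lambda>k. c * f k) \<in> {f \<in> fin_seq. seq_norm f \<le> 1}"
      using r fin_seq_scale[OF f] by (simp add: seq_norm_scale[OF f] c r_def)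
    from cSup_upper[OF imageI[OF this] bdd]
    have "seq_norm (alg_op q p (\<lambda>k. c * f k)) \<le> op_norm p"
      by (simp only: op_norm_def)
    moreover have "alg_op q p (\<lambda>k. c * f k) = (\<lambda>k. c * alg_op q p f k)"
      by (rule ext) (simp add: alg_op_def word_op_scale sum_distrib_left mult_ac)
    moreover have "seq_norm (\<lambda>k. c * alg_op q p f k) = (1 / r) * seq_norm (alg_op q p f)"
      by (simp only: seq_norm_scale[OF alg_op_fin_seq[OF f]] c)
    ultimately have "(1 / r) * seq_norm (alg_op q p f) \<le> op_norm p" by simp
    then show ?thesis
      using r by (simp add: r_def field_simps)
  qed
qed

lemma op_norm_le:
  assumes "\<And>f. f \<in> fin_seq \<Longrightarrow> seq_norm (alg_op q p f) \<le> C * seq_norm f" "C \<ge> 0"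
  shows "op_norm p \<le> C"
  unfolding op_norm_def
proof (rule cSup_least)
  show "(\<lambda>f. seq_norm (alg_op q p f)) ` {f \<in> fin_seq. seq_norm f \<le> 1} \<noteq> {}"
    by (auto intro!: exI[of _ "\<lambda>_. 0"])
  fix x assume "x \<in> (\<lambda>f. seq_norm (alg_op q p f)) ` {f \<in> fin_seq. seq_norm f \<le> 1}"
  then obtain f where "f \<in> fin_seq" "seq_norm f \<le> 1" "x = seq_norm (alg_op q p f)" by blast
  then show "x \<le> C"
    using assms(1)[of f] mult_left_mono[of "seq_norm f" 1 C] assms(2) by simp
qed

definition vacuum :: "nat \<Rightarrow> complex" where "vacuum k = (if k = 0 then 1 else 0)"

lemma vacuum: "vacuum \<in> fin_seq" "seq_norm vacuum = 1"
proof -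
  show "vacuum \<in> fin_seq" unfolding fin_seq_def vacuum_def by (auto intro!: exI[of _ 1])
  show "seq_norm vacuum = 1"
    by (subst seq_norm_eq[of 1]) (auto simp: vacuum_def L2_set_def)
qed

lemma op_norm_nonneg: "0 \<le> op_norm p"
proof -
  have "0 \<le> seq_norm (alg_op q p vacuum)"
    by (intro seq_norm_nonneg alg_op_fin_seq vacuum)
  also have "\<dots> \<le> op_norm p * seq_norm vacuum"
    by (rule op_norm_bound[OF vacuum(1)])
  finally show ?thesis by (simp add: vacuum(2))
qed

lemma op_norm_mult: "op_norm (x * y) \<le> op_norm x * op_norm y"
proof (rule op_norm_le)
  fix f assume f: "f \<in> fin_seq"
  have "seq_norm (alg_op q (x * y) f) \<le> op_norm x * seq_norm (alg_op q y f)"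
    unfolding alg_op_mult by (intro op_norm_bound alg_op_fin_seq f)
  also have "\<dots> \<le> op_norm x * (op_norm y * seq_norm f)"
    by (intro mult_left_mono op_norm_bound op_norm_nonneg f)
  finally show "seq_norm (alg_op q (x * y) f) \<le> op_norm x * op_norm y * seq_norm f"
    by (simp add: mult.assoc)
qed (simp add: op_norm_nonneg)

text \<open>Cauchy-Schwarz applied to the squared norm of \<open>x f\<close>, written as the inner
  product of \<open>f\<close> with the action of \<open>free_adj x * x\<close>. This is the
  nontrivial half of the C*-identity.\<close>

lemma op_norm_sq_le: "(op_norm x)\<^sup>2 \<le> op_norm (free_adj x * x)"
proof -
  have "op_norm x \<le> sqrt (op_norm (free_adj x * x))"
  proof (rule op_norm_le)
    fix f assume f: "f \<in> fin_seq"
    have "complex_of_real ((seq_norm (alg_op q x f))\<^sup>2) = seq_ip f (alg_op q (free_adj x * x) f)"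
      unfolding seq_norm_ip[OF alg_op_fin_seq[OF f]] alg_op_mult
      by (rule alg_op_adj[OF f alg_op_fin_seq[OF f]])
    from arg_cong[OF this, of cmod]
    have "(seq_norm (alg_op q x f))\<^sup>2 \<le> seq_norm f * seq_norm (alg_op q (free_adj x * x) f)"
      using seq_Cauchy_Schwarz[OF f alg_op_fin_seq[OF f], of q "free_adj x * x"] by (simp add: norm_power)
    also have "\<dots> \<le> seq_norm f * (op_norm (free_adj x * x) * seq_norm f)"
      by (intro mult_left_mono op_norm_bound seq_norm_nonneg f)
    finally have "(seq_norm (alg_op q x f))\<^sup>2 \<le> (sqrt (op_norm (free_adj x * x)) * seq_norm f)\<^sup>2"
      using op_norm_nonneg by (simp add: power2_eq_square mult_ac)
    then show "seq_norm (alg_op q x f) \<le> sqrt (op_norm (free_adj x * x)) * seq_norm f"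
      by (rule power2_le_imp_le) (simp add: op_norm_nonneg f)
  qed (simp add: op_norm_nonneg)
  then show ?thesis
    using op_norm_nonneg by (metis power_mono real_sqrt_pow2)
qed

lemma op_norm_adj_le: "op_norm (free_adj x) \<le> op_norm x"
proof (rule op_norm_le)
  fix f assume f: "f \<in> fin_seq"
  let ?\<eta> = "alg_op q (free_adj x) f"
  have \<eta>: "?\<eta> \<in> fin_seq" by (intro alg_op_fin_seq f)
  have "complex_of_real ((seq_norm ?\<eta>)\<^sup>2) = seq_ip (alg_op q x ?\<eta>) f"
    unfolding seq_norm_ip[OF \<eta>] by (rule alg_op_adj[OF \<eta> f, symmetric])
  from arg_cong[OF this, of cmod]
  have "(seq_norm ?\<eta>)\<^sup>2 \<le> seq_norm (alg_op q x ?\<eta>) * seq_norm f"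
    using seq_Cauchy_Schwarz[OF alg_op_fin_seq[OF \<eta>] f, of q x] by (simp add: norm_power)
  also have "\<dots> \<le> op_norm x * seq_norm ?\<eta> * seq_norm f"
    by (intro mult_right_mono op_norm_bound seq_norm_nonneg f \<eta>)
  finally have "seq_norm ?\<eta> * seq_norm ?\<eta> \<le> seq_norm ?\<eta> * (op_norm x * seq_norm f)"
    by (simp add: power2_eq_square mult_ac)
  then show "seq_norm ?\<eta> \<le> op_norm x * seq_norm f"
    using seq_norm_nonneg[OF \<eta>] seq_norm_nonneg[OF f] op_norm_nonneg[of x]
    by (cases "seq_norm ?\<eta> = 0") auto
qed (rule op_norm_nonneg)

lemma op_norm_scale: "op_norm (free_scale c x) = cmod c * op_norm x"
proof (rule antisym)
  have eq: "seq_norm (alg_op q (free_scale c x) f) = cmod c * seq_norm (alg_op q x f)" if "f \<in> fin_seq" for f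
    by (simp add: alg_op_scale seq_norm_scale alg_op_fin_seq that)
  show "op_norm (free_scale c x) \<le> cmod c * op_norm x"
    by (rule op_norm_le) (simp_all add: eq mult.assoc mult_left_mono op_norm_bound op_norm_nonneg)
  show "cmod c * op_norm x \<le> op_norm (free_scale c x)"
  proof (cases "c = 0")
    case False
    have "op_norm x \<le> op_norm (free_scale c x) / cmod c"
    proof (rule op_norm_le)
      show "seq_norm (alg_op q x f) \<le> op_norm (free_scale c x) / cmod c * seq_norm f" if "f \<in> fin_seq" for f
        using False op_norm_bound[OF that, of "free_scale c x"] by (simp add: eq that field_simps)
    qed (simp add: op_norm_nonneg)
    then show ?thesis using False by (simp add: field_simps)
  qed (simp add: op_norm_nonneg)
qed

lemma op_norm_seminorm: "cstar_seminorm_on UNIV free_scale free_adj op_norm"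
  unfolding cstar_seminorm_on_def
proof (intro conjI ballI allI)
  fix x y
  show "op_norm (x + y) \<le> op_norm x + op_norm y"
  proof (rule op_norm_le)
    fix f assume f: "f \<in> fin_seq"
    have "seq_norm (alg_op q (x + y) f) \<le> seq_norm (alg_op q x f) + seq_norm (alg_op q y f)"
      unfolding alg_op_add by (intro seq_norm_add alg_op_fin_seq f)
    then show "seq_norm (alg_op q (x + y) f) \<le> (op_norm x + op_norm y) * seq_norm f"
      using op_norm_bound[OF f, of x] op_norm_bound[OF f, of y] by (simp add: distrib_right)
  qed (simp add: op_norm_nonneg)
  have "op_norm (free_adj x * x) \<le> op_norm (free_adj x) * op_norm x" by (rule op_norm_mult)
  also have "\<dots> \<le> (op_norm x)\<^sup>2"
    unfolding power2_eq_square by (intro mult_right_mono op_norm_adj_le op_norm_nonneg)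
  finally show "op_norm (free_adj x * x) = (op_norm x)\<^sup>2"
    using op_norm_sq_le by (intro antisym)
qed (simp_all add: op_norm_nonneg op_norm_mult op_norm_scale)

lemma op_norm_relator:
  assumes "r \<in> SUq2_relators q"
  shows "op_norm r = 0"
proof -
  have w: "shift_weight q k * shift_weight q k = 1 - complex_of_real q ^ k * complex_of_real q ^ k" for k
  proof -
    have "sqrt (1 - q ^ (2 * k)) * sqrt (1 - q ^ (2 * k)) = 1 - q ^ (2 * k)"
      using even_power_le_1[of k] by simp
    then have "shift_weight q k * shift_weight q k = complex_of_real (1 - q ^ (2 * k))"
      unfolding shift_weight_def by (metis of_real_mult)
    then show ?thesis by (simp add: mult_2 power_add)
  qed
  \<comment> \<open>Position 0 is separate because the adjoint of the shift vanishes there, in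
    agreement with the weight 0 at that place.\<close>
  have "\<forall>r\<in>SUq2_relators q. alg_op q r f k = 0" for f k
    unfolding SUq2_relators_def Let_def
    by (cases k) (simp_all add: alg_op_diff alg_op_add alg_op_mult alg_op_scale w power2_eq_square algebra_simps)
  then have "alg_op q r f = (\<lambda>_. 0)" for f using assms by blast
  then have "op_norm r \<le> 0" by (intro op_norm_le) auto
  then show ?thesis using op_norm_nonneg[of r] by simp
qed

text \<open>\<open>vacuum\<close> is fixed by the action of \<open>adj \<gamma> * \<gamma>\<close>
  since \<open>q ^ 0 = 1\<close>, and the universal norm dominates \<open>op_norm\<close>. This
  lower bound is all that is drawn from the concrete representation.\<close>

lemma SUq2_norm_gamma:
  assumes "is_SUq2 q \<alpha> \<gamma>"
  shows "1 \<le> norm (adj \<gamma> * \<gamma>)"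
proof -
  let ?e = "\<lambda>g. case g of Alpha \<Rightarrow> \<alpha> | Gamma \<Rightarrow> \<gamma>" and ?p = "free_adj (free_gen Gamma) * free_gen Gamma"
  have "alg_op q ?p vacuum = vacuum"
    by (rule ext) (simp add: alg_op_mult vacuum_def)
  then have "1 \<le> op_norm ?p"
    using op_norm_bound[OF vacuum(1), of ?p] by (simp add: vacuum)
  also have "\<dots> \<le> norm (free_eval ?e ?p)"
    using assms op_norm_seminorm op_norm_relator unfolding is_SUq2_def universal_cstar_def by blast
  finally show ?thesis by (simp add: free_eval_mult free_eval_adj)
qed

end

section \<open>Mean ergodic projection\<close>

lemma norm_geometric_sum_le:
  fixes z :: complex
  assumes "cmod z = 1" "z \<noteq> 1"
  shows "cmod (\<Sum>j<n. z ^ j) \<le> 2 / cmod (1 - z)"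
proof -
  have "cmod (1 - z ^ n) \<le> 2"
    using norm_triangle_ineq4[of 1 "z ^ n"] assms(1) by (simp add: norm_power)
  moreover have "(\<Sum>j<n. z ^ j) = (1 - z ^ n) / (1 - z)"
    using assms(2) by (simp add: sum_gp_strict)
  ultimately show ?thesis
    by (simp add: norm_divide divide_right_mono)
qed

text \<open>The averages of \<open>\<omega>\<^bsup>-j\<^esup> S\<^sup>j\<close> fix the eigenvectors of \<open>S\<close> with eigenvalue \<open>\<omega>\<close> and tend to \<open>0\<close> on
  the other ones.\<close>

lemma ergodic_projection:
  fixes S :: "'a::cstar_algebra \<Rightarrow> 'a"
  assumes S: "star_hom S" and \<omega>: "cmod \<omega> = 1"
    and M: "\<And>m. m \<in> M \<Longrightarrow> \<exists>c. cmod c = 1 \<and> S m = c *\<^sub>C m"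
    and y: "y \<in> closure (span M)" "S y = \<omega> *\<^sub>C y"
  shows "y \<in> closure (span {m \<in> M. S m = \<omega> *\<^sub>C m})" (is "_ \<in> closure (span ?M0)")
proof -
  define A where "A n x = (1 / real (Suc n)) *\<^sub>R (\<Sum>j<Suc n. (cnj \<omega> ^ j) *\<^sub>C (S ^^ j) x)" for n x
  have \<omega>1: "cnj \<omega> * \<omega> = 1" using \<omega> by (metis complex_norm_square mult.commute of_real_1 one_power2)
  have Sj: "star_hom (S ^^ j)" for j
    by (induction j) (auto simp: star_hom_def intro: S star_hom_comp simp: star_hom_simps[OF S])
  have A_add: "A n (x + x') = A n x + A n x'" for n x x'
    by (simp only: A_def star_hom_add[OF Sj] scaleC_add_right sum.distrib scaleR_add_right)
  have A_scale: "A n (r *\<^sub>R x) = r *\<^sub>R A n x" for n r x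
  proof -
    have "(S ^^ j) (r *\<^sub>R x) = r *\<^sub>R (S ^^ j) x" for j
      by (simp only: scaleR_scaleC star_hom_scaleC[OF Sj])
    then show ?thesis
      by (simp only: A_def scaleC_scaleR_commute scaleR_right.sum[symmetric] scaleR_left_commute)
  qed
  have A_norm: "norm (A n x) \<le> norm x" for n x
  proof -
    have "norm (\<Sum>j<Suc n. (cnj \<omega> ^ j) *\<^sub>C (S ^^ j) x) \<le> (\<Sum>j<Suc n. norm x)"
      using \<omega> by (intro sum_norm_le) (simp add: norm_scaleC norm_power star_hom_norm_le[OF Sj])
    then show ?thesis
      by (simp add: A_def field_simps del: sum.lessThan_Suc)
  qed
  have eig: "(S ^^ j) m = (c ^ j) *\<^sub>C m" if "S m = c *\<^sub>C m" for j m c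
    by (induction j) (simp_all add: scaleC_one star_hom_scaleC[OF S] that scaleC_scaleC mult.commute)
  have A_eig: "A n m = ((1 / real (Suc n)) *\<^sub>R (\<Sum>j<Suc n. (cnj \<omega> * c) ^ j)) *\<^sub>C m" if "S m = c *\<^sub>C m" for n m c
    by (simp only: A_def eig[OF that] scaleC_scaleC scaleR_scaleC scaleC_sum_left[symmetric] power_mult_distrib)
      (simp add: scaleC_complex_def scaleC_scaleC)
  have A_\<omega>: "A n m = m" if "S m = \<omega> *\<^sub>C m" for n m
  proof -
    have "(1 / real (Suc n)) *\<^sub>R (\<Sum>j<Suc n. (cnj \<omega> * \<omega>) ^ j) = 1"
      by (simp add: \<omega>1 scaleR_conv_of_real del: of_nat_Suc sum.lessThan_Suc)
    then show ?thesis by (simp only: A_eig[OF that] scaleC_one)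
  qed
  have conv: "\<exists>x'\<in>span ?M0. (\<lambda>n. A n x) \<longlonglongrightarrow> x'" if "x \<in> span M" for x
    using that
  proof (induction rule: span_induct_alt)
    case base
    have "A n 0 = 0" for n using A_scale[of n 0 0] by simp
    then show ?case by (auto intro!: bexI[of _ 0] span_zero)
  next
    case (step r m x)
    then obtain x' where x': "x' \<in> span ?M0" "(\<lambda>n. A n x) \<longlonglongrightarrow> x'" by blast
    obtain c where c: "cmod c = 1" "S m = c *\<^sub>C m" using M step by blast
    have "\<exists>m'\<in>span ?M0. (\<lambda>n. A n m) \<longlonglongrightarrow> m'"
    proof (cases "c = \<omega>")
      case True
      then show ?thesis
        using step c by (intro bexI[of _ m]) (auto simp: A_\<omega> intro: span_base)
    next
      case False
      define z where "z = cnj \<omega> * c"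
      have z: "cmod z = 1" "z \<noteq> 1"
      proof -
        show "cmod z = 1" using \<omega> c by (simp add: z_def norm_mult)
        show "z \<noteq> 1"
        proof
          assume "z = 1"
          then have "\<omega> * (cnj \<omega> * c) = \<omega>" by (simp add: z_def)
          then have "(cnj \<omega> * \<omega>) * c = \<omega>" by (simp only: mult_ac)
          then show False using \<omega>1 False by simp
        qed
      qed
      have le: "norm (A n m) \<le> (2 / cmod (1 - z) * norm m) * inverse (real (Suc n))" for n
      proof -
        have "A n m = ((1 / real (Suc n)) *\<^sub>R (\<Sum>j<Suc n. z ^ j)) *\<^sub>C m"
          unfolding z_def by (rule A_eig[OF c(2)])
        then have "norm (A n m) = (inverse (real (Suc n)) * cmod (\<Sum>j<Suc n. z ^ j)) * norm m"
          by (simp only: norm_scaleC norm_scaleR divide_inverse mult_1 abs_inverse abs_of_nat)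
        also have "\<dots> \<le> (inverse (real (Suc n)) * (2 / cmod (1 - z))) * norm m"
          using norm_geometric_sum_le[OF z, of "Suc n"]
          by (intro mult_right_mono mult_left_mono norm_ge_zero) (simp_all del: sum.lessThan_Suc)
        also have "\<dots> = (2 / cmod (1 - z) * norm m) * inverse (real (Suc n))"
          by (simp only: mult_ac)
        finally show ?thesis .
      qed
      have "(\<lambda>n. A n m) \<longlonglongrightarrow> 0"
      proof (rule Lim_null_comparison[OF always_eventually[OF allI[OF le]]])
        show "(\<lambda>n. 2 / cmod (1 - z) * norm m * inverse (real (Suc n))) \<longlonglongrightarrow> 0"
          by (rule tendsto_mult_right_zero[OF LIMSEQ_inverse_real_of_nat])
      qed
      then show ?thesis by (intro bexI[of _ 0]) (auto intro: span_zero)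
    qed
    then obtain m' where m': "m' \<in> span ?M0" "(\<lambda>n. A n m) \<longlonglongrightarrow> m'" by blast
    have "(\<lambda>n. A n (r *\<^sub>R m + x)) \<longlonglongrightarrow> r *\<^sub>R m' + x'"
      unfolding A_add A_scale by (intro tendsto_intros m' x')
    moreover have "r *\<^sub>R m' + x' \<in> span ?M0"
      using m' x' by (intro span_add span_scale)
    ultimately show ?case by blast
  qed
  show ?thesis
    unfolding closure_approachable
  proof (intro allI impI)
    fix e :: real assume e: "e > 0"
    then obtain x where x: "x \<in> span M" "dist x y < e / 2"
      using y(1) unfolding closure_approachable by (meson half_gt_zero)
    obtain x' where x': "x' \<in> span ?M0" "(\<lambda>n. A n x) \<longlonglongrightarrow> x'" using conv[OF x(1)] by blast
    \<comment> \<open>The averages fix \<open>y\<close> and are contractive, so the approximation of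
      \<open>y\<close> by \<open>x\<close> survives averaging and passes to the limit in the smaller
      span.\<close>
    have "norm (A n x - y) \<le> e / 2" for n
    proof -
      have "A n x - y = A n (x + (- 1) *\<^sub>R y)"
        by (simp only: A_add A_scale A_\<omega>[OF y(2)]) simp
      then show ?thesis using A_norm[of n "x + (- 1) *\<^sub>R y"] x(2) by (simp add: dist_norm)
    qed
    then have "norm (x' - y) \<le> e / 2"
      by (intro Lim_norm_ubound[OF _ tendsto_diff[OF x'(2) tendsto_const]]) auto
    then show "\<exists>m\<in>span ?M0. dist m y < e"
      using x' e by (intro bexI[of _ x']) (auto simp: dist_norm)
  qed
qed

lemma closure_span_image:
  assumes "bounded_linear T" "subspace W" "closed W" "\<And>m. m \<in> M \<Longrightarrow> T m \<in> W" "x \<in> closure (span M)"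
  shows "T x \<in> W"
proof -
  have "T ` span M \<subseteq> W"
    using assms(1,2,4) by (metis image_subsetI linear_span_image bounded_linear.linear span_minimal)
  moreover have "continuous_on UNIV T"
    using assms(1) by (intro linear_continuous_on)
  ultimately have "T ` closure (span M) \<subseteq> W"
    using assms(3) by (intro image_closure_subset) (auto intro: continuous_on_subset)
  then show ?thesis using assms(5) by blast
qed

text \<open>\<open>span\<close> is real linear, so complex lines are introduced separately. They are
  the closed targets into which \<open>closure_span_image\<close> confines products with
  \<open>p\<close>.\<close>

definition cline :: "'a::cstar_algebra \<Rightarrow> 'a set" where
  "cline v = range (\<lambda>c. c *\<^sub>C v)"

lemma subspace_cline: "subspace (cline v)"
  unfolding subspace_def cline_def
proof (intro conjI ballI allI)
  show "0 \<in> range (\<lambda>c. c *\<^sub>C v)" by (rule image_eqI[of _ _ 0]) auto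
  show "x + y \<in> range (\<lambda>c. c *\<^sub>C v)" if "x \<in> range (\<lambda>c. c *\<^sub>C v)" "y \<in> range (\<lambda>c. c *\<^sub>C v)" for x y
    using that by (auto simp flip: scaleC_add_left)
  show "r *\<^sub>R x \<in> range (\<lambda>c. c *\<^sub>C v)" if "x \<in> range (\<lambda>c. c *\<^sub>C v)" for r x
    using that by (auto simp: scaleR_scaleC scaleC_scaleC)
qed

lemma closed_cline: "closed (cline v)"
proof (cases "v = 0")
  case False
  show ?thesis
    unfolding closed_sequential_limits
  proof (intro allI impI, elim conjE)
    fix x l assume x: "\<forall>n. x n \<in> cline v" and l: "x \<longlonglongrightarrow> l"
    from x have "\<forall>n. \<exists>d. x n = d *\<^sub>C v" by (auto simp: cline_def)
    then obtain c where c: "\<And>n. x n = c n *\<^sub>C v" by metis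
    have "Cauchy c"
    proof (rule metric_CauchyI)
      fix e :: real assume "e > 0"
      then have "e * norm v > 0" using False by simp
      then obtain N where N: "\<forall>m\<ge>N. \<forall>n\<ge>N. dist (x m) (x n) < e * norm v"
        using metric_CauchyD[OF LIMSEQ_imp_Cauchy[OF l]] by blast
      have "dist (c m) (c n) < e" if "m \<ge> N" "n \<ge> N" for m n
      proof -
        have "dist (x m) (x n) = dist (c m) (c n) * norm v"
          by (simp add: dist_norm c norm_scaleC flip: scaleC_diff_left)
        then show ?thesis using N that False by (metis mult_less_cancel_right norm_ge_zero not_less zero_less_norm_iff)
      qed
      then show "\<exists>N. \<forall>m\<ge>N. \<forall>n\<ge>N. dist (c m) (c n) < e" by blast
    qed
    then obtain d where d: "c \<longlonglongrightarrow> d" using Cauchy_convergent convergent_def by blast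
    have "(\<lambda>n. norm (x n - d *\<^sub>C v)) \<longlonglongrightarrow> 0"
      using tendsto_mult_left_zero[OF tendsto_norm_zero[OF LIM_zero[OF d]], of "norm v"]
      by (simp add: c norm_scaleC flip: scaleC_diff_left)
    then have "x \<longlonglongrightarrow> d *\<^sub>C v" using LIM_zero_cancel tendsto_norm_zero_iff by blast
    then have "l = d *\<^sub>C v" using l LIMSEQ_unique by blast
    then show "l \<in> cline v" by (auto simp: cline_def)
  qed
qed (simp add: cline_def)

text \<open>Roots of unity are countable in number, while the circle is uncountable. The powers of
  such a \<open>z\<close> separate integer weights, so a single rotation can stand for the whole
  circle action.\<close>

lemma not_root_of_unity:
  obtains z :: complex where "cmod z = 1" "\<And>n. z powi n = 1 \<Longrightarrow> n = 0"
proof -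
  have "countable (\<Union>n\<in>{0<..}. {z::complex. z ^ n = 1})"
    by (rule countable_UN) (auto intro!: countable_finite finite_roots_unity)
  moreover have "uncountable (sphere (0::complex) 1)"
    by (rule connected_uncountable[of _ 1 "- 1"]) (auto intro!: connected_sphere)
  ultimately obtain z where z: "z \<in> sphere 0 1" "z \<notin> (\<Union>n\<in>{0<..}. {z::complex. z ^ n = 1})"
    by (meson countable_subset subsetI)
  have "n = 0" if "z powi n = 1" for n
  proof (rule ccontr)
    assume "n \<noteq> 0"
    then have "nat \<bar>n\<bar> > 0" by simp
    moreover have "z ^ nat \<bar>n\<bar> = 1"
      using that z(1) by (cases "n \<ge> 0") (auto simp: power_int_def power_inverse)
    ultimately show False using z(2) by auto
  qed
  with z(1) show ?thesis using that by auto
qed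

section \<open>The structure of \<open>SU\<^sub>q(2)\<close>\<close>

definition SUq2_rel :: "real \<Rightarrow> 'a::cstar_algebra \<Rightarrow> 'a \<Rightarrow> bool" where
  "SUq2_rel q a c \<longleftrightarrow> adj a * a + adj c * c = 1 \<and> a * adj a + q\<^sup>2 *\<^sub>R (c * adj c) = 1 \<and>
     a * c = q *\<^sub>R (c * a) \<and> a * adj c = q *\<^sub>R (adj c * a) \<and> c * adj c = adj c * c"

lemma SUq2_rel_iff:
  "(\<forall>r\<in>SUq2_relators q. free_eval (case_SUq2_gen a c) r = 0) \<longleftrightarrow> SUq2_rel q a c"
  unfolding SUq2_relators_def Let_def SUq2_rel_def
  by (simp add: free_eval_simps scaleR_scaleC)

lemma star_hom_free_eval:
  assumes f: "star_hom f"
  shows "f (free_eval e p) = free_eval (\<lambda>g. f (e g)) p"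
proof (rule additive_poly_mapping_eq[where p = p])
  have "f (word_eval e w) = word_eval (\<lambda>g. f (e g)) w" for w
  proof -
    have "f (prod_list (map (\<lambda>(g, b). if b then adj (e g) else e g) l)) =
        prod_list (map (\<lambda>(g, b). if b then adj (f (e g)) else f (e g)) l)" for l
      by (induction l) (auto simp: star_hom_simps[OF f])
    then show ?thesis by (simp add: word_eval_def)
  qed
  then show "f (free_eval e (Poly_Mapping.single w c)) = free_eval (\<lambda>g. f (e g)) (Poly_Mapping.single w c)" for w c
    by (simp add: star_hom_simps[OF f])
qed (simp_all add: free_eval_add star_hom_simps[OF f])

lemma telescoping_geometric_limit:
  fixes x :: "nat \<Rightarrow> 'a::banach"
  assumes "\<And>n. norm (x (Suc n) - x n) \<le> C * t ^ n" "0 \<le> t" "t < 1"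
  obtains l where "x \<longlonglongrightarrow> l" "\<And>n. norm (x n - l) \<le> C * t ^ n / (1 - t)"
proof -
  have C: "C \<ge> 0" using order_trans[OF norm_ge_zero assms(1)[of 0]] by simp
  have "summable (\<lambda>n. x (Suc n) - x n)"
    by (rule summable_comparison_test'[of "\<lambda>n. C * t ^ n" 0])
      (use assms in \<open>auto intro!: summable_mult summable_geometric\<close>)
  then obtain s where "(\<lambda>n. \<Sum>k<n. x (Suc k) - x k) \<longlonglongrightarrow> s"
    unfolding summable_def sums_def by blast
  then have "(\<lambda>n. x n - x 0) \<longlonglongrightarrow> s" by (simp add: sum_lessThan_telescope)
  from tendsto_add[OF this tendsto_const[of "x 0"]] have l: "x \<longlonglongrightarrow> s + x 0" by simp
  have step: "norm (x (n + k) - x n) \<le> C * t ^ n * (1 - t ^ k) / (1 - t)" for n k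
  proof (induction k)
    case (Suc k)
    have "norm (x (n + Suc k) - x n) \<le> norm (x (Suc (n + k)) - x (n + k)) + norm (x (n + k) - x n)"
      using norm_triangle_ineq[of "x (Suc (n + k)) - x (n + k)" "x (n + k) - x n"] by simp
    also have "\<dots> \<le> C * t ^ (n + k) + C * t ^ n * (1 - t ^ k) / (1 - t)"
      using assms(1)[of "n + k"] Suc by simp
    also have "\<dots> = C * t ^ n * (1 - t ^ Suc k) / (1 - t)"
      using assms(3) by (simp add: field_simps power_add)
    finally show ?case .
  qed simp
  have "norm (x (n + k) - x n) \<le> C * t ^ n / (1 - t)" for n k
  proof -
    have "C * t ^ n * (1 - t ^ k) \<le> C * t ^ n * 1"
      using C assms by (intro mult_left_mono) auto
    then have "C * t ^ n * (1 - t ^ k) / (1 - t) \<le> C * t ^ n / (1 - t)"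
      using assms(3) by (simp add: divide_right_mono)
    with step[of n k] show ?thesis by (rule order_trans)
  qed
  then have le: "\<forall>\<^sub>F k in sequentially. norm (x (n + k) - x n) \<le> C * t ^ n / (1 - t)" for n
    by (intro always_eventually allI)
  have lim: "(\<lambda>k. x (n + k) - x n) \<longlonglongrightarrow> s + x 0 - x n" for n
    using LIMSEQ_ignore_initial_segment[OF l, of n] by (intro tendsto_diff tendsto_const) (simp only: add.commute)
  have "norm (s + x 0 - x n) \<le> C * t ^ n / (1 - t)" for n
    by (rule Lim_norm_ubound[OF trivial_limit_sequentially lim le])
  then have "norm (x n - (s + x 0)) \<le> C * t ^ n / (1 - t)" for n
    by (simp only: norm_minus_commute)
  with l show ?thesis by (rule that)
qed

lemma commute_scaled_power:
  fixes x y :: "'a::real_algebra_1"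
  assumes "y * x = r *\<^sub>R (x * y)"
  shows "y * x ^ k = r ^ k *\<^sub>R (x ^ k * y)"
proof (induction k)
  case (Suc k)
  have "y * x ^ Suc k = (y * x) * x ^ k" by (simp add: mult.assoc)
  also have "\<dots> = r *\<^sub>R (x * (y * x ^ k))" by (simp add: assms mult.assoc)
  also have "\<dots> = r ^ Suc k *\<^sub>R (x ^ Suc k * y)" by (simp add: Suc mult.assoc)
  finally show ?case .
qed simp

locale suq2 =
  fixes q :: real and \<alpha> \<gamma> :: "'a::cstar_algebra"
  assumes q_pos: "0 < q\<^sup>2" and q_less: "q\<^sup>2 < 1" and SUq2: "is_SUq2 q \<alpha> \<gamma>"
begin

abbreviation gens :: "SUq2_gen \<Rightarrow> 'a" where "gens \<equiv> case_SUq2_gen \<alpha> \<gamma>"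

definition h :: 'a where "h = adj \<gamma> * \<gamma>"
definition t :: real where "t = q\<^sup>2"

lemma t: "0 < t" "t < 1"
  using q_pos q_less by (auto simp: t_def)

lemma q_nonzero: "q \<noteq> 0"
  using q_pos by auto

lemma rel: "SUq2_rel q \<alpha> \<gamma>"
  using SUq2 unfolding is_SUq2_def universal_cstar_def SUq2_rel_iff[symmetric] by blast

lemma dense: "closure (range (free_eval gens)) = UNIV"
  using SUq2 unfolding is_SUq2_def universal_cstar_def by blast

lemma gamma_normal: "\<gamma> * adj \<gamma> = h"
  and adj_alpha_alpha: "adj \<alpha> * \<alpha> = 1 - h"
  and alpha_adj_alpha: "\<alpha> * adj \<alpha> = 1 - t *\<^sub>R h"
  and alpha_gamma: "\<alpha> * \<gamma> = q *\<^sub>R (\<gamma> * \<alpha>)"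
  and alpha_adj_gamma: "\<alpha> * adj \<gamma> = q *\<^sub>R (adj \<gamma> * \<alpha>)"
proof -
  have 1: "adj \<alpha> * \<alpha> + h = 1" and 2: "\<alpha> * adj \<alpha> + t *\<^sub>R (\<gamma> * adj \<gamma>) = 1"
    and 3: "\<alpha> * \<gamma> = q *\<^sub>R (\<gamma> * \<alpha>)" and 4: "\<alpha> * adj \<gamma> = q *\<^sub>R (adj \<gamma> * \<alpha>)"
    and 5: "\<gamma> * adj \<gamma> = h"
    using rel unfolding SUq2_rel_def h_def t_def by blast+
  show "\<gamma> * adj \<gamma> = h" by (rule 5)
  show "adj \<alpha> * \<alpha> = 1 - h" using 1 by (simp add: eq_diff_eq)
  show "\<alpha> * adj \<alpha> = 1 - t *\<^sub>R h" using 2 by (simp add: eq_diff_eq 5)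
  show "\<alpha> * \<gamma> = q *\<^sub>R (\<gamma> * \<alpha>)" by (rule 3)
  show "\<alpha> * adj \<gamma> = q *\<^sub>R (adj \<gamma> * \<alpha>)" by (rule 4)
qed

lemma adj_gamma_adj_alpha: "adj \<gamma> * adj \<alpha> = q *\<^sub>R (adj \<alpha> * adj \<gamma>)"
  by (metis alpha_gamma adj_mult adj_scaleR)

lemma gamma_adj_alpha: "\<gamma> * adj \<alpha> = q *\<^sub>R (adj \<alpha> * \<gamma>)"
  by (metis alpha_adj_gamma adj_mult adj_scaleR adj_adj)

lemma hom_lift:
  assumes "SUq2_rel q a c"
  obtains f where "star_hom f" "f \<alpha> = a" "f \<gamma> = c"
proof -
  obtain f where "star_hom f" "\<And>g. f (gens g) = case_SUq2_gen a c g"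
    using universal_cstar_lift[of "SUq2_relators q" gens "case_SUq2_gen a c"] SUq2 assms
    unfolding is_SUq2_def SUq2_rel_iff[symmetric] by blast
  then show ?thesis using that[of f] by (metis SUq2_gen.case)
qed

lemma hom_eqI:
  assumes f: "star_hom f" and g: "star_hom g" and eq: "f \<alpha> = g \<alpha>" "f \<gamma> = g \<gamma>"
  shows "f x = g x"
proof (rule dense_induct[OF dense])
  show "closed {x. f x = g x}"
    by (intro closed_Collect_eq continuous_on_star_hom[OF f] continuous_on_star_hom[OF g] continuous_on_id)
  have "(\<lambda>s. f (gens s)) = (\<lambda>s. g (gens s))"
    using eq by (auto split: SUq2_gen.split)
  then show "f x = g x" if "x \<in> range (free_eval gens)" for x
    using that by (auto simp: star_hom_free_eval[OF f] star_hom_free_eval[OF g])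
qed

text \<open>A word arises from 1 by prefixing letters, so stability under left multiplication by the
  four letters already captures the dense image of the free algebra.\<close>

lemma closure_invariant_subspace:
  assumes V: "subspace V" "\<And>c x. x \<in> V \<Longrightarrow> c *\<^sub>C x \<in> V" "1 \<in> V"
    and "\<And>x. x \<in> V \<Longrightarrow> \<alpha> * x \<in> V" "\<And>x. x \<in> V \<Longrightarrow> adj \<alpha> * x \<in> V"
      "\<And>x. x \<in> V \<Longrightarrow> \<gamma> * x \<in> V" "\<And>x. x \<in> V \<Longrightarrow> adj \<gamma> * x \<in> V"
  shows "x \<in> closure V"
proof -
  have "word_eval gens w \<in> V" for w
  proof -
    have "prod_list (map (\<lambda>(g, b). if b then adj (gens g) else gens g) l) \<in> V" for l
      by (induction l) (use assms in \<open>auto split: SUq2_gen.split\<close>)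
    then show ?thesis by (simp add: word_eval_def)
  qed
  then have "range (free_eval gens) \<subseteq> V"
    using V by (auto simp: free_eval_word intro!: subspace_sum)
  then show ?thesis using dense closure_mono by blast
qed

section \<open>Powers of \<open>h\<close> and the limit projection\<close>

lemma h_selfadj: "adj h = h"
  by (simp add: h_def adj_mult adj_adj)

lemma gamma_h: "\<gamma> * h = h * \<gamma>"
  by (metis h_def gamma_normal mult.assoc)

lemma adj_gamma_h: "adj \<gamma> * h = h * adj \<gamma>"
  by (metis h_def gamma_normal mult.assoc)

lemma alpha_h: "\<alpha> * h = t *\<^sub>R (h * \<alpha>)"
proof -
  have "\<alpha> * h = (\<alpha> * adj \<gamma>) * \<gamma>" by (simp add: h_def mult.assoc)
  also have "\<dots> = q *\<^sub>R (adj \<gamma> * (\<alpha> * \<gamma>))" by (simp add: alpha_adj_gamma mult.assoc)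
  also have "\<dots> = t *\<^sub>R (h * \<alpha>)" by (simp add: alpha_gamma h_def t_def power2_eq_square mult.assoc)
  finally show ?thesis .
qed

lemma h_adj_alpha: "h * adj \<alpha> = t *\<^sub>R (adj \<alpha> * h)"
  by (metis alpha_h adj_mult adj_scaleR h_selfadj)

lemma h_power_adj_alpha: "h ^ n * adj \<alpha> = t ^ n *\<^sub>R (adj \<alpha> * h ^ n)"
proof (induction n)
  case (Suc n)
  have "h ^ Suc n * adj \<alpha> = h * (h ^ n * adj \<alpha>)" by (simp add: mult.assoc)
  also have "\<dots> = t ^ n *\<^sub>R ((h * adj \<alpha>) * h ^ n)" by (simp add: Suc mult.assoc)
  also have "\<dots> = t ^ Suc n *\<^sub>R (adj \<alpha> * h ^ Suc n)" by (simp add: h_adj_alpha mult.assoc)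
  finally show ?case .
qed simp

lemma h_power_diff: "h ^ n - h ^ Suc n = t ^ n *\<^sub>R (adj \<alpha> * h ^ n * \<alpha>)"
proof -
  have "h ^ n - h ^ Suc n = h ^ n * (adj \<alpha> * \<alpha>)"
    by (simp add: adj_alpha_alpha right_diff_distrib power_commutes)
  then show ?thesis
    by (simp add: h_power_adj_alpha flip: mult.assoc)
qed

lemma norm_h_power_diff: "norm (h ^ n - h ^ Suc n) \<le> (norm \<alpha>)\<^sup>2 * t ^ n * norm h ^ n"
proof -
  have "norm (adj \<alpha> * h ^ n * \<alpha>) \<le> norm \<alpha> * norm h ^ n * norm \<alpha>"
    using order_trans[OF norm_mult_ineq mult_right_mono[OF norm_mult_ineq norm_ge_zero], of "adj \<alpha>" "h ^ n" \<alpha>]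
    by (simp add: selfadj_norm_power[OF h_selfadj])
  then show ?thesis
    using t unfolding h_power_diff by (simp add: power2_eq_square mult_ac mult_left_mono)
qed

text \<open>Comparing \<open>\<parallel>h\<^sup>n\<parallel> = \<parallel>h\<parallel>\<^sup>n\<close> with \<open>h\<^sup>n - h\<^bsup>n+1\<^esup> = q\<^bsup>2n\<^esup> \<alpha>\<^sup>* h\<^sup>n \<alpha>\<close> replaces an appeal to
  positivity of \<open>\<alpha>\<^sup>* \<alpha>\<close>.\<close>

lemma norm_h: "norm h = 1"
proof (rule antisym)
  show ge: "1 \<le> norm h"
    unfolding h_def using SUq2_norm_gamma[OF q_less SUq2] .
  have le: "norm h \<le> 1 + (norm \<alpha>)\<^sup>2 * t ^ n" for n
  proof -
    have "norm h ^ Suc n = norm (h ^ Suc n)"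
      by (rule selfadj_norm_power[OF h_selfadj, symmetric])
    also have "\<dots> \<le> norm (h ^ n) + norm (h ^ n - h ^ Suc n)"
      unfolding norm_minus_commute[of "h ^ n"] by (rule norm_triangle_sub)
    also have "\<dots> \<le> norm h ^ n + (norm \<alpha>)\<^sup>2 * t ^ n * norm h ^ n"
      by (intro add_mono norm_h_power_diff norm_power_ineq)
    finally have "norm h ^ n * norm h \<le> norm h ^ n * (1 + (norm \<alpha>)\<^sup>2 * t ^ n)"
      by (simp add: algebra_simps)
    moreover have "0 < norm h ^ n" using ge by (intro zero_less_power) linarith
    ultimately show ?thesis by (simp only: mult_le_cancel_left_pos)
  qed
  have "(\<lambda>n. 1 + (norm \<alpha>)\<^sup>2 * t ^ n) \<longlonglongrightarrow> 1 + (norm \<alpha>)\<^sup>2 * 0"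
    using t by (intro tendsto_intros LIMSEQ_power_zero) auto
  then show "norm h \<le> 1"
    using le by (intro LIMSEQ_le_const[of "\<lambda>n. 1 + (norm \<alpha>)\<^sup>2 * t ^ n"]) auto
qed

text \<open>This plays the role of the spectral projection of \<open>h\<close> at 1, equivalently of
  the projection onto the kernel of \<alpha>.\<close>

definition p :: 'a where "p = lim (\<lambda>n. h ^ n)"

text \<open>The geometric rate matters as much as the limit: its sum yields the lower bound for
  \<open>1 - h\<close> in \<open>null_e_lower_bound\<close>.\<close>

lemma p: "(\<lambda>n. h ^ n) \<longlonglongrightarrow> p" "norm (h ^ n - p) \<le> (norm \<alpha>)\<^sup>2 * t ^ n / (1 - t)"
proof -
  have "norm (h ^ Suc n - h ^ n) \<le> (norm \<alpha>)\<^sup>2 * t ^ n" for n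
    unfolding norm_minus_commute[of "h ^ Suc n"] using norm_h_power_diff[of n] by (simp only: norm_h power_one mult_1_right)
  then obtain l where l: "(\<lambda>n. h ^ n) \<longlonglongrightarrow> l" "\<And>n. norm (h ^ n - l) \<le> (norm \<alpha>)\<^sup>2 * t ^ n / (1 - t)"
    using telescoping_geometric_limit[OF _ less_imp_le[OF t(1)] t(2), of "\<lambda>n. h ^ n"] by blast
  have "p = l" unfolding p_def by (intro limI l)
  then show "(\<lambda>n. h ^ n) \<longlonglongrightarrow> p" "norm (h ^ n - p) \<le> (norm \<alpha>)\<^sup>2 * t ^ n / (1 - t)"
    using l by simp_all
qed

lemma norm_p: "norm p = 1"
proof -
  have "norm (h ^ n) = 1" for n by (simp add: selfadj_norm_power[OF h_selfadj] norm_h)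
  with tendsto_norm[OF p(1)] have "(\<lambda>n::nat. 1) \<longlonglongrightarrow> norm p"
    by (simp only:)
  then show ?thesis by (rule LIMSEQ_unique) (rule tendsto_const)
qed

lemma p_nonzero: "p \<noteq> 0"
  using norm_p by auto

lemma p_selfadj: "adj p = p"
proof -
  have "(\<lambda>n. h ^ n) \<longlonglongrightarrow> adj p"
    using tendsto_adj[OF p(1)] by (simp add: adj_power h_selfadj)
  then show ?thesis using p(1) by (rule LIMSEQ_unique)
qed

lemma p_commute:
  assumes "x * h = h * x"
  shows "x * p = p * x"
proof -
  have "x * h ^ n = h ^ n * x" for n
    using power_commuting_commutes[OF assms[symmetric], of n] by (rule sym)
  moreover have "(\<lambda>n. x * h ^ n) \<longlonglongrightarrow> x * p" "(\<lambda>n. h ^ n * x) \<longlonglongrightarrow> p * x"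
    by (intro tendsto_mult tendsto_const p(1))+
  ultimately show ?thesis
    by (simp add: LIMSEQ_unique)
qed

lemma h_p: "h * p = p"
proof -
  have "(\<lambda>n. h * h ^ n) \<longlonglongrightarrow> p" using LIMSEQ_Suc[OF p(1)] by simp
  moreover have "(\<lambda>n. h * h ^ n) \<longlonglongrightarrow> h * p" by (intro tendsto_mult tendsto_const p(1))
  ultimately show ?thesis by (rule LIMSEQ_unique[symmetric])
qed

lemma p_h: "p * h = p"
  using p_commute[of h] h_p by simp

lemma h_power_p: "h ^ n * p = p"
  by (induction n) (simp_all add: mult.assoc h_p)

lemma p_p: "p * p = p"
proof -
  have "(\<lambda>n. h ^ n * p) \<longlonglongrightarrow> p * p" by (intro tendsto_mult tendsto_const p(1))
  then have "(\<lambda>n::nat. p) \<longlonglongrightarrow> p * p" by (simp only: h_power_p)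
  then show ?thesis by (rule LIMSEQ_unique) (rule tendsto_const)
qed

lemma alpha_p: "\<alpha> * p = 0"
proof (rule adj_mult_eq_0)
  have "adj (\<alpha> * p) * (\<alpha> * p) = p * ((adj \<alpha> * \<alpha>) * p)"
    by (simp add: adj_mult p_selfadj mult.assoc)
  then show "adj (\<alpha> * p) * (\<alpha> * p) = 0"
    by (simp add: adj_alpha_alpha left_diff_distrib h_p)
qed

lemma p_adj_alpha: "p * adj \<alpha> = 0"
  using arg_cong[OF alpha_p, of adj] by (simp add: adj_mult p_selfadj)

lemma gamma_p: "\<gamma> * p = p * \<gamma>" and adj_gamma_p: "adj \<gamma> * p = p * adj \<gamma>"
  by (rule p_commute[OF gamma_h], rule p_commute[OF adj_gamma_h])

lemma adj_gamma_gamma_p: "adj \<gamma> * (\<gamma> * p) = p" and gamma_adj_gamma_p: "\<gamma> * (adj \<gamma> * p) = p"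
  using h_p gamma_normal by (simp_all add: h_def flip: mult.assoc)

text \<open>Unnormalised copies of the basis vectors of the standard representation, realised as
  elements so that left multiplication is the action. Leaving out the normalisation makes them words
  in \<open>adj \<alpha>\<close> times \<open>p\<close>, which homomorphisms map
  transparently.\<close>

definition e :: "nat \<Rightarrow> 'a" where "e k = adj \<alpha> ^ k * p"

lemma e_0: "e 0 = p" and e_Suc: "e (Suc k) = adj \<alpha> * e k"
  by (simp_all add: e_def mult.assoc)

lemma e_p: "e k * p = e k"
  by (simp add: e_def mult.assoc p_p)

lemma h_e: "h * e k = t ^ k *\<^sub>R e k"
proof (induction k)
  case (Suc k)
  have "h * e (Suc k) = t *\<^sub>R (adj \<alpha> * (h * e k))"
    by (simp add: e_Suc h_adj_alpha flip: mult.assoc)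
  then show ?case by (simp add: Suc e_Suc)
qed (simp add: e_0 h_p)

lemma alpha_e: "\<alpha> * e (Suc k) = (1 - t ^ Suc k) *\<^sub>R e k"
proof -
  have "\<alpha> * e (Suc k) = (1 - t *\<^sub>R h) * e k"
    by (simp add: e_Suc alpha_adj_alpha flip: mult.assoc)
  then show ?thesis by (simp add: left_diff_distrib h_e scaleR_left_diff_distrib)
qed

lemma e_nonzero: "e k \<noteq> 0"
proof (induction k)
  case 0
  then show ?case by (simp add: e_0 p_nonzero)
next
  case (Suc k)
  have "t ^ Suc k < 1" using t power_less_one_iff[of t "Suc k"] by simp
  then show ?case using Suc alpha_e[of k] by auto
qed

end

lemma span_linear_closed:
  assumes "linear T" "\<And>m. m \<in> M \<Longrightarrow> T m \<in> span M" "x \<in> span M"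
  shows "T x \<in> span M"
proof -
  have "T ` span M = span (T ` M)" using assms(1) by (rule linear_span_image[symmetric])
  also have "\<dots> \<subseteq> span M" using assms(2) by (intro span_minimal subspace_span) auto
  finally show ?thesis using assms(3) by blast
qed

lemma unit_cnj:
  assumes "cmod z = 1"
  shows "cnj z * z = 1" "z * cnj z = 1"
proof -
  have "z * cnj z = complex_of_real ((cmod z)\<^sup>2)" by (rule complex_norm_square[symmetric])
  then show "z * cnj z = 1" by (simp only: assms) simp
  then show "cnj z * z = 1" by (simp only: mult.commute)
qed

section \<open>The torus of rotations and the monomials\<close>

context suq2
begin

text \<open>Left and right translation by \<open>z\<close> are \<open>rot z (cnj z)\<close> and
  \<open>rot z z\<close>; the two independent parameters make compositions multiplicative in each
  slot. For unit \<open>z\<close> and \<open>w\<close> the chosen map exists by the universal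
  property and is unique by \<open>hom_eqI\<close>.\<close>

definition rot :: "complex \<Rightarrow> complex \<Rightarrow> 'a \<Rightarrow> 'a" where
  "rot z w = (SOME f. star_hom f \<and> f \<alpha> = z *\<^sub>C \<alpha> \<and> f \<gamma> = w *\<^sub>C \<gamma>)"

lemma rot:
  assumes "cmod z = 1" "cmod w = 1"
  shows "star_hom (rot z w)" "rot z w \<alpha> = z *\<^sub>C \<alpha>" "rot z w \<gamma> = w *\<^sub>C \<gamma>"
proof -
  note zw = unit_cnj[OF assms(1)] unit_cnj[OF assms(2)]
  have scale: "(c *\<^sub>C x) * (d *\<^sub>C y) = (c * d) *\<^sub>C (x * y)" for c d and x y :: 'a
    by (simp only: mult_scaleC_left mult_scaleC_right scaleC_scaleC mult.commute[of d c])
  have "SUq2_rel q (z *\<^sub>C \<alpha>) (w *\<^sub>C \<gamma>)"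
    unfolding SUq2_rel_def adj_scaleC scale zw scaleC_one
  proof (intro conjI)
    show "(z * w) *\<^sub>C (\<alpha> * \<gamma>) = q *\<^sub>R (w * z) *\<^sub>C (\<gamma> * \<alpha>)"
      by (simp only: alpha_gamma scaleC_scaleR_commute mult.commute[of z w])
    show "(z * cnj w) *\<^sub>C (\<alpha> * adj \<gamma>) = q *\<^sub>R (cnj w * z) *\<^sub>C (adj \<gamma> * \<alpha>)"
      by (simp only: alpha_adj_gamma scaleC_scaleR_commute mult.commute[of z "cnj w"])
  qed (use rel in \<open>unfold SUq2_rel_def, blast\<close>)+
  then obtain f where "star_hom f" "f \<alpha> = z *\<^sub>C \<alpha>" "f \<gamma> = w *\<^sub>C \<gamma>"
    by (rule hom_lift)
  then have "star_hom (rot z w) \<and> rot z w \<alpha> = z *\<^sub>C \<alpha> \<and> rot z w \<gamma> = w *\<^sub>C \<gamma>"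
    unfolding rot_def by (intro someI[of "\<lambda>f. star_hom f \<and> f \<alpha> = z *\<^sub>C \<alpha> \<and> f \<gamma> = w *\<^sub>C \<gamma>"] conjI)
  then show "star_hom (rot z w)" "rot z w \<alpha> = z *\<^sub>C \<alpha>" "rot z w \<gamma> = w *\<^sub>C \<gamma>" by blast+
qed

lemma rot_rot:
  assumes z: "cmod z = 1" "cmod w = 1" and z': "cmod z' = 1" "cmod w' = 1"
  shows "rot z w (rot z' w' x) = rot (z * z') (w * w') x"
proof -
  have zz: "cmod (z * z') = 1" "cmod (w * w') = 1" using z z' by (simp_all add: norm_mult)
  show ?thesis
    by (rule hom_eqI[OF star_hom_comp[OF rot(1)[OF z] rot(1)[OF z']] rot(1)[OF zz]])
      (simp_all only: rot[OF z] rot[OF z'] rot[OF zz] star_hom_scaleC[OF rot(1)[OF z]] scaleC_scaleC mult.commute[of z' z] mult.commute[of w' w] rot[OF zz])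
qed

lemma rot_one: "rot 1 1 x = x"
  by (rule hom_eqI[OF rot(1) star_hom_id]) (simp_all add: rot scaleC_one)

lemma rot_cnj:
  assumes z: "cmod z = 1" "cmod w = 1"
  shows "rot z w (rot (cnj z) (cnj w) x) = x" "rot (cnj z) (cnj w) (rot z w x) = x"
proof -
  note zw = unit_cnj[OF z(1)] unit_cnj[OF z(2)]
  have c: "cmod (cnj z) = 1" "cmod (cnj w) = 1" using z by simp_all
  show "rot z w (rot (cnj z) (cnj w) x) = x" "rot (cnj z) (cnj w) (rot z w x) = x"
    by (simp_all only: rot_rot[OF z c] rot_rot[OF c z] zw rot_one)
qed

lemma bij_rot:
  assumes z: "cmod z = 1" "cmod w = 1"
  shows "bij (rot z w)"
  by (rule bij_betw_byWitness[where f' = "rot (cnj z) (cnj w)"]) (auto simp: rot_cnj[OF z])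

lemma rot_h:
  assumes "cmod z = 1" "cmod w = 1"
  shows "rot z w h = h"
proof -
  have "rot z w h = adj (w *\<^sub>C \<gamma>) * (w *\<^sub>C \<gamma>)"
    by (simp only: h_def star_hom_mult[OF rot(1)[OF assms]] star_hom_adj[OF rot(1)[OF assms]] rot[OF assms])
  also have "\<dots> = h"
    by (simp only: adj_scaleC mult_scaleC_left mult_scaleC_right scaleC_scaleC unit_cnj[OF assms(2)] scaleC_one h_def)
  finally show ?thesis .
qed

text \<open>A normal form of Poincare-Birkhoff-Witt type, with the flag telling the sign of the
  degree in \<alpha>. Only spanning is required of it; for \<open>k = 0\<close> both flags give the
  same monomial.\<close>

definition mon :: "bool \<Rightarrow> nat \<Rightarrow> nat \<Rightarrow> nat \<Rightarrow> 'a" where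
  "mon s k a b = (if s then adj \<alpha> ^ k else \<alpha> ^ k) * (\<gamma> ^ a * adj \<gamma> ^ b)"

text \<open>The complex coefficient is built in because \<open>span\<close> is real linear.\<close>

definition mons :: "'a set" where
  "mons = {c *\<^sub>C mon s k a b | c s k a b. True}"

lemma gamma_power_normal: "\<gamma> ^ a * adj \<gamma> ^ a = h ^ a"
proof (induction a)
  case (Suc a)
  have "\<gamma> ^ Suc a * adj \<gamma> ^ Suc a = \<gamma> * (\<gamma> ^ a * adj \<gamma> ^ a) * adj \<gamma>"
    by (simp add: mult.assoc power_commutes)
  also have "\<dots> = h ^ a * (\<gamma> * adj \<gamma>)"
    by (simp only: Suc power_commuting_commutes[OF gamma_h[symmetric], of a, symmetric] mult.assoc)
  finally show ?case by (simp add: gamma_normal power_commutes)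
qed simp

lemma gamma_alpha: "\<gamma> * \<alpha> = (1 / q) *\<^sub>R (\<alpha> * \<gamma>)" and adj_gamma_alpha: "adj \<gamma> * \<alpha> = (1 / q) *\<^sub>R (\<alpha> * adj \<gamma>)"
  using q_nonzero by (simp_all add: alpha_gamma alpha_adj_gamma)

lemma gamma_mono: "\<exists>r. \<gamma> * mon s k a b = r *\<^sub>R mon s k (Suc a) b"
  and adj_gamma_mono: "\<exists>r. adj \<gamma> * mon s k a b = r *\<^sub>R mon s k a (Suc b)"
proof -
  let ?A = "if s then adj \<alpha> ^ k else \<alpha> ^ k" and ?r = "if s then q ^ k else (1 / q) ^ k"
  have A: "\<gamma> * ?A = ?r *\<^sub>R (?A * \<gamma>)" "adj \<gamma> * ?A = ?r *\<^sub>R (?A * adj \<gamma>)"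
    by (simp_all only: commute_scaled_power[OF gamma_alpha] commute_scaled_power[OF adj_gamma_alpha]
        commute_scaled_power[OF gamma_adj_alpha] commute_scaled_power[OF adj_gamma_adj_alpha] split: if_split) auto
  have c: "adj \<gamma> * \<gamma> ^ a = \<gamma> ^ a * adj \<gamma>"
    using power_commuting_commutes[of \<gamma> "adj \<gamma>" a] gamma_normal by (simp add: h_def)
  have "\<gamma> * mon s k a b = (\<gamma> * ?A) * (\<gamma> ^ a * adj \<gamma> ^ b)" by (simp only: mon_def mult.assoc)
  also have "\<dots> = ?r *\<^sub>R mon s k (Suc a) b" by (simp only: A mon_def mult_scaleR_left mult.assoc power_Suc)
  finally show "\<exists>r. \<gamma> * mon s k a b = r *\<^sub>R mon s k (Suc a) b" by blast
  have "adj \<gamma> * mon s k a b = (adj \<gamma> * ?A) * (\<gamma> ^ a * adj \<gamma> ^ b)" by (simp only: mon_def mult.assoc)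
  also have "\<dots> = ?r *\<^sub>R (?A * ((adj \<gamma> * \<gamma> ^ a) * adj \<gamma> ^ b))" by (simp only: A mult_scaleR_left mult.assoc)
  also have "\<dots> = ?r *\<^sub>R mon s k a (Suc b)" by (simp only: c mon_def mult.assoc power_Suc)
  finally show "\<exists>r. adj \<gamma> * mon s k a b = r *\<^sub>R mon s k a (Suc b)" by blast
qed

lemma h_mono: "\<exists>r. h * mon s k a b = r *\<^sub>R mon s k (Suc a) (Suc b)"
proof -
  obtain r r' where "\<gamma> * mon s k a b = r *\<^sub>R mon s k (Suc a) b"
    "adj \<gamma> * mon s k (Suc a) b = r' *\<^sub>R mon s k (Suc a) (Suc b)"
    using gamma_mono adj_gamma_mono by metis
  then have "h * mon s k a b = (r * r') *\<^sub>R mon s k (Suc a) (Suc b)"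
    by (simp add: h_def mult.assoc)
  then show ?thesis by blast
qed

lemma mons_scaleC: "m \<in> mons \<Longrightarrow> c *\<^sub>C m \<in> mons"
  unfolding mons_def by (force simp: scaleC_scaleC)

lemma mon_in_mons: "mon s k a b \<in> mons"
  unfolding mons_def by (force simp: scaleC_one intro: exI[of _ 1])

lemma span_mons_scaleC: "x \<in> span mons \<Longrightarrow> c *\<^sub>C x \<in> span mons"
  by (rule span_linear_closed[OF bounded_linear.linear[OF bounded_linear_scaleC]])
    (auto intro: span_base mons_scaleC)

lemma span_mons_mult:
  assumes "\<And>s k a b. g * mon s k a b \<in> span mons" "x \<in> span mons"
  shows "g * x \<in> span mons"
proof (rule span_linear_closed[OF bounded_linear.linear[OF bounded_linear_mult_right] _ assms(2)])
  fix m assume "m \<in> mons"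
  then obtain c s k a b where "m = c *\<^sub>C mon s k a b" unfolding mons_def by blast
  then show "g * m \<in> span mons"
    using assms(1) by (simp add: mult_scaleC_right span_mons_scaleC)
qed

text \<open>The only products leaving the normal form are those where \<alpha> meets its adjoint.
  The relations replace such a pair by 1 minus a multiple of \<open>h\<close>, and by
  \<open>h_mono\<close> left multiplication by \<open>h\<close> merely raises the two exponents of
  the \<gamma> part, up to a scalar.\<close>

lemma closure_span_mons: "x \<in> closure (span mons)"
proof (rule closure_invariant_subspace)
  have mon: "r *\<^sub>R mon s k a b \<in> span mons" for r s k a b
    by (intro span_scale span_base mon_in_mons)
  have mon1: "mon s k a b \<in> span mons" for s k a b
    by (intro span_base mon_in_mons)
  show "1 \<in> span mons" using mon1[of False 0 0 0] by (simp add: mon_def)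
  show "\<gamma> * x \<in> span mons" "adj \<gamma> * x \<in> span mons" if "x \<in> span mons" for x
    using span_mons_mult[OF _ that] gamma_mono adj_gamma_mono mon by metis+
  show "\<alpha> * x \<in> span mons" if "x \<in> span mons" for x
  proof (rule span_mons_mult[OF _ that])
    fix s k a b
    show "\<alpha> * mon s k a b \<in> span mons"
    proof (cases s)
      case False
      then have "\<alpha> * mon s k a b = mon False (Suc k) a b" by (simp add: mon_def mult.assoc)
      then show ?thesis by (simp add: mon1)
    next
      case True
      show ?thesis
      proof (cases k)
        case 0
        then have "\<alpha> * mon s k a b = mon False 1 a b" by (simp add: mon_def)
        then show ?thesis by (simp add: mon1)
      next
        case (Suc l)
        have "\<alpha> * mon s k a b = (\<alpha> * adj \<alpha>) * mon True l a b"
          by (simp add: True Suc mon_def mult.assoc)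
        also have "\<dots> = mon True l a b - t *\<^sub>R (h * mon True l a b)"
          by (simp add: alpha_adj_alpha left_diff_distrib)
        also have "\<dots> \<in> span mons"
          using h_mono[of True l a b] by (auto intro!: span_diff span_scale mon1)
        finally show ?thesis .
      qed
    qed
  qed
  show "adj \<alpha> * x \<in> span mons" if "x \<in> span mons" for x
  proof (rule span_mons_mult[OF _ that])
    fix s k a b
    show "adj \<alpha> * mon s k a b \<in> span mons"
    proof (cases s)
      case True
      then have "adj \<alpha> * mon s k a b = mon True (Suc k) a b" by (simp add: mon_def mult.assoc)
      then show ?thesis by (simp add: mon1)
    next
      case False
      show ?thesis
      proof (cases k)
        case 0
        then have "adj \<alpha> * mon s k a b = mon True 1 a b" by (simp add: mon_def)
        then show ?thesis by (simp add: mon1)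
      next
        case (Suc l)
        have "adj \<alpha> * mon s k a b = (adj \<alpha> * \<alpha>) * mon False l a b"
          by (simp add: False Suc mon_def mult.assoc)
        also have "\<dots> = mon False l a b - h * mon False l a b"
          by (simp add: adj_alpha_alpha left_diff_distrib)
        also have "\<dots> \<in> span mons"
          using h_mono[of False l a b] by (auto intro!: span_diff span_scale mon1)
        finally show ?thesis .
      qed
    qed
  qed
qed (auto intro: span_mons_scaleC)

section \<open>A rotation of infinite order and the resulting bigrading\<close>

definition z0 :: complex where
  "z0 = (SOME z. cmod z = 1 \<and> (\<forall>n. z powi n = 1 \<longrightarrow> n = 0))"

lemma z0: "cmod z0 = 1" "z0 powi n = 1 \<Longrightarrow> n = 0"
proof -
  have "cmod z0 = 1 \<and> (\<forall>n. z0 powi n = 1 \<longrightarrow> n = 0)"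
    unfolding z0_def by (rule someI_ex) (metis not_root_of_unity)
  then show "cmod z0 = 1" "z0 powi n = 1 \<Longrightarrow> n = 0" by blast+
qed

lemma z0_nonzero: "z0 \<noteq> 0"
  using z0(1) by auto

lemma z0_powi_eq_iff: "z0 powi m = z0 powi n \<longleftrightarrow> m = n"
  using z0(2)[of "m - n"] z0_nonzero by (auto simp: power_int_diff)

lemma norm_z0_powi: "cmod (z0 powi n) = 1"
  by (simp add: norm_power_int z0)

lemma cnj_z0: "cnj z0 = z0 powi (- 1)"
proof -
  have "z0 * cnj z0 = 1" by (rule unit_cnj[OF z0(1)])
  then show ?thesis using z0_nonzero by (simp add: power_int_minus field_simps)
qed

abbreviation L :: "'a \<Rightarrow> 'a" where "L \<equiv> rot z0 (cnj z0)"
abbreviation R :: "'a \<Rightarrow> 'a" where "R \<equiv> rot z0 z0"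

lemma z0_norms: "cmod z0 = 1" "cmod (cnj z0) = 1"
  by (simp_all add: z0)

lemmas LR_hom = rot(1)[OF z0_norms(1,2)] rot(1)[OF z0_norms(1,1)]

definition sgn_exp :: "bool \<Rightarrow> nat \<Rightarrow> int" where "sgn_exp s k = (if s then - int k else int k)"

lemma rot_mono:
  assumes "cmod z = 1" "cmod w = 1"
  shows "rot z w (mon s k a b) = ((if s then cnj z ^ k else z ^ k) * (w ^ a * cnj w ^ b)) *\<^sub>C mon s k a b"
proof -
  note simps = star_hom_simps[OF rot(1)[OF assms]] rot[OF assms]
  show ?thesis
    by (cases s) (simp_all add: mon_def simps adj_scaleC scaleC_power mult_scaleC_left mult_scaleC_right
        scaleC_scaleC mult_ac)
qed

lemma z0_power_prod: "(if s then cnj z0 ^ k else z0 ^ k) = z0 powi sgn_exp s k"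
  using z0_nonzero by (auto simp: cnj_z0 sgn_exp_def power_int_minus power_inverse)

lemma cnj_z0_power: "cnj z0 ^ a = z0 powi (- int a)"
  by (simp add: cnj_z0 power_int_minus power_inverse)

lemma L_mono: "L (mon s k a b) = (z0 powi (sgn_exp s k - int a + int b)) *\<^sub>C mon s k a b"
  unfolding rot_mono[OF z0_norms(1,2)] z0_power_prod
  using z0_nonzero by (simp add: cnj_z0_power power_int_add power_int_diff power_int_minus divide_inverse mult_ac)

lemma R_mono: "R (mon s k a b) = (z0 powi (sgn_exp s k + int a - int b)) *\<^sub>C mon s k a b"
  unfolding rot_mono[OF z0_norms(1,1)] z0_power_prod
  using z0_nonzero by (simp add: cnj_z0_power power_int_add power_int_diff power_int_minus divide_inverse mult_ac)

text \<open>All monomials have eigenvalues that are powers of \<open>z0\<close>. If \<omega> were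
  none of these, the ergodic projection would leave only 0. This is the source of the integer weight
  in \<open>Aut_weight\<close>.\<close>

lemma L_eigenvalue:
  assumes "L x = \<omega> *\<^sub>C x" "cmod \<omega> = 1" "x \<noteq> 0"
  obtains n where "\<omega> = z0 powi n"
proof -
  have "\<exists>c. cmod c = 1 \<and> L m = c *\<^sub>C m" if "m \<in> mons" for m
      proof -
    obtain c s k a b where m: "m = c *\<^sub>C mon s k a b" using \<open>m \<in> mons\<close> unfolding mons_def by blast
    have "L m = (z0 powi (sgn_exp s k - int a + int b)) *\<^sub>C m"
      by (simp add: m star_hom_scaleC[OF LR_hom(1)] L_mono scaleC_scaleC mult.commute)
    then show ?thesis using norm_z0_powi by blast
  qed
  then have x: "x \<in> closure (span {m \<in> mons. L m = \<omega> *\<^sub>C m})"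
    by (intro ergodic_projection[OF LR_hom(1) assms(2) _ closure_span_mons assms(1)])
  have "\<exists>m\<in>mons. L m = \<omega> *\<^sub>C m \<and> m \<noteq> 0"
  proof (rule ccontr)
    assume "\<not> ?thesis"
    then have "span {m \<in> mons. L m = \<omega> *\<^sub>C m} \<subseteq> {0}"
      by (intro span_minimal subspace_single_0) auto
    then have "closure (span {m \<in> mons. L m = \<omega> *\<^sub>C m}) \<subseteq> {0}"
      by (intro closure_minimal) auto
    then show False using x assms(3) by blast
  qed
  then obtain c s k a b where m: "L (c *\<^sub>C mon s k a b) = \<omega> *\<^sub>C (c *\<^sub>C mon s k a b)" "c *\<^sub>C mon s k a b \<noteq> 0"
    unfolding mons_def by blast
  then have "z0 powi (sgn_exp s k - int a + int b) *\<^sub>C (c *\<^sub>C mon s k a b) = \<omega> *\<^sub>C (c *\<^sub>C mon s k a b)"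
    by (simp add: star_hom_scaleC[OF LR_hom(1)] L_mono scaleC_scaleC mult.commute)
  then have "\<omega> = z0 powi (sgn_exp s k - int a + int b)"
    using m(2) by (metis scaleC_cancel)
  then show ?thesis by (rule that)
qed

text \<open>As \<open>z0\<close> has infinite order, a nonzero element has at most one pair of
  weights. A monomial of signed \<alpha>-degree d with \<gamma> exponents a, b has weights d - a + b
  and d + a - b.\<close>

definition weight :: "int \<Rightarrow> int \<Rightarrow> 'a \<Rightarrow> bool" where
  "weight i j x \<longleftrightarrow> L x = (z0 powi i) *\<^sub>C x \<and> R x = (z0 powi j) *\<^sub>C x"

text \<open>The ergodic projection is applied twice: first for \<open>L\<close>, then for
  \<open>R\<close> among the monomials that already have the right left weight.\<close>

lemma weight_closure:
  assumes "weight i j x"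
  shows "x \<in> closure (span {c *\<^sub>C mon s k a b | c s k a b. sgn_exp s k - int a + int b = i \<and> sgn_exp s k + int a - int b = j})"
    (is "_ \<in> closure (span ?H)")
proof -
  have Lm: "L (c *\<^sub>C mon s k a b) = (z0 powi (sgn_exp s k - int a + int b)) *\<^sub>C (c *\<^sub>C mon s k a b)"
    and Rm: "R (c *\<^sub>C mon s k a b) = (z0 powi (sgn_exp s k + int a - int b)) *\<^sub>C (c *\<^sub>C mon s k a b)" for c s k a b
    by (simp_all add: star_hom_scaleC[OF LR_hom(1)] star_hom_scaleC[OF LR_hom(2)] L_mono R_mono scaleC_scaleC mult.commute)
  have L: "\<exists>c. cmod c = 1 \<and> L m = c *\<^sub>C m" and R: "\<exists>c. cmod c = 1 \<and> R m = c *\<^sub>C m" if "m \<in> mons" for m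
    using that norm_z0_powi Lm Rm unfolding mons_def by blast+
  define M1 where "M1 = {m \<in> mons. L m = (z0 powi i) *\<^sub>C m}"
  have "x \<in> closure (span M1)"
    unfolding M1_def using assms unfolding weight_def
    by (intro ergodic_projection[OF LR_hom(1) norm_z0_powi L closure_span_mons]) auto
  then have x: "x \<in> closure (span {m \<in> M1. R m = (z0 powi j) *\<^sub>C m})"
    using assms R unfolding weight_def M1_def
    by (intro ergodic_projection[OF LR_hom(2) norm_z0_powi]) auto
  have "{m \<in> M1. R m = (z0 powi j) *\<^sub>C m} \<subseteq> span ?H"
  proof
    fix m assume m: "m \<in> {m \<in> M1. R m = (z0 powi j) *\<^sub>C m}"
    then obtain c s k a b where c: "m = c *\<^sub>C mon s k a b" unfolding M1_def mons_def by blast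
    show "m \<in> span ?H"
    proof (cases "m = 0")
      case False
      have "z0 powi (sgn_exp s k - int a + int b) = z0 powi i" "z0 powi (sgn_exp s k + int a - int b) = z0 powi j"
        using m Lm[of c s k a b] Rm[of c s k a b] False unfolding M1_def c[symmetric] by (auto dest: scaleC_cancel)
      then have "sgn_exp s k - int a + int b = i" "sgn_exp s k + int a - int b = j"
        by (simp_all only: z0_powi_eq_iff)
      then show ?thesis unfolding c by (intro span_base) blast
    qed (simp add: span_zero)
  qed
  then have "closure (span {m \<in> M1. R m = (z0 powi j) *\<^sub>C m}) \<subseteq> closure (span ?H)"
    by (intro closure_mono span_minimal subspace_span)
  then show ?thesis using x by blast
qed

section \<open>Homogeneous elements multiplied by \<open>p\<close>\<close>

lemma gamma_powers_p: "\<gamma> ^ a * adj \<gamma> ^ a * p = p"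
  by (simp add: gamma_power_normal h_power_p)

lemma alpha_mono_p: "mon False (Suc k) a b * p = 0"
proof -
  have "(\<gamma> ^ a * adj \<gamma> ^ b) * p = p * (\<gamma> ^ a * adj \<gamma> ^ b)"
    using power_commuting_commutes[OF gamma_p, of a] power_commuting_commutes[OF adj_gamma_p, of b]
    by (metis mult.assoc)
  then have "mon False (Suc k) a b * p = \<alpha> ^ k * ((\<alpha> * p) * (\<gamma> ^ a * adj \<gamma> ^ b))"
    by (simp add: mon_def mult.assoc power_Suc2 del: power_Suc)
  then show ?thesis by (simp add: alpha_p)
qed

text \<open>Checking monomials suffices, and on \<open>p\<close> few survive: positive powers of
  \<alpha> vanish, and equal powers of \<gamma> and its adjoint disappear. So each of the weights
  considered below leaves at most a complex line.\<close>

lemma weight_mult_p: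
  assumes "weight i j x" "subspace W" "closed W"
    and "\<And>c s k a b. sgn_exp s k - int a + int b = i \<Longrightarrow> sgn_exp s k + int a - int b = j \<Longrightarrow>
      c *\<^sub>C (mon s k a b * p) \<in> W"
  shows "x * p \<in> W"
  by (rule closure_span_image[OF bounded_linear_mult_left assms(2,3) _ weight_closure[OF assms(1)]])
    (auto simp: mult_scaleC_left assms(4))

lemma weight_pos_p:
  assumes "weight i i x" "i > 0"
  shows "x * p = 0"
proof -
  have "x * p \<in> {0}"
  proof (rule weight_mult_p[OF assms(1)])
    fix c s k a b assume "sgn_exp s k - int a + int b = i" "sgn_exp s k + int a - int b = i"
    then have "sgn_exp s k = i" by simp
    then have "s = False" "k = Suc (k - 1)" using assms(2) by (auto simp: sgn_exp_def split: if_splits)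
    then have "mon s k a b * p = 0" using alpha_mono_p by metis
    then show "c *\<^sub>C (mon s k a b * p) \<in> {0}" by simp
  qed auto
  then show ?thesis by simp
qed

lemma weight_neg_p:
  assumes "weight (- int n) (- int n) x"
  obtains c where "x * p = c *\<^sub>C e n"
proof -
  have "x * p \<in> cline (e n)"
  proof (rule weight_mult_p[OF assms subspace_cline closed_cline])
    fix c s k a b assume *: "sgn_exp s k - int a + int b = - int n" "sgn_exp s k + int a - int b = - int n"
    then have ab: "a = b" and k: "sgn_exp s k = - int n" by auto
    have "mon s k a b * p = e n"
    proof (cases s)
      case True
      then have "k = n" using k by (simp add: sgn_exp_def)
      then show ?thesis using True ab gamma_powers_p[of b] by (simp add: mon_def e_def mult.assoc)
    next
      case False
      \<comment> \<open>Degree 0 is the overlap of the two flags in \<open>mon\<close>.\<close>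
      then have "k = 0" "n = 0" using k by (simp_all add: sgn_exp_def)
      then show ?thesis using False ab gamma_powers_p[of b] by (simp add: mon_def e_def mult.assoc)
    qed
    then show "c *\<^sub>C (mon s k a b * p) \<in> cline (e n)" by (simp add: cline_def)
  qed
  then show ?thesis using that by (auto simp: cline_def)
qed

lemma weight_gamma_p:
  assumes "weight (- 1) 1 x"
  obtains c where "x * p = c *\<^sub>C (\<gamma> * p)"
proof -
  have "x * p \<in> cline (\<gamma> * p)"
  proof (rule weight_mult_p[OF assms subspace_cline closed_cline])
    fix c s k a b assume *: "sgn_exp s k - int a + int b = - 1" "sgn_exp s k + int a - int b = 1"
    then have ab: "a = Suc b" and k: "sgn_exp s k = 0" by auto
    have "k = 0" using k by (auto simp: sgn_exp_def split: if_splits)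
    then have "mon s k a b * p = \<gamma> * p"
      using ab gamma_powers_p[of b] by (simp add: mon_def mult.assoc)
    then show "c *\<^sub>C (mon s k a b * p) \<in> cline (\<gamma> * p)" by (simp add: cline_def)
  qed
  then show ?thesis using that by (auto simp: cline_def)
qed

lemma weight_zero_closure:
  assumes "weight 0 0 x"
  shows "x \<in> closure (span {c *\<^sub>C h ^ a | c a. True})"
proof -
  have "{c *\<^sub>C mon s k a b | c s k a b. sgn_exp s k - int a + int b = 0 \<and> sgn_exp s k + int a - int b = 0}
    \<subseteq> {c *\<^sub>C h ^ a | c a. True}"
  proof clarify
    fix c s k a b assume *: "sgn_exp s k - int a + int b = 0" "sgn_exp s k + int a - int b = 0"
    then have ab: "a = b" and k: "sgn_exp s k = 0" by auto
    have "k = 0" using k by (auto simp: sgn_exp_def split: if_splits)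
    then have "mon s k a b = h ^ a" using ab by (simp add: mon_def gamma_power_normal)
    then show "\<exists>c' a'. c *\<^sub>C mon s k a b = c' *\<^sub>C h ^ a' \<and> True" by auto
  qed
  then show ?thesis
    using weight_closure[OF assms] closure_mono[OF span_mono] by blast
qed

lemma weight_adj: "weight i j x \<Longrightarrow> weight (- i) (- j) (adj x)"
proof -
  have "cnj (z0 powi n) = z0 powi (- n)" for n
  proof -
    have "cnj (z0 powi n) * z0 powi n = z0 powi (- n) * z0 powi n"
      using z0_nonzero unit_cnj[OF norm_z0_powi[of n]] by (simp add: power_int_minus)
    then show ?thesis using z0_nonzero by simp
  qed
  then show "weight i j x \<Longrightarrow> weight (- i) (- j) (adj x)"
    unfolding weight_def by (simp add: star_hom_adj[OF LR_hom(1)] star_hom_adj[OF LR_hom(2)] adj_scaleC)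
qed

lemma weight_mult: "weight i j x \<Longrightarrow> weight i' j' y \<Longrightarrow> weight (i + i') (j + j') (x * y)"
  unfolding weight_def using z0_nonzero
  by (simp add: star_hom_mult[OF LR_hom(1)] star_hom_mult[OF LR_hom(2)] mult_scaleC_left mult_scaleC_right
      scaleC_scaleC power_int_add mult.commute)

lemma weight_diff: "weight i j x \<Longrightarrow> weight i j y \<Longrightarrow> weight i j (x - y)"
  unfolding weight_def
  by (simp add: star_hom_diff[OF LR_hom(1)] star_hom_diff[OF LR_hom(2)] scaleC_diff_right)

lemma weight_scaleC: "weight i j x \<Longrightarrow> weight i j (c *\<^sub>C x)"
  unfolding weight_def
  by (simp add: star_hom_scaleC[OF LR_hom(1)] star_hom_scaleC[OF LR_hom(2)] scaleC_scaleC mult.commute)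

lemma weight_alpha: "weight 1 1 \<alpha>" and weight_gamma: "weight (- 1) 1 \<gamma>" and weight_h: "weight 0 0 h"
  unfolding weight_def rot[OF z0_norms(1,2)] rot[OF z0_norms(1,1)] rot_h[OF z0_norms(1,2)] rot_h[OF z0_norms(1,1)]
  by (simp_all add: cnj_z0 scaleC_one)

lemma weight_power: "weight i j x \<Longrightarrow> weight (int n * i) (int n * j) (x ^ n)"
proof (induction n)
  case 0
  show ?case by (simp add: weight_def star_hom_one[OF LR_hom(1)] star_hom_one[OF LR_hom(2)] scaleC_one)
next
  case (Suc n)
  then show ?case using weight_mult[of i j x "int n * i" "int n * j" "x ^ n"] by (simp add: algebra_simps)
qed

text \<open>The candidates for a failure of faithfulness in weight zero, to be shown trivial. The
  class is stable under multiplication by \<open>h\<close> and under conjugation by \<alpha>, which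
  is what permits the recursion in \<open>null_e_decay\<close>.\<close>

definition null_e :: "'a \<Rightarrow> bool" where
  "null_e x \<longleftrightarrow> adj x = x \<and> x * h = h * x \<and> (\<forall>k. x * e k = 0)"

lemma null_e_h:
  assumes "null_e x"
  shows "null_e (x * h)"
  unfolding null_e_def
proof (intro conjI allI)
  show "adj (x * h) = x * h" using assms by (simp add: null_e_def adj_mult h_selfadj)
  have "x * h = h * x" using assms by (simp add: null_e_def)
  from arg_cong[OF this, of "\<lambda>y. y * h"] show "x * h * h = h * (x * h)" by (simp only: mult.assoc)
  show "x * h * e k = 0" for k using assms by (simp add: null_e_def mult.assoc h_e)
qed

lemma null_e_diff: "null_e x \<Longrightarrow> null_e y \<Longrightarrow> null_e (x - y)"
  by (simp add: null_e_def adj_diff left_diff_distrib right_diff_distrib)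

lemma null_e_h_power: "null_e x \<Longrightarrow> null_e (x * h ^ m)"
proof (induction m)
  case (Suc m)
  have "x * h ^ Suc m = (x * h ^ m) * h" by (simp add: mult.assoc power_commutes)
  then show ?case using null_e_h[OF Suc.IH[OF Suc.prems]] by simp
qed simp

lemma null_e_conj:
  assumes "null_e x"
  shows "null_e (\<alpha> * x * adj \<alpha>)"
  unfolding null_e_def
proof (intro conjI allI)
  have x: "adj x = x" "x * h = h * x" "x * e k = 0" for k using assms by (auto simp: null_e_def)
  show "adj (\<alpha> * x * adj \<alpha>) = \<alpha> * x * adj \<alpha>" by (simp add: adj_mult adj_adj x mult.assoc)
  show "\<alpha> * x * adj \<alpha> * e k = 0" for k by (simp add: mult.assoc x flip: e_Suc)
  have a: "t *\<^sub>R (adj \<alpha> * h) = h * adj \<alpha>" by (rule h_adj_alpha[symmetric])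
  have "t *\<^sub>R (\<alpha> * x * adj \<alpha> * h) = \<alpha> * x * (t *\<^sub>R (adj \<alpha> * h))"
    by (simp only: mult_scaleR_right mult.assoc)
  also have "\<dots> = \<alpha> * (x * h) * adj \<alpha>" by (simp only: a mult.assoc)
  also have "\<dots> = (\<alpha> * h) * x * adj \<alpha>" by (simp only: x mult.assoc)
  also have "\<dots> = t *\<^sub>R (h * (\<alpha> * x * adj \<alpha>))" by (simp only: alpha_h mult_scaleR_left mult.assoc)
  finally show "\<alpha> * x * adj \<alpha> * h = h * (\<alpha> * x * adj \<alpha>)"
    using t by simp
qed

definition C1 :: real where "C1 = (norm \<alpha>)\<^sup>2 / (1 - t)"

text \<open>As \<open>e 0 = p\<close>, the products \<open>x * h ^ m\<close> tend to
  \<open>x * p = 0\<close>, so \<open>x\<close> is the telescoping sum of the differences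
  \<open>x * h ^ j - x * h ^ Suc j\<close>. Each equals \<open>x * (1 - h) * (h ^ j - p)\<close>,
  and the last factor decays geometrically.\<close>

lemma null_e_lower_bound:
  assumes "null_e x"
  shows "norm x \<le> C1 / (1 - t) * norm (x * (1 - h))"
proof -
  have C1: "C1 \<ge> 0" using t by (simp add: C1_def)
  have xp: "x * p = 0" using assms by (auto simp: null_e_def simp flip: e_0)
  have step: "x * h ^ j - x * h ^ Suc j = x * (1 - h) * (h ^ j - p)" for j
    by (simp add: right_diff_distrib left_diff_distrib mult.assoc h_p xp)
  have le: "norm (x * h ^ j - x * h ^ Suc j) \<le> norm (x * (1 - h)) * (C1 * t ^ j)" for j
    unfolding step using p(2)[of j]
    by (intro order_trans[OF norm_mult_ineq] mult_left_mono) (simp_all add: C1_def)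
  have "norm (x - x * h ^ m) \<le> C1 / (1 - t) * norm (x * (1 - h))" for m
  proof -
    have "x - x * h ^ m = (\<Sum>j<m. x * h ^ j - x * h ^ Suc j)"
      using sum_lessThan_telescope'[of "\<lambda>j. x * h ^ j" m] by (simp only: power_0 mult_1_right)
    also have "norm \<dots> \<le> (\<Sum>j<m. norm (x * (1 - h)) * (C1 * t ^ j))"
      by (intro sum_norm_le le)
    also have "\<dots> = norm (x * (1 - h)) * C1 * (\<Sum>j<m. t ^ j)"
      by (simp add: sum_distrib_left mult.assoc)
    also have "\<dots> \<le> norm (x * (1 - h)) * C1 * (1 / (1 - t))"
    proof -
      have "(\<Sum>j<m. t ^ j) = (1 - t ^ m) / (1 - t)" using t by (simp add: sum_gp_strict)
      also have "\<dots> \<le> 1 / (1 - t)" using t by (intro divide_right_mono) auto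
      finally show ?thesis using C1 by (intro mult_left_mono) auto
    qed
    finally show ?thesis by (simp add: mult_ac)
  qed
  then have ev: "\<forall>\<^sub>F m in sequentially. norm (x - x * h ^ m) \<le> C1 / (1 - t) * norm (x * (1 - h))"
    by (intro always_eventually allI)
  have "(\<lambda>m. x - x * h ^ m) \<longlonglongrightarrow> x - x * p"
    by (intro tendsto_intros p(1))
  from Lim_norm_ubound[OF trivial_limit_sequentially this ev]
  have "norm (x - x * p) \<le> C1 / (1 - t) * norm (x * (1 - h))" .
  then show ?thesis by (simp add: xp)
qed

text \<open>One factor \<open>C1 / (1 - t)\<close> for each of two uses of
  \<open>null_e_lower_bound\<close>, and one squared norm of \<alpha> for each of two conjugations:
  the one forming the new element and the one around it.\<close>

definition E1 :: real where "E1 = (C1 / (1 - t))\<^sup>2 * ((norm \<alpha>)\<^sup>2)\<^sup>2"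

text \<open>Conjugation by \<open>\<alpha>\<close> preserves \<^const>\<open>null_e\<close> and turns \<open>x h\<^sup>m\<close> into \<open>q\<^bsup>2m\<^esup> (\<alpha> x \<alpha>\<^sup>*) h\<^sup>m\<close>; since \<open>1 - h\<close>
  is bounded below on such elements, the factor \<open>q\<^bsup>2m\<^esup>\<close> can be gained any number of times.\<close>

lemma null_e_decay:
  assumes "null_e x"
  shows "norm (x * h ^ m) \<le> (E1 * t ^ m) ^ n * norm x"
  using assms
proof (induction n arbitrary: x)
  case 0
  have "norm (x * h ^ m) \<le> norm x * norm (h ^ m)" by (rule norm_mult_ineq)
  then show ?case by (simp add: selfadj_norm_power[OF h_selfadj] norm_h)
next
  case (Suc n)
  let ?B = "C1 / (1 - t)" and ?y = "x * h ^ m" and ?z = "\<alpha> * x * adj \<alpha>"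
  have B: "?B \<ge> 0" using t by (simp add: C1_def)
  have y: "null_e ?y" by (rule null_e_h_power[OF Suc.prems])
  have y1: "null_e (?y * (1 - h))"
    using null_e_diff[OF y null_e_h[OF y]] by (simp add: right_diff_distrib)
  have comm: "(1 - h) * ?y = ?y * (1 - h)"
    using y by (simp add: null_e_def right_diff_distrib left_diff_distrib)
  \<comment> \<open>One factor is moved to the left; replacing both by
    \<open>adj \<alpha> * \<alpha>\<close> then leaves \<alpha> and its adjoint around
    \<open>x * h ^ m\<close>, and commuting \<open>h ^ m\<close> past \<open>adj \<alpha>\<close>
    releases \<open>t ^ m\<close>.\<close>
  have "?y * (1 - h) * (1 - h) = (1 - h) * ?y * (1 - h)" by (simp only: comm)
  also have "\<dots> = adj \<alpha> * (\<alpha> * x * (h ^ m * adj \<alpha>)) * \<alpha>"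
    by (simp only: adj_alpha_alpha[symmetric] mult.assoc)
  also have "\<dots> = t ^ m *\<^sub>R (adj \<alpha> * (?z * h ^ m) * \<alpha>)"
    by (simp only: h_power_adj_alpha mult_scaleR_right mult_scaleR_left mult.assoc)
  finally have eq: "?y * (1 - h) * (1 - h) = t ^ m *\<^sub>R (adj \<alpha> * (?z * h ^ m) * \<alpha>)" .
  have norm_conj: "norm (a * b * c) \<le> norm a * norm b * norm c" for a b c :: 'a
    by (rule order_trans[OF norm_mult_ineq mult_right_mono[OF norm_mult_ineq norm_ge_zero]])
  have Et: "0 \<le> (E1 * t ^ m) ^ n" using t by (simp add: E1_def)
  have "norm ?z \<le> norm \<alpha> * norm x * norm (adj \<alpha>)" by (rule norm_conj)
  then have z: "norm ?z \<le> (norm \<alpha>)\<^sup>2 * norm x" by (simp add: power2_eq_square mult_ac)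
  have "norm (adj \<alpha> * (?z * h ^ m) * \<alpha>) \<le> norm (adj \<alpha>) * norm (?z * h ^ m) * norm \<alpha>" by (rule norm_conj)
  also have "\<dots> = (norm \<alpha>)\<^sup>2 * norm (?z * h ^ m)" by (simp add: power2_eq_square mult_ac)
  also have "\<dots> \<le> (norm \<alpha>)\<^sup>2 * ((E1 * t ^ m) ^ n * ((norm \<alpha>)\<^sup>2 * norm x))"
    using Suc.IH[OF null_e_conj[OF Suc.prems]] mult_left_mono[OF z Et]
    by (intro mult_left_mono) auto
  finally have 1: "norm (?y * (1 - h) * (1 - h)) \<le> t ^ m * ((norm \<alpha>)\<^sup>2 * ((E1 * t ^ m) ^ n * ((norm \<alpha>)\<^sup>2 * norm x)))"
    unfolding eq using t by (simp add: mult_left_mono)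
  have "norm ?y \<le> ?B * norm (?y * (1 - h))" by (rule null_e_lower_bound[OF y])
  also have "\<dots> \<le> ?B * (?B * norm (?y * (1 - h) * (1 - h)))"
    by (intro mult_left_mono null_e_lower_bound[OF y1] B)
  also have "\<dots> \<le> ?B * (?B * (t ^ m * ((norm \<alpha>)\<^sup>2 * ((E1 * t ^ m) ^ n * ((norm \<alpha>)\<^sup>2 * norm x)))))"
    by (intro mult_left_mono 1 B)
  also have "\<dots> = (E1 * t ^ m) ^ Suc n * norm x"
    by (simp only: E1_def power2_eq_square power_Suc mult_ac)
  finally show ?case .
qed

text \<open>For large \<open>m\<close> the base \<open>E1 * t ^ m\<close> is below 1, so unlimited
  decay forces \<open>x * h ^ m = 0\<close>. With \<open>m\<close> a power of two the C*-identity
  halves the exponent again and again, down to 1.\<close>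

lemma null_e_mult_h:
  assumes "null_e x"
  shows "x * h = 0"
proof -
  have "(\<lambda>m. E1 * t ^ m) \<longlonglongrightarrow> E1 * 0"
    using t by (intro tendsto_intros LIMSEQ_power_zero) auto
  then have "\<forall>\<^sub>F m in sequentially. E1 * t ^ m < 1"
    by (rule order_tendstoD) simp
  then obtain i where i: "\<And>m. m \<ge> i \<Longrightarrow> E1 * t ^ m < 1"
    by (auto simp: eventually_sequentially)
  let ?m = "2 ^ i :: nat"
  have "i \<le> ?m" by (simp add: less_imp_le)
  then have lt: "E1 * t ^ ?m < 1" by (rule i)
  have "0 \<le> E1 * t ^ ?m" using t by (simp add: E1_def)
  with lt have "(\<lambda>n. (E1 * t ^ ?m) ^ n * norm x) \<longlonglongrightarrow> 0 * norm x"
    by (intro tendsto_intros LIMSEQ_power_zero) simp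
  then have "norm (x * h ^ ?m) \<le> 0 * norm x"
    by (rule LIMSEQ_le_const) (use null_e_decay[OF assms] in blast)
  then have 0: "x * h ^ 2 ^ i = 0" by simp
  have "x * h ^ 2 ^ j = 0" if "j \<le> i" for j
    using that
  proof (induction rule: inc_induct)
    case (step j)
    let ?y = "x * h ^ 2 ^ j"
    have y: "adj ?y = ?y" using null_e_h_power[OF assms, of "2 ^ j"] by (simp add: null_e_def)
    have c: "h ^ 2 ^ j * x = x * h ^ 2 ^ j"
      using assms power_commuting_commutes[of h x] by (simp add: null_e_def)
    have "adj ?y * ?y = x * (h ^ 2 ^ j * x) * h ^ 2 ^ j" by (simp only: y mult.assoc)
    also have "\<dots> = x * (x * h ^ 2 ^ Suc j)"
      by (simp add: c mult.assoc mult_2 flip: power_add)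
    finally have "adj ?y * ?y = 0" by (simp only: step.IH mult_zero_right)
    then show ?case by (rule adj_mult_eq_0)
  qed (rule 0)
  from this[of 0] show ?thesis by simp
qed

text \<open>Since \<open>x * h = 0\<close>, multiplying \<open>x\<close> by a polynomial in
  \<open>h\<close> gives its value at 0 times \<open>x\<close>, and this value is the limit of the
  eigenvalues on the \<open>e k\<close>. For a polynomial close to \<open>x\<close> these
  eigenvalues are small because \<open>x\<close> kills the \<open>e k\<close>, so
  \<open>x * x\<close> is too small for the C*-identity.\<close>

lemma null_e_zero:
  assumes x: "null_e x" and cl: "x \<in> closure (span {c *\<^sub>C h ^ a | c a. True})"
  shows "x = 0"
proof (rule ccontr)
  assume "x \<noteq> 0"
  have span: "\<exists>c d. x * y = c *\<^sub>C x \<and> (\<forall>k. y * e k = d k *\<^sub>C e k) \<and> d \<longlonglongrightarrow> c"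
    if "y \<in> span {c *\<^sub>C h ^ a | c a. True}" for y
    using that
  proof (induction rule: span_induct_alt)
    case base
    show ?case by (intro exI[of _ 0] exI[of _ "\<lambda>_. 0"]) simp
  next
    case (step r m y)
    obtain c0 a where m: "m = c0 *\<^sub>C h ^ a" using step by blast
    obtain c d where cd: "x * y = c *\<^sub>C x" "\<And>k. y * e k = d k *\<^sub>C e k" "d \<longlonglongrightarrow> c" using step by blast
    \<comment> \<open>The value at 0 of the a-th power: it appears both as the factor in
      \<open>x * h ^ a\<close> and as the limit of the eigenvalues of \<open>h ^ a\<close>.\<close>
    define u :: complex where "u = (if a = 0 then 1 else 0)"
    have xh: "x * h ^ a = u *\<^sub>C x"
      using null_e_mult_h[OF x] by (cases a) (simp_all add: u_def scaleC_one flip: mult.assoc)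
    have he: "h ^ a * e k = (complex_of_real (t ^ k) ^ a) *\<^sub>C e k" for k
    proof (induction a)
      case (Suc a)
      have "h ^ Suc a * e k = h * (h ^ a * e k)" by (simp add: mult.assoc)
      then show ?case by (simp add: Suc mult_scaleC_right h_e scaleR_scaleC scaleC_scaleC mult.commute)
    qed (simp add: scaleC_one)
    have "(\<lambda>k. complex_of_real (t ^ k)) \<longlonglongrightarrow> complex_of_real 0"
      using t by (intro tendsto_of_real LIMSEQ_power_zero) auto
    then have lim: "(\<lambda>k. complex_of_real (t ^ k) ^ a) \<longlonglongrightarrow> u"
      using tendsto_power[of "\<lambda>k. complex_of_real (t ^ k)" "complex_of_real 0" sequentially a]
      by (cases a) (simp_all add: u_def)
    show ?case
    proof (intro exI conjI allI)
      show "x * (r *\<^sub>R m + y) = (complex_of_real r * c0 * u + c) *\<^sub>C x"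
        by (simp add: m distrib_left mult_scaleC_right xh cd scaleR_scaleC scaleC_scaleC scaleC_add_left)
      show "(r *\<^sub>R m + y) * e k = (complex_of_real r * c0 * complex_of_real (t ^ k) ^ a + d k) *\<^sub>C e k" for k
        by (simp add: m distrib_right mult_scaleC_left he cd scaleR_scaleC scaleC_scaleC scaleC_add_left)
      show "(\<lambda>k. complex_of_real r * c0 * complex_of_real (t ^ k) ^ a + d k) \<longlonglongrightarrow> complex_of_real r * c0 * u + c"
        by (intro tendsto_intros lim cd)
    qed
  qed
  \<comment> \<open>A quarter for the distance of \<open>y\<close> from \<open>x\<close> and a
    quarter for the size of \<open>c\<close> add up to one half, which is already a
    contradiction.\<close>
  have "norm x / 4 > 0" using \<open>x \<noteq> 0\<close> by simp
  then obtain y where y: "y \<in> span {c *\<^sub>C h ^ a | c a. True}" "norm (y - x) < norm x / 4"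
    using cl unfolding closure_approachable dist_norm by blast
  obtain c d where cd: "x * y = c *\<^sub>C x" "\<And>k. y * e k = d k *\<^sub>C e k" "d \<longlonglongrightarrow> c"
    using span[OF y(1)] by blast
  have "cmod (d k) \<le> norm x / 4" for k
  proof -
    have "cmod (d k) * norm (e k) = norm ((y - x) * e k)"
      using x by (simp add: null_e_def left_diff_distrib cd norm_scaleC)
    also have "\<dots> \<le> norm (y - x) * norm (e k)" by (rule norm_mult_ineq)
    also have "\<dots> \<le> norm x / 4 * norm (e k)" using y(2) by (intro mult_right_mono) auto
    finally show ?thesis using e_nonzero[of k] by simp
  qed
  then have ev: "\<forall>\<^sub>F k in sequentially. cmod (d k) \<le> norm x / 4"
    by (intro always_eventually allI)
  have c: "cmod c \<le> norm x / 4"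
    by (rule Lim_norm_ubound[OF trivial_limit_sequentially cd(3) ev])
  have "adj x = x" using x by (simp add: null_e_def)
  then have "(norm x)\<^sup>2 = norm (x * x)" by (rule norm_sq_selfadj[symmetric])
  also have "x * x = c *\<^sub>C x - x * (y - x)" by (simp add: right_diff_distrib cd)
  also have "norm \<dots> \<le> cmod c * norm x + norm x * norm (y - x)"
    using norm_triangle_ineq4[of "c *\<^sub>C x" "x * (y - x)"] norm_mult_ineq[of x "y - x"] by (simp add: norm_scaleC)
  also have "\<dots> \<le> norm x / 4 * norm x + norm x * (norm x / 4)"
    using c y(2) by (intro add_mono mult_right_mono mult_left_mono) auto
  finally have "norm x * norm x \<le> (1 / 2) * (norm x * norm x)"
    by (simp add: power2_eq_square)
  moreover have "norm x * norm x > 0" using \<open>x \<noteq> 0\<close> by simp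
  ultimately show False by linarith
qed

lemma weight_zero_commute:
  assumes "weight 0 0 x"
  shows "x * h = h * x"
proof -
  have "x * h - h * x \<in> {0}"
  proof (rule closure_span_image[OF _ subspace_single_0 _ _ weight_zero_closure[OF assms], where T = "\<lambda>x. x * h - h * x"])
    show "bounded_linear (\<lambda>x. x * h - h * x)"
      by (rule bounded_linear_sub[OF bounded_linear_mult_left bounded_linear_mult_right])
    show "m * h - h * m \<in> {0}" if "m \<in> {c *\<^sub>C h ^ a | c a. True}" for m
      using that by (auto simp: mult_scaleC_left mult_scaleC_right power_commutes)
  qed simp
  then show ?thesis by simp
qed

text \<open>The two weights cancel in \<open>adj y * y\<close>, which therefore is a limit of
  polynomials in \<open>h\<close>; it commutes with \<open>h\<close> and falls under
  \<open>null_e_zero\<close>.\<close>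

lemma weight_faithful:
  assumes w: "weight i j y" and y: "\<And>k. y * e k = 0"
  shows "y = 0"
proof -
  have "weight 0 0 (adj y * y)"
    using weight_mult[OF weight_adj[OF w] w] by simp
  moreover from this have "null_e (adj y * y)"
    unfolding null_e_def
    by (intro conjI allI weight_zero_commute) (simp_all add: adj_mult adj_adj mult.assoc y)
  ultimately have "adj y * y = 0"
    by (intro null_e_zero weight_zero_closure)
  then show ?thesis by (rule adj_mult_eq_0)
qed

end

section \<open>Automorphisms of \<open>SU\<^sub>q(2)\<close>\<close>

lemma unitary_rep_image:
  assumes \<theta>: "star_hom \<theta>" and F: "is_tensor_hom tens \<theta> \<theta> F" "F \<circ> \<Phi> = \<Phi> \<circ> \<theta>"
    and v: "unitary_rep tens \<Phi> n v"
  shows "unitary_rep tens \<Phi> n (\<lambda>i j. \<theta> (v i j))"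
  unfolding unitary_rep_def
proof (intro conjI allI impI)
  fix i j assume ij: "i < n" "j < n"
  have v1: "(\<Sum>k<n. v i k * adj (v j k)) = (if i = j then 1 else 0)"
    and v2: "(\<Sum>k<n. adj (v k i) * v k j) = (if i = j then 1 else 0)"
    and v3: "\<Phi> (v i j) = (\<Sum>k<n. tens (v i k) (v k j))"
    using v ij unfolding unitary_rep_def by blast+
  show "(\<Sum>k<n. \<theta> (v i k) * adj (\<theta> (v j k))) = (if i = j then 1 else 0)"
    using arg_cong[OF v1, of \<theta>] by (auto simp: star_hom_simps[OF \<theta>])
  show "(\<Sum>k<n. adj (\<theta> (v k i)) * \<theta> (v k j)) = (if i = j then 1 else 0)"
    using arg_cong[OF v2, of \<theta>] by (auto simp: star_hom_simps[OF \<theta>])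
  have "\<Phi> (\<theta> (v i j)) = F (\<Phi> (v i j))"
    using F(2) by (metis comp_apply)
  then show "\<Phi> (\<theta> (v i j)) = (\<Sum>k<n. tens (\<theta> (v i k)) (\<theta> (v k j)))"
    using F(1) unfolding is_tensor_hom_def by (simp add: v3 star_hom_sum)
qed

lemma lessThan_2: "{..<2::nat} = {0, 1}"
  by auto

lemma all_less_2: "(\<forall>i<2::nat. P i) \<longleftrightarrow> P 0 \<and> P 1"
  by (auto simp: numeral_2_eq_2 less_Suc_eq)

locale suq2_group = suq2 q \<alpha> \<gamma> for q :: real and \<alpha> \<gamma> :: "'a::cstar_algebra" +
  fixes tens :: "'a \<Rightarrow> 'a \<Rightarrow> 'c::cstar_algebra" and \<Phi> :: "'a \<Rightarrow> 'c"
  assumes tens: "min_tensor tens" and comult: "is_SUq2_comult q \<alpha> \<gamma> tens \<Phi>"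
begin

lemma \<Phi>_hom: "star_hom \<Phi>"
  using comult by (simp add: is_SUq2_comult_def)

abbreviation u :: "nat \<Rightarrow> nat \<Rightarrow> 'a" where "u \<equiv> SUq2_matrix q \<alpha> \<gamma>"

lemma u: "u 0 0 = \<alpha>" "u 0 1 = - (q *\<^sub>R adj \<gamma>)" "u 1 0 = \<gamma>" "u 1 1 = adj \<alpha>"
  by (simp_all add: SUq2_matrix_def scaleR_scaleC)

lemma tens_scaleR: "tens (r *\<^sub>R a) b = r *\<^sub>R tens a b" "tens a (r *\<^sub>R b) = r *\<^sub>R tens a b"
  by (simp_all add: scaleR_scaleC tens_scaleC_left[OF tens] tens_scaleC_right[OF tens])

lemma \<Phi>_u: "i < 2 \<Longrightarrow> j < 2 \<Longrightarrow> \<Phi> (u i j) = (\<Sum>k<2. tens (u i k) (u k j))"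
  using comult by (simp add: is_SUq2_comult_def Let_def)

lemma \<Phi>_alpha: "\<Phi> \<alpha> = tens \<alpha> \<alpha> - q *\<^sub>R tens (adj \<gamma>) \<gamma>"
  and \<Phi>_gamma: "\<Phi> \<gamma> = tens \<gamma> \<alpha> + tens (adj \<alpha>) \<gamma>"
  using \<Phi>_u[of 0 0] \<Phi>_u[of 1 0]
  by (simp_all only: lessThan_2) (simp_all add: u[simplified] tens_minus_left[OF tens] tens_scaleR)

lemma unitary_u: "unitary_rep tens \<Phi> 2 u"
proof -
  have "\<forall>i<2. \<forall>j<2. (\<Sum>k<2. u i k * adj (u j k)) = (if i = j then 1 else 0)"
    by (simp add: all_less_2 lessThan_2 u[simplified] adj_minus adj_scaleR adj_adj alpha_adj_alpha adj_alpha_alpha gamma_normal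
        alpha_adj_gamma alpha_gamma gamma_adj_alpha h_def[symmetric] t_def power2_eq_square)
  moreover have "\<forall>i<2. \<forall>j<2. (\<Sum>k<2. adj (u k i) * u k j) = (if i = j then 1 else 0)"
    by (simp add: all_less_2 lessThan_2 u[simplified] adj_minus adj_scaleR adj_adj alpha_adj_alpha adj_alpha_alpha gamma_normal
        alpha_adj_gamma alpha_gamma adj_gamma_adj_alpha h_def[symmetric] t_def power2_eq_square)
  ultimately show ?thesis
    unfolding unitary_rep_def using \<Phi>_u by blast
qed

lemma rot_equivariant:
  assumes z: "cmod z = 1" and v: "unitary_rep tens \<Phi> n v"
  obtains D where "\<And>i j. i < n \<Longrightarrow> j < n \<Longrightarrow> rot z (cnj z) (v i j) = (\<Sum>k<n. D i k *\<^sub>C v k j)"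
    "\<And>i j. i < n \<Longrightarrow> j < n \<Longrightarrow> rot z z (v i j) = (\<Sum>k<n. D k j *\<^sub>C v i k)"
    "\<And>i j. i < n \<Longrightarrow> j < n \<Longrightarrow> (\<Sum>k<n. D i k * cnj (D j k)) = (if i = j then 1 else 0)"
proof -
  have cz: "cmod (cnj z) = 1" using z by simp
  note L = rot[OF z cz] and R = rot[OF z z]
  have idb: "bij (\<lambda>x::'a. x)" using bij_id by (simp add: id_def)
  obtain T where T: "star_hom T" "\<And>a b. T (tens a b) = tens a (rot z (cnj z) b)"
    by (rule tens_automorphism[OF tens star_hom_id idb L(1) bij_rot[OF z cz]]) (rule that; assumption)
  obtain S where S: "star_hom S" "\<And>a b. S (tens a b) = tens (rot z z a) b"
    by (rule tens_automorphism[OF tens R(1) bij_rot[OF z z] star_hom_id idb]) (rule that; assumption)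
  have eq: "S (\<Phi> x) = T (\<Phi> x)" for x
  proof (rule hom_eqI[OF star_hom_comp[OF S(1) \<Phi>_hom] star_hom_comp[OF T(1) \<Phi>_hom]])
    show "S (\<Phi> \<alpha>) = T (\<Phi> \<alpha>)"
      by (simp add: \<Phi>_alpha scaleR_scaleC star_hom_diff[OF S(1)] star_hom_diff[OF T(1)] star_hom_scaleC[OF S(1)]
          star_hom_scaleC[OF T(1)] S T L R star_hom_adj[OF R(1)] star_hom_adj[OF L(1)] adj_scaleC
          tens_scaleC_left[OF tens] tens_scaleC_right[OF tens])
    show "S (\<Phi> \<gamma>) = T (\<Phi> \<gamma>)"
      by (simp add: \<Phi>_gamma star_hom_add[OF S(1)] star_hom_add[OF T(1)]
          S T L R star_hom_adj[OF R(1)] star_hom_adj[OF L(1)] adj_scaleC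
          tens_scaleC_left[OF tens] tens_scaleC_right[OF tens])
  qed
  note equivariant = unitary_rep_equivariant[where \<Phi> = \<Phi> and L = "rot z (cnj z)" and R = "rot z z" and S = S and T = T,
      OF tens v L(1) T R(1) S eq]
  show ?thesis
    by (rule equivariant) (rule that; assumption)
qed

lemma rot_character:
  assumes z: "cmod z = 1" and v: "unitary_rep tens \<Phi> n v"
  shows "rot z (cnj z) (rep_character n v) = rot z z (rep_character n v)"
proof -
  obtain D where D: "\<And>i j. i < n \<Longrightarrow> j < n \<Longrightarrow> rot z (cnj z) (v i j) = (\<Sum>k<n. D i k *\<^sub>C v k j)"
    "\<And>i j. i < n \<Longrightarrow> j < n \<Longrightarrow> rot z z (v i j) = (\<Sum>k<n. D k j *\<^sub>C v i k)"
    by (rule rot_equivariant[OF assms]) (rule that; assumption)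
  have cz: "cmod (cnj z) = 1" using z by simp
  have "rot z (cnj z) (rep_character n v) = (\<Sum>i<n. \<Sum>k<n. D i k *\<^sub>C v k i)"
    by (simp add: rep_character_def star_hom_sum[OF rot(1)[OF z cz]] D(1))
  also have "\<dots> = (\<Sum>k<n. \<Sum>i<n. D i k *\<^sub>C v k i)" by (rule sum.swap)
  also have "\<dots> = rot z z (rep_character n v)"
    by (simp add: rep_character_def star_hom_sum[OF rot(1)[OF z z]] D(2))
  finally show ?thesis .
qed

section \<open>Automorphisms and the grading\<close>

lemma AutD:
  assumes "\<theta> \<in> Aut tens \<Phi>"
  shows "star_hom \<theta>" "bij \<theta>"
  using assms unfolding Aut_def by blast+

lemma Aut_tensor_hom:
  assumes "\<theta> \<in> Aut tens \<Phi>"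
  obtains F where "is_tensor_hom tens \<theta> \<theta> F" "F \<circ> \<Phi> = \<Phi> \<circ> \<theta>"
    "star_hom F" "\<And>a b. F (tens a b) = tens (\<theta> a) (\<theta> b)" "\<And>x. F (\<Phi> x) = \<Phi> (\<theta> x)"
proof -
  obtain F where F: "is_tensor_hom tens \<theta> \<theta> F" "F \<circ> \<Phi> = \<Phi> \<circ> \<theta>"
    using assms unfolding Aut_def by blast
  then show ?thesis
    using that[of F] unfolding is_tensor_hom_def by (metis comp_apply)
qed

text \<open>Membership asks for a homomorphism that implements the tensor square of
  \<open>inv \<theta>\<close>. The one from \<open>tens_automorphism\<close> undoes \<open>F\<close>
  on algebraic tensors, hence everywhere, and so inherits compatibility with \<Phi>.\<close>

lemma inv_Aut:
  assumes "\<theta> \<in> Aut tens \<Phi>"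
  shows "inv \<theta> \<in> Aut tens \<Phi>"
proof -
  note \<theta> = AutD[OF assms]
  obtain F where F: "star_hom F" "\<And>a b. F (tens a b) = tens (\<theta> a) (\<theta> b)" "\<And>x. F (\<Phi> x) = \<Phi> (\<theta> x)"
    by (rule Aut_tensor_hom[OF assms]) (rule that; assumption)
  note i = star_hom_inv[OF \<theta>] bij_imp_bij_inv[OF \<theta>(2)]
  obtain G where G: "star_hom G" "\<And>a b. G (tens a b) = tens (inv \<theta> a) (inv \<theta> b)"
    by (rule tens_automorphism[OF tens i i]) (rule that; assumption)
  have \<theta>i: "inv \<theta> (\<theta> x) = x" "\<theta> (inv \<theta> x) = x" for x
    using \<theta>(2) by (simp_all add: bij_is_inj bij_is_surj surj_f_inv_f)
  have GF: "G (F y) = y" for y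
  proof (rule dense_induct[OF tens_dense[OF tens]])
    show "closed {y. G (F y) = y}"
      by (intro closed_Collect_eq continuous_on_star_hom[OF G(1)] continuous_on_star_hom[OF F(1)] continuous_on_id)
    show "G (F y) = y" if "y \<in> alg_tensor tens" for y
      using that by (auto simp: alg_tensor_def star_hom_sum[OF G(1)] star_hom_sum[OF F(1)] G F(2) \<theta>i)
  qed
  have "G (\<Phi> x) = \<Phi> (inv \<theta> x)" for x
    using GF[of "\<Phi> (inv \<theta> x)"] by (simp add: F(3) \<theta>i)
  then have "G \<circ> \<Phi> = \<Phi> \<circ> inv \<theta>" by (simp add: fun_eq_iff)
  moreover have "is_tensor_hom tens (inv \<theta>) (inv \<theta>) G" using G by (simp add: is_tensor_hom_def)
  ultimately show ?thesis unfolding Aut_def using i by blast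
qed

text \<open>After multiplication by \<open>p\<close> on the right, left multiplication by
  \<open>p\<close> kills the \<alpha> side and fixes the \<gamma> side.\<close>

lemma adj_alpha_adj_gamma_indep:
  assumes "x *\<^sub>C adj \<alpha> = y *\<^sub>C adj \<gamma>"
  shows "x = 0 \<and> y = 0"
proof -
  have nz: "adj \<gamma> * p \<noteq> 0"
    using gamma_adj_gamma_p p_nonzero by auto
  have eq: "x *\<^sub>C e 1 = y *\<^sub>C (adj \<gamma> * p)"
    using arg_cong[OF assms, of "\<lambda>w. w * p"] by (simp add: mult_scaleC_left e_def)
  have "p * e 1 = 0" by (simp add: e_def p_adj_alpha flip: mult.assoc)
  then have "y *\<^sub>C (p * (adj \<gamma> * p)) = 0"
    using arg_cong[OF eq, of "\<lambda>w. p * w"] by (simp add: mult_scaleC_right)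
  moreover have "p * (adj \<gamma> * p) = adj \<gamma> * p"
    by (metis adj_gamma_p mult.assoc p_p)
  ultimately have "y = 0" using nz by (simp add: scaleC_eq_0_iff)
  then show ?thesis using eq e_nonzero[of 1] by (simp add: scaleC_eq_0_iff)
qed

lemma alpha_nonzero: "\<alpha> \<noteq> 0"
proof
  assume "\<alpha> = 0"
  then have "adj \<alpha> * e 0 = 0" by simp
  then show False using e_nonzero[of 1] e_Suc[of 0] by simp
qed

text \<open>The matrix \<open>D\<close> intertwines the circle action on \<open>\<theta>(u)\<close>. Being unitary and compatible with
  the form of \<open>u\<close>, it is diagonal because \<open>q\<^sup>2 \<noteq> 1\<close>.\<close>

lemma Aut_weight:
  assumes "\<theta> \<in> Aut tens \<Phi>"
  obtains n where "weight n n (\<theta> \<alpha>)" "weight (- n) n (\<theta> \<gamma>)"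
proof -
  note \<theta> = AutD[OF assms]
  obtain F where F: "is_tensor_hom tens \<theta> \<theta> F" "F \<circ> \<Phi> = \<Phi> \<circ> \<theta>"
    by (rule Aut_tensor_hom[OF assms]) (rule that; assumption)
  define a where "a = \<theta> \<alpha>"
  define c where "c = \<theta> \<gamma>"
  have v: "\<theta> (u 0 0) = a" "\<theta> (u 0 1) = - (q *\<^sub>R adj c)" "\<theta> (u 1 0) = c" "\<theta> (u 1 1) = adj a"
    unfolding u a_def c_def by (simp_all add: star_hom_simps[OF \<theta>(1)] scaleR_scaleC)
  obtain D where D: "\<And>i j. i < 2 \<Longrightarrow> j < 2 \<Longrightarrow> L (\<theta> (u i j)) = (\<Sum>k<2. D i k *\<^sub>C \<theta> (u k j))"
    "\<And>i j. i < 2 \<Longrightarrow> j < 2 \<Longrightarrow> R (\<theta> (u i j)) = (\<Sum>k<2. D k j *\<^sub>C \<theta> (u i k))"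
    "\<And>i j. i < 2 \<Longrightarrow> j < 2 \<Longrightarrow> (\<Sum>k<2. D i k * cnj (D j k)) = (if i = j then 1 else 0)"
    by (rule rot_equivariant[OF z0(1) unitary_rep_image[OF \<theta>(1) F unitary_u]]) (rule that; assumption)
  have two: "(0::nat) < 2" "(1::nat) < 2" by simp_all
  have sum2: "(\<Sum>k<2. f k) = f 0 + f 1" for f :: "nat \<Rightarrow> 'x::comm_monoid_add"
    by (simp add: lessThan_2)
  note D1 = D(1)[unfolded sum2] and D2 = D(2)[unfolded sum2] and D3 = D(3)[unfolded sum2]
  have La: "L a = D 0 0 *\<^sub>C a + D 0 1 *\<^sub>C c" using D1[OF two(1,1)] by (simp only: v)
  have Lc: "L c = D 1 0 *\<^sub>C a + D 1 1 *\<^sub>C c" using D1[OF two(2,1)] by (simp only: v)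
  have La': "L (adj a) = D 1 0 *\<^sub>C (- (q *\<^sub>R adj c)) + D 1 1 *\<^sub>C adj a" using D1[OF two(2,2)] by (simp only: v)
  have Ra: "R a = D 0 0 *\<^sub>C a + D 1 0 *\<^sub>C (- (q *\<^sub>R adj c))" using D2[OF two(1,1)] by (simp only: v)
  have Rc: "R c = D 0 0 *\<^sub>C c + D 1 0 *\<^sub>C adj a" using D2[OF two(2,1)] by (simp only: v)
  \<comment> \<open>The last column of the matrix repeats the adjoints of the first, so
    \<open>L (adj a)\<close> is known in two ways; comparing coefficients ties the two rows of
    \<open>D\<close> together.\<close>
  have "L (adj a) = cnj (D 0 0) *\<^sub>C adj a + cnj (D 0 1) *\<^sub>C adj c"
    by (simp add: star_hom_adj[OF LR_hom(1)] La adj_add adj_scaleC)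
  then have "(D 1 1 - cnj (D 0 0)) *\<^sub>C adj a = (cnj (D 0 1) + q * D 1 0) *\<^sub>C adj c"
    using La' by (simp add: scaleC_diff_left scaleC_add_left scaleC_minus_right scaleR_scaleC scaleC_scaleC
        algebra_simps)
  then have "\<theta> ((D 1 1 - cnj (D 0 0)) *\<^sub>C adj \<alpha>) = \<theta> ((cnj (D 0 1) + q * D 1 0) *\<^sub>C adj \<gamma>)"
    by (simp only: a_def c_def star_hom_scaleC[OF \<theta>(1)] star_hom_adj[OF \<theta>(1)])
  then have "(D 1 1 - cnj (D 0 0)) *\<^sub>C adj \<alpha> = (cnj (D 0 1) + q * D 1 0) *\<^sub>C adj \<gamma>"
    using \<theta>(2) by (meson bij_is_inj injD)
  from adj_alpha_adj_gamma_indep[OF this] have D11: "D 1 1 = cnj (D 0 0)" and "cnj (D 0 1) = - (q * D 1 0)"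
    by (simp_all add: eq_neg_iff_add_eq_0)
  then have D01: "cmod (D 0 1) = \<bar>q\<bar> * cmod (D 1 0)"
    by (metis complex_mod_cnj norm_minus_cancel norm_mult norm_of_real)
  have "D 0 0 * cnj (D 0 0) + D 0 1 * cnj (D 0 1) = 1" "D 1 0 * cnj (D 1 0) + D 1 1 * cnj (D 1 1) = 1"
    using D3[OF two(1,1)] D3[OF two(2,2)] by simp_all
  then have "complex_of_real ((cmod (D 0 0))\<^sup>2 + (cmod (D 0 1))\<^sup>2) = 1"
    "complex_of_real ((cmod (D 1 0))\<^sup>2 + (cmod (D 1 1))\<^sup>2) = 1"
    by (simp_all only: of_real_add complex_norm_square)
  then have unit: "(cmod (D 0 0))\<^sup>2 + (cmod (D 0 1))\<^sup>2 = 1" "(cmod (D 1 0))\<^sup>2 + (cmod (D 1 1))\<^sup>2 = 1"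
    by (simp_all only: of_real_eq_1_iff)
  \<comment> \<open>Both rows have norm one and the same entries up to modulus, except that one
    off-diagonal entry carries an extra factor \<open>q\<close>; with \<open>t < 1\<close> it must
    vanish.\<close>
  have "(cmod (D 0 0))\<^sup>2 + t * (cmod (D 1 0))\<^sup>2 = 1"
    using unit(1) by (simp only: D01 power_mult_distrib power2_abs t_def)
  moreover have "(cmod (D 1 0))\<^sup>2 + (cmod (D 0 0))\<^sup>2 = 1"
    using unit(2) by (simp only: D11 complex_mod_cnj)
  ultimately have "(1 - t) * (cmod (D 1 0))\<^sup>2 = 0" by (simp only: left_diff_distrib)
  then have D10: "D 1 0 = 0" using t by simp
  then have D01: "D 0 1 = 0" using D01 by simp
  have w1: "cmod (D 0 0) = 1"
    using unit(1) D01 by (simp add: power2_eq_1_iff) (metis norm_ge_zero not_one_le_zero neg_0_le_iff_le)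
  have La: "L a = D 0 0 *\<^sub>C a" using La D01 by simp
  have "a \<noteq> 0"
  proof
    assume "a = 0"
    then have "\<theta> \<alpha> = \<theta> 0" by (simp add: a_def star_hom_zero[OF \<theta>(1)])
    then have "\<alpha> = 0" using \<theta>(2) by (meson bij_is_inj injD)
    then show False using alpha_nonzero by simp
  qed
  then obtain n where n: "D 0 0 = z0 powi n"
    using L_eigenvalue[OF La w1] by blast
  have n': "cnj (D 0 0) = z0 powi (- n)"
  proof -
    have "cnj (D 0 0) * D 0 0 = z0 powi (- n) * D 0 0"
      using z0_nonzero unit_cnj[OF w1] by (simp add: n power_int_minus)
    then show ?thesis using w1 by auto
  qed
  have "R a = D 0 0 *\<^sub>C a" "L c = cnj (D 0 0) *\<^sub>C c" "R c = D 0 0 *\<^sub>C c"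
    using Ra Lc Rc by (simp_all only: D10 D11 scaleC_zero_left add_0_left add_0_right)
  then have "weight n n a" "weight (- n) n c"
    unfolding weight_def using La by (simp_all only: n'[symmetric] n[symmetric])
  then show ?thesis using that by (simp add: a_def c_def)
qed

text \<open>With negative weight, \<open>inv \<theta> p\<close> would annihilate \<alpha> from the
  left, hence also \<open>1 - t *\<^sub>R h\<close>, which is impossible for a nonzero element as
  \<open>norm h = 1\<close>. With weight 0, \<open>L\<close> would be trivial on the range of
  \<theta>, that is, everywhere.\<close>

lemma Aut_weight_pos:
  assumes "\<theta> \<in> Aut tens \<Phi>"
  obtains n where "n > 0" "weight (int n) (int n) (\<theta> \<alpha>)" "weight (- int n) (int n) (\<theta> \<gamma>)"
proof -
  obtain m where m: "weight m m (\<theta> \<alpha>)" "weight (- m) m (\<theta> \<gamma>)" using Aut_weight[OF assms] .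
  note \<theta> = AutD[OF assms]
  have \<theta>i: "inv \<theta> (\<theta> x) = x" "\<theta> (inv \<theta> x) = x" for x
    using \<theta>(2) by (simp_all add: bij_is_inj bij_is_surj surj_f_inv_f)
  note \<theta>' = star_hom_inv[OF \<theta>]
  have "\<not> m < 0"
  proof
    assume "m < 0"
    then have "adj (\<theta> \<alpha>) * p = 0"
      by (intro weight_pos_p[OF weight_adj[OF m(1)]]) simp
    from arg_cong[OF this, of adj] have "p * \<theta> \<alpha> = 0" by (simp add: adj_mult adj_adj p_selfadj)
    from arg_cong[OF this, of "inv \<theta>"] have "inv \<theta> p * \<alpha> = 0"
      by (simp add: star_hom_simps[OF \<theta>'] \<theta>i)
    then have "inv \<theta> p * (\<alpha> * adj \<alpha>) = 0" by (simp flip: mult.assoc)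
    then have "inv \<theta> p = t *\<^sub>R (inv \<theta> p * h)" by (simp add: alpha_adj_alpha right_diff_distrib)
    then have "norm (inv \<theta> p) = t * norm (inv \<theta> p * h)"
      using t by (metis abs_of_pos norm_scaleR)
    also have "\<dots> \<le> t * norm (inv \<theta> p)"
      using norm_mult_ineq[of "inv \<theta> p" h] t by (intro mult_left_mono) (simp_all add: norm_h)
    finally have "norm (inv \<theta> p) * (1 - t) \<le> 0" by (simp add: algebra_simps)
    then have "inv \<theta> p = 0" using t by (simp add: mult_le_0_iff)
    then have "p = 0" using \<theta>i(2)[of p] star_hom_zero[OF \<theta>(1)] by simp
    then show False using p_nonzero by simp
  qed
  moreover have "m \<noteq> 0"
  proof
    assume "m = 0"
    then have "L (\<theta> \<alpha>) = \<theta> \<alpha>" "L (\<theta> \<gamma>) = \<theta> \<gamma>"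
      using m by (simp_all add: weight_def scaleC_one)
    then have "L (\<theta> x) = \<theta> x" for x
      by (rule hom_eqI[OF star_hom_comp[OF LR_hom(1) \<theta>(1)] \<theta>(1)])
    from this[of "inv \<theta> \<alpha>"] have "L \<alpha> = \<alpha>" by (simp add: \<theta>i)
    then have "z0 *\<^sub>C \<alpha> = 1 *\<^sub>C \<alpha>" by (simp add: rot[OF z0_norms(1,2)] scaleC_one)
    then have "z0 = 1" using alpha_nonzero by (rule scaleC_cancel)
    then show False using z0(2)[of 1] by simp
  qed
  ultimately have "nat m > 0" "int (nat m) = m" by auto
  then show ?thesis using that[of "nat m"] m by simp
qed

text \<open>Positive weight makes the image of \<alpha> kill \<open>p\<close>. So the image of
  \<open>h\<close> fixes \<open>p\<close>, and so does the limit of its powers.\<close>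

lemma Aut_p_aux:
  assumes "\<theta> \<in> Aut tens \<Phi>"
  shows "\<theta> p * p = p" "\<theta> h * p = p"
proof -
  obtain n where n: "n > 0" "weight (int n) (int n) (\<theta> \<alpha>)" using Aut_weight_pos[OF assms] .
  note \<theta> = AutD[OF assms]
  have "\<theta> \<alpha> * p = 0" using n by (intro weight_pos_p[OF n(2)]) simp
  then have "\<theta> (adj \<alpha> * \<alpha>) * p = 0" by (simp add: star_hom_simps[OF \<theta>(1)] mult.assoc)
  then show hp: "\<theta> h * p = p"
    by (simp add: adj_alpha_alpha star_hom_simps[OF \<theta>(1)] left_diff_distrib)
  have "\<theta> (h ^ k) * p = p" for k
    by (induction k) (simp_all add: star_hom_simps[OF \<theta>(1)] mult.assoc hp)
  moreover have "(\<lambda>k. \<theta> (h ^ k) * p) \<longlonglongrightarrow> \<theta> p * p"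
    by (intro tendsto_mult tendsto_const tendsto_star_hom[OF \<theta>(1)] p(1))
  ultimately have "(\<lambda>k::nat. p) \<longlonglongrightarrow> \<theta> p * p" by (simp only:)
  then show "\<theta> p * p = p" by (rule LIMSEQ_unique) (rule tendsto_const)
qed

text \<open>As projections, \<open>p\<close> lies below \<open>\<theta> p\<close> by
  \<open>Aut_p_aux\<close>; the same statement for the inverse automorphism gives the reverse
  order.\<close>

lemma Aut_p:
  assumes "\<theta> \<in> Aut tens \<Phi>"
  shows "\<theta> p = p"
proof -
  note \<theta> = AutD[OF assms]
  have \<theta>i: "\<theta> (inv \<theta> x) = x" for x
    using \<theta>(2) by (simp add: bij_is_surj surj_f_inv_f)
  have "\<theta> (inv \<theta> p * p) = \<theta> p" using Aut_p_aux(1)[OF inv_Aut[OF assms]] by simp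
  then have "p * \<theta> p = \<theta> p" by (simp add: star_hom_simps[OF \<theta>(1)] \<theta>i)
  from arg_cong[OF this, of adj] have "\<theta> p * p = \<theta> p"
    by (simp add: adj_mult p_selfadj flip: star_hom_adj[OF \<theta>(1)])
  then show ?thesis using Aut_p_aux(1)[OF assms] by simp
qed

lemma Aut_e:
  assumes "\<theta> \<in> Aut tens \<Phi>" "weight (int n) (int n) (\<theta> \<alpha>)"
  obtains c where "\<And>k. \<theta> (e k) = c k *\<^sub>C e (k * n)"
proof -
  note \<theta> = AutD[OF assms(1)]
  have "\<exists>c. \<theta> (e k) = c *\<^sub>C e (k * n)" for k
  proof -
    have "weight (- int (k * n)) (- int (k * n)) (\<theta> (adj \<alpha>) ^ k)"
      using weight_power[OF weight_adj[OF assms(2)], of k] by (simp add: star_hom_adj[OF \<theta>(1)])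
    then obtain c where "\<theta> (adj \<alpha>) ^ k * p = c *\<^sub>C e (k * n)" by (rule weight_neg_p)
    then have "\<theta> (e k) = c *\<^sub>C e (k * n)"
      by (simp add: e_def star_hom_mult[OF \<theta>(1)] star_hom_power[OF \<theta>(1)] Aut_p[OF assms(1)])
    then show ?thesis by blast
  qed
  then show ?thesis using that by metis
qed

text \<open>Applying the inverse and then \<theta> makes \<open>e 1\<close> a multiple of
  \<open>e (m * n)\<close>. As \<open>h\<close> separates the \<open>e k\<close> by their
  eigenvalues \<open>t ^ k\<close>, the product of the two weights is 1.\<close>

lemma Aut_weight_1:
  assumes "\<theta> \<in> Aut tens \<Phi>"
  shows "weight 1 1 (\<theta> \<alpha>)" "weight (- 1) 1 (\<theta> \<gamma>)"
proof -
  obtain n where n: "n > 0" "weight (int n) (int n) (\<theta> \<alpha>)" "weight (- int n) (int n) (\<theta> \<gamma>)"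
    using Aut_weight_pos[OF assms] .
  obtain m where m: "m > 0" "weight (int m) (int m) (inv \<theta> \<alpha>)"
    using Aut_weight_pos[OF inv_Aut[OF assms]] .
  note \<theta> = AutD[OF assms]
  obtain c where c: "\<And>k. \<theta> (e k) = c k *\<^sub>C e (k * n)" by (rule Aut_e[OF assms n(2)]) (rule that; assumption)
  obtain d where d: "\<And>k. inv \<theta> (e k) = d k *\<^sub>C e (k * m)" by (rule Aut_e[OF inv_Aut[OF assms] m(2)]) (rule that; assumption)
  have "e 1 = \<theta> (inv \<theta> (e 1))" using \<theta>(2) by (simp add: bij_is_surj surj_f_inv_f)
  also have "\<dots> = (d 1 * c m) *\<^sub>C e (m * n)" by (simp add: c d star_hom_scaleC[OF \<theta>(1)] scaleC_scaleC)
  finally have e1: "e 1 = (d 1 * c m) *\<^sub>C e (m * n)" .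
  have "h * e 1 = t ^ (m * n) *\<^sub>R e 1"
    by (subst (1 2) e1) (simp add: mult_scaleC_right h_e scaleC_scaleR_commute)
  then have "t ^ 1 *\<^sub>R e 1 = t ^ (m * n) *\<^sub>R e 1" by (simp only: h_e)
  then have "t ^ 1 = t ^ (m * n)" using e_nonzero[of 1] by (simp only: scaleR_cancel_right) simp
  then have "1 = m * n" using t by (simp only: power_inject_exp')
  then have "n = 1" by (metis nat_mult_eq_1_iff)
  then show "weight 1 1 (\<theta> \<alpha>)" "weight (- 1) 1 (\<theta> \<gamma>)" using n by simp_all
qed

end

section \<open>Determination of the remaining scalars\<close>

context suq2_group
begin

lemma e_mult_p: "e k * (p * x) = e k * x"
  by (simp add: e_p flip: mult.assoc)

lemma tens_nonzero: "a \<noteq> 0 \<Longrightarrow> b \<noteq> 0 \<Longrightarrow> tens a b \<noteq> 0"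
  using tens_eq_0_imp[OF tens] by blast

text \<open>Left multiplication by \<gamma> is not scalar on \<open>e k\<close>: besides
  \<open>q ^ k\<close> a phase remains, which commutes with \<open>p\<close> and is kept as the
  right factor.\<close>

lemma gamma_e: "\<gamma> * e k = q ^ k *\<^sub>R (e k * \<gamma>)" and adj_gamma_e: "adj \<gamma> * e k = q ^ k *\<^sub>R (e k * adj \<gamma>)"
proof -
  have "\<gamma> * e k = (\<gamma> * adj \<alpha> ^ k) * p" by (simp add: e_def mult.assoc)
  then show "\<gamma> * e k = q ^ k *\<^sub>R (e k * \<gamma>)"
    by (simp add: commute_scaled_power[OF gamma_adj_alpha] e_def mult.assoc gamma_p)
  have "adj \<gamma> * e k = (adj \<gamma> * adj \<alpha> ^ k) * p" by (simp add: e_def mult.assoc)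
  then show "adj \<gamma> * e k = q ^ k *\<^sub>R (e k * adj \<gamma>)"
    by (simp add: commute_scaled_power[OF adj_gamma_adj_alpha] e_def mult.assoc adj_gamma_p)
qed

lemma \<Phi>_h: "\<Phi> h = tens h (1 - h) + tens (adj \<gamma> * adj \<alpha>) (adj \<alpha> * \<gamma>) + tens (\<alpha> * \<gamma>) (adj \<gamma> * \<alpha>)
    + tens (1 - t *\<^sub>R h) h"
proof -
  have "\<Phi> h = tens (adj \<gamma> * \<gamma>) (adj \<alpha> * \<alpha>) + tens (adj \<gamma> * adj \<alpha>) (adj \<alpha> * \<gamma>) + tens (\<alpha> * \<gamma>) (adj \<gamma> * \<alpha>)
      + tens (\<alpha> * adj \<alpha>) (adj \<gamma> * \<gamma>)"
    by (simp add: h_def star_hom_mult[OF \<Phi>_hom] star_hom_adj[OF \<Phi>_hom] \<Phi>_gamma adj_add tens_adj[OF tens]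
        adj_adj distrib_left distrib_right tens_mult[OF tens])
  then show ?thesis
    by (simp only: adj_alpha_alpha alpha_adj_alpha h_def[symmetric])
qed

lemma Aut_gens:
  assumes "\<theta> \<in> Aut tens \<Phi>"
  obtains \<mu> where "cmod \<mu> = 1" "\<theta> \<alpha> = \<alpha>" "\<theta> \<gamma> = \<mu> *\<^sub>C \<gamma>"
proof -
  note \<theta> = AutD[OF assms]
  note hom = star_hom_simps[OF \<theta>(1)]
  obtain F where F: "star_hom F" "\<And>a b. F (tens a b) = tens (\<theta> a) (\<theta> b)" "\<And>x. F (\<Phi> x) = \<Phi> (\<theta> x)"
    by (rule Aut_tensor_hom[OF assms]) (rule that; assumption)
  note w = Aut_weight_1[OF assms]
  note \<theta>p = Aut_p[OF assms]
  have inj: "\<theta> x = \<theta> y \<Longrightarrow> x = y" for x y using \<theta>(2) by (meson bij_is_inj injD)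
  obtain c where "\<And>k. \<theta> (e k) = c k *\<^sub>C e (k * 1)" by (rule Aut_e[OF assms, of 1]) (simp_all add: w)
  then have c: "\<theta> (e k) = c k *\<^sub>C e k" for k by simp
  have c0: "c 0 = 1"
    using c[of 0] p_nonzero by (metis \<theta>p e_0 scaleC_cancel scaleC_one)
  have c_nz: "c k \<noteq> 0" for k
  proof
    assume "c k = 0"
    then have "\<theta> (e k) = \<theta> 0" using c[of k] by (simp add: star_hom_zero[OF \<theta>(1)])
    then show False using inj e_nonzero by blast
  qed
  obtain \<mu> where \<mu>: "\<theta> \<gamma> * p = \<mu> *\<^sub>C (\<gamma> * p)" using weight_gamma_p[OF w(2)] .
  have \<theta>gp: "\<theta> (p * \<gamma>) = \<mu> *\<^sub>C (p * \<gamma>)"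
    using \<mu> by (simp add: hom \<theta>p flip: gamma_p)
  have \<theta>gp': "\<theta> (p * adj \<gamma>) = cnj \<mu> *\<^sub>C (p * adj \<gamma>)"
    using arg_cong[OF \<mu>, of adj] by (simp add: adj_mult adj_scaleC p_selfadj hom \<theta>p)
  \<comment> \<open>That the image of \<open>h\<close> fixes \<open>p\<close> is the statement that
    the image of \<gamma> acts isometrically there; this pins down the modulus of \<mu>.\<close>
  have "\<theta> (adj \<gamma>) * (\<theta> \<gamma> * p) = p"
    using Aut_p_aux(2)[OF assms] by (simp add: h_def hom mult.assoc)
  then have "p * (\<theta> (adj \<gamma>) * (\<theta> \<gamma> * p)) = p" by (simp add: p_p)
  then have "adj (\<theta> \<gamma> * p) * (\<theta> \<gamma> * p) = p"
    by (simp add: adj_mult p_selfadj hom mult.assoc)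
  then have "(cnj \<mu> * \<mu>) *\<^sub>C (p * (adj \<gamma> * (\<gamma> * p))) = p"
    by (simp add: \<mu> adj_scaleC adj_mult p_selfadj mult_scaleC_left mult_scaleC_right scaleC_scaleC mult.assoc mult.commute)
  then have "(cnj \<mu> * \<mu>) *\<^sub>C p = 1 *\<^sub>C p" by (simp add: adj_gamma_gamma_p p_p scaleC_one)
  then have \<mu>1: "cnj \<mu> * \<mu> = 1" using p_nonzero by (rule scaleC_cancel)
  then have norm_\<mu>: "cmod \<mu> = 1"
    by (metis complex_mod_cnj norm_mult norm_one power2_eq_square real_sqrt_abs abs_norm_cancel real_sqrt_one)
  have h_e_\<theta>: "\<theta> h * e k = t ^ k *\<^sub>R e k" for k
  proof -
    have "c k *\<^sub>C (\<theta> h * e k) = \<theta> h * \<theta> (e k)" by (simp only: c mult_scaleC_right)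
    also have "\<dots> = \<theta> (h * e k)" by (simp only: hom)
    also have "\<dots> = c k *\<^sub>C (t ^ k *\<^sub>R e k)" by (simp add: h_e scaleR_scaleC hom c scaleC_scaleC mult.commute)
    finally have "c k *\<^sub>C (\<theta> h * e k - t ^ k *\<^sub>R e k) = 0" by (simp add: scaleC_diff_right)
    then show ?thesis using c_nz by (simp add: scaleC_eq_0_iff)
  qed
  have "weight 0 0 (\<theta> h)"
    using weight_mult[OF weight_adj[OF w(2)] w(2)] by (simp add: h_def hom)
  then have "\<theta> h - h = 0"
    by (intro weight_faithful[OF weight_diff[OF _ weight_h]]) (simp_all add: left_diff_distrib h_e h_e_\<theta>)
  then have \<theta>h: "\<theta> h = h" by simp
  define E where "E k = tens (e k) p" for k
  define G where "G k = tens (e (Suc k) * adj \<gamma>) (e 1 * \<gamma>)" for k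
  \<comment> \<open>Of the four terms of \<open>\<Phi> h\<close>, those with \<open>1 - h\<close> or
    \<open>adj \<gamma> * \<alpha>\<close> in the second leg die on \<open>p\<close>.\<close>
  have \<Phi>hE: "\<Phi> h * E k = (1 - t ^ Suc k) *\<^sub>R E k + q ^ Suc k *\<^sub>R G k" for k
  proof -
    have "(1 - h) * p = 0" by (simp add: left_diff_distrib h_p)
    moreover have "adj \<gamma> * \<alpha> * p = 0" by (simp add: alpha_p mult.assoc)
    moreover have "(1 - t *\<^sub>R h) * e k = (1 - t ^ Suc k) *\<^sub>R e k"
      by (simp add: left_diff_distrib h_e scaleR_left_diff_distrib)
    moreover have "adj \<gamma> * adj \<alpha> * e k = q ^ Suc k *\<^sub>R (e (Suc k) * adj \<gamma>)"
      using adj_gamma_e[of "Suc k"] by (simp only: e_Suc mult.assoc)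
    moreover have "adj \<alpha> * \<gamma> * p = e 1 * \<gamma>"
      by (simp add: e_def gamma_p mult.assoc)
    ultimately show ?thesis
      by (simp only: \<Phi>_h E_def G_def distrib_right tens_mult[OF tens] h_p tens_scaleR tens_zero_right[OF tens]
          add_0_left add_0_right add.commute)
  qed
  have FE: "F (E k) = c k *\<^sub>C E k" for k
    by (simp add: E_def F c \<theta>p tens_scaleC_left[OF tens])
  \<comment> \<open>The phases \<open>cnj \<mu>\<close> and \<mu> of the two legs cancel, so only
    the scalars of the vectors themselves remain.\<close>
  have FG: "F (G k) = (c (Suc k) * c 1) *\<^sub>C G k" for k
  proof -
    have 1: "\<theta> (e (Suc k) * adj \<gamma>) = (c (Suc k) * cnj \<mu>) *\<^sub>C (e (Suc k) * adj \<gamma>)"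
    proof -
      have "\<theta> (e (Suc k) * (p * adj \<gamma>)) = (c (Suc k) * cnj \<mu>) *\<^sub>C (e (Suc k) * (p * adj \<gamma>))"
        unfolding star_hom_mult[OF \<theta>(1), of "e (Suc k)"] c \<theta>gp'
        by (simp add: mult_scaleC_left mult_scaleC_right scaleC_scaleC mult.commute)
      then show ?thesis by (simp only: e_mult_p)
    qed
    have 2: "\<theta> (e 1 * \<gamma>) = (c 1 * \<mu>) *\<^sub>C (e 1 * \<gamma>)"
    proof -
      have "\<theta> (e 1 * (p * \<gamma>)) = (c 1 * \<mu>) *\<^sub>C (e 1 * (p * \<gamma>))"
        unfolding star_hom_mult[OF \<theta>(1), of "e 1"] c \<theta>gp
        by (simp add: mult_scaleC_left mult_scaleC_right scaleC_scaleC mult.commute)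
      then show ?thesis by (simp only: e_mult_p)
    qed
    have "c (Suc k) * cnj \<mu> * (c 1 * \<mu>) = c (Suc k) * c 1 * (cnj \<mu> * \<mu>)" by (simp only: mult_ac)
    then have 3: "c (Suc k) * cnj \<mu> * (c 1 * \<mu>) = c (Suc k) * c 1" by (simp only: \<mu>1 mult_1_right)
    show ?thesis
      by (simp only: G_def F 1 2 tens_scaleC_left[OF tens] tens_scaleC_right[OF tens] scaleC_scaleC 3 mult.commute[of "c 1 * \<mu>"])
  qed
  have G_nz: "G k \<noteq> 0" for k
    unfolding G_def
  proof (rule tens_nonzero)
    have "e (Suc k) * adj \<gamma> * \<gamma> = e (Suc k)"
      by (metis e_p h_def mult.assoc p_h)
    then show "e (Suc k) * adj \<gamma> \<noteq> 0" using e_nonzero[of "Suc k"] by auto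
    have "e 1 * \<gamma> * adj \<gamma> = e 1"
      by (metis e_p gamma_normal mult.assoc p_h)
    then show "e 1 * \<gamma> \<noteq> 0" using e_nonzero[of 1] by auto
  qed
  \<comment> \<open>\<open>F\<close> fixes \<open>\<Phi> h\<close> because \<theta> fixes
    \<open>h\<close>. It therefore multiplies all of \<open>\<Phi> h * E k\<close> by the scalar of
    \<open>E k\<close>, including the \<open>G k\<close> component, whose own scalar is already
    known.\<close>
  have cc: "c (Suc k) * c 1 = c k" for k
  proof -
    have "F (\<Phi> h * E k) = \<Phi> h * F (E k)" by (simp only: star_hom_mult[OF F(1)] F(3) \<theta>h)
    also have "\<dots> = c k *\<^sub>C (\<Phi> h * E k)" by (simp only: FE mult_scaleC_right)
    finally have "F ((1 - t ^ Suc k) *\<^sub>R E k + q ^ Suc k *\<^sub>R G k) = c k *\<^sub>C ((1 - t ^ Suc k) *\<^sub>R E k + q ^ Suc k *\<^sub>R G k)"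
      by (simp only: \<Phi>hE)
    then have "(1 - t ^ Suc k) *\<^sub>R (c k *\<^sub>C E k) + q ^ Suc k *\<^sub>R ((c (Suc k) * c 1) *\<^sub>C G k) =
        (1 - t ^ Suc k) *\<^sub>R (c k *\<^sub>C E k) + q ^ Suc k *\<^sub>R (c k *\<^sub>C G k)"
      by (simp only: star_hom_add[OF F(1)] scaleR_scaleC star_hom_scaleC[OF F(1)] FE FG scaleC_add_right
          scaleC_scaleR_commute[unfolded scaleR_scaleC])
    then have "q ^ Suc k *\<^sub>R ((c (Suc k) * c 1) *\<^sub>C G k) = q ^ Suc k *\<^sub>R (c k *\<^sub>C G k)"
      by (rule add_left_imp_eq)
    then have "(c (Suc k) * c 1) *\<^sub>C G k = c k *\<^sub>C G k"
      using q_nonzero by (simp only: scaleR_cancel_left) simp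
    then show ?thesis using G_nz by (rule scaleC_cancel)
  qed
  have ye: "\<theta> \<alpha> * e k = c 1 *\<^sub>C (\<alpha> * e k)" for k
  proof (cases k)
    case 0
    have "\<theta> \<alpha> * p = 0" by (rule weight_pos_p[OF w(1)]) simp
    then show ?thesis by (simp add: 0 e_0 alpha_p)
  next
    case (Suc l)
    have "c k *\<^sub>C (\<theta> \<alpha> * e k) = \<theta> \<alpha> * \<theta> (e k)" by (simp only: c mult_scaleC_right)
    also have "\<dots> = \<theta> (\<alpha> * e k)" by (simp only: hom)
    also have "\<dots> = c l *\<^sub>C (\<alpha> * e k)"
      by (simp only: Suc alpha_e scaleR_scaleC hom c scaleC_scaleC mult.commute)
    also have "\<dots> = c k *\<^sub>C (c 1 *\<^sub>C (\<alpha> * e k))" by (simp add: Suc scaleC_scaleC flip: cc[of l])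
    finally have "c k *\<^sub>C (\<theta> \<alpha> * e k - c 1 *\<^sub>C (\<alpha> * e k)) = 0" by (simp add: scaleC_diff_right)
    then show ?thesis using c_nz by (simp add: scaleC_eq_0_iff)
  qed
  have "\<theta> \<alpha> - c 1 *\<^sub>C \<alpha> = 0"
    by (intro weight_faithful[OF weight_diff[OF w(1) weight_scaleC[OF weight_alpha]]])
      (simp add: left_diff_distrib mult_scaleC_left ye)
  then have \<theta>\<alpha>: "\<theta> \<alpha> = c 1 *\<^sub>C \<alpha>" by simp
  \<comment> \<open>On the tensor square of \<open>p\<close> only the \<gamma> term of
    \<open>\<Phi> \<alpha>\<close> survives, and its phases cancel under \<open>F\<close>. So the
    factor \<open>c 1\<close> multiplies a nonzero tensor without changing it.\<close>
  have "F (\<Phi> \<alpha>) * tens p p = c 1 *\<^sub>C (\<Phi> \<alpha> * tens p p)"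
    by (simp add: F(3) \<theta>\<alpha> star_hom_scaleC[OF \<Phi>_hom] mult_scaleC_left)
  moreover have "\<Phi> \<alpha> * tens p p = - (q *\<^sub>R tens (adj \<gamma> * p) (\<gamma> * p))"
    by (simp add: \<Phi>_alpha left_diff_distrib tens_mult[OF tens] alpha_p tens_zero_left[OF tens])
  moreover have "F (\<Phi> \<alpha>) * tens p p = - (q *\<^sub>R tens (adj \<gamma> * p) (\<gamma> * p))"
  proof -
    have "\<theta> \<alpha> * p = 0" by (simp add: \<theta>\<alpha> alpha_p mult_scaleC_left)
    moreover have "\<theta> (adj \<gamma>) * p = cnj \<mu> *\<^sub>C (adj \<gamma> * p)"
      using \<theta>gp' by (simp add: hom \<theta>p flip: adj_gamma_p)
    ultimately have "F (\<Phi> \<alpha>) * tens p p = - (q *\<^sub>R tens (cnj \<mu> *\<^sub>C (adj \<gamma> * p)) (\<mu> *\<^sub>C (\<gamma> * p)))"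
      by (simp add: \<Phi>_alpha star_hom_diff[OF F(1)] scaleR_scaleC star_hom_scaleC[OF F(1)] F(2) left_diff_distrib
          mult_scaleC_left tens_mult[OF tens] tens_zero_left[OF tens] \<mu> scaleC_minus_right)
    also have "tens (cnj \<mu> *\<^sub>C (adj \<gamma> * p)) (\<mu> *\<^sub>C (\<gamma> * p)) = tens (adj \<gamma> * p) (\<gamma> * p)"
      by (simp only: tens_scaleC_left[OF tens] tens_scaleC_right[OF tens] scaleC_scaleC mult.commute[of \<mu>] \<mu>1 scaleC_one)
    finally show ?thesis .
  qed
  ultimately have s: "1 *\<^sub>C (q *\<^sub>R tens (adj \<gamma> * p) (\<gamma> * p)) = c 1 *\<^sub>C (q *\<^sub>R tens (adj \<gamma> * p) (\<gamma> * p))"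
    by (simp add: scaleC_minus_right scaleC_one)
  have "adj \<gamma> * p \<noteq> 0" "\<gamma> * p \<noteq> 0"
    using gamma_adj_gamma_p adj_gamma_gamma_p p_nonzero by auto
  then have "q *\<^sub>R tens (adj \<gamma> * p) (\<gamma> * p) \<noteq> 0"
    using q_nonzero tens_nonzero by simp
  with s have c1: "c 1 = 1" by (metis scaleC_cancel)
  have c_one: "c k = 1" for k
    by (induction k) (use c0 cc c1 in auto)
  have "\<theta> \<gamma> * e k = \<mu> *\<^sub>C (\<gamma> * e k)" for k
  proof -
    have "\<theta> \<gamma> * e k = \<theta> (\<gamma> * e k)" by (simp add: hom c c_one scaleC_one)
    also have "\<dots> = q ^ k *\<^sub>R \<theta> (e k * (p * \<gamma>))"
      by (simp only: gamma_e e_mult_p scaleR_scaleC star_hom_scaleC[OF \<theta>(1)])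
    also have "\<dots> = q ^ k *\<^sub>R (\<mu> *\<^sub>C (e k * \<gamma>))"
      unfolding star_hom_mult[OF \<theta>(1), of "e k"] c \<theta>gp
      by (simp add: c_one scaleC_one mult_scaleC_right e_mult_p)
    also have "\<dots> = \<mu> *\<^sub>C (\<gamma> * e k)" by (simp add: gamma_e scaleC_scaleR_commute)
    finally show ?thesis .
  qed
  then have "\<theta> \<gamma> - \<mu> *\<^sub>C \<gamma> = 0"
    by (intro weight_faithful[OF weight_diff[OF w(2) weight_scaleC[OF weight_gamma]]])
      (simp add: left_diff_distrib mult_scaleC_left)
  then show ?thesis using that[of \<mu>] norm_\<mu> \<theta>\<alpha> c1 by (simp add: scaleC_one)
qed

lemma Aut_fixes_character:
  assumes \<theta>: "\<theta> \<in> Aut tens \<Phi>" and v: "unitary_rep tens \<Phi> n v"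
  shows "\<theta> (rep_character n v) = rep_character n v"
proof -
  obtain \<mu> where \<mu>: "cmod \<mu> = 1" "\<theta> \<alpha> = \<alpha>" "\<theta> \<gamma> = \<mu> *\<^sub>C \<gamma>" using Aut_gens[OF \<theta>] .
  \<comment> \<open>Chosen with \<open>cnj z * cnj z = \<mu>\<close>, so that
    \<open>rot 1 \<mu>\<close> is the left translation by \<open>z\<close> followed by the right
    translation by \<open>cnj z\<close>. On a character the former can be exchanged for the right
    translation by \<open>z\<close>, which the latter undoes.\<close>
  define z where "z = cnj (csqrt \<mu>)"
  have z: "cmod z = 1" "cmod (cnj z) = 1" using \<mu>(1) by (simp_all add: z_def norm_csqrt)
  have zz: "cnj z * z = 1" "cnj z * cnj z = \<mu>"
    using unit_cnj[OF z(1)] by (simp_all add: z_def flip: power2_eq_square)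
  have one: "cmod 1 = 1" by simp
  let ?\<chi> = "rep_character n v"
  have "\<theta> ?\<chi> = rot 1 \<mu> ?\<chi>"
    by (rule hom_eqI[OF AutD(1)[OF \<theta>] rot(1)[OF one \<mu>(1)]]) (simp_all add: rot[OF one \<mu>(1)] \<mu> scaleC_one)
  also have "\<dots> = rot (cnj z) (cnj z) (rot z (cnj z) ?\<chi>)"
    by (simp only: rot_rot[OF z(2,2) z] zz)
  also have "\<dots> = rot (cnj z) (cnj z) (rot z z ?\<chi>)" by (simp only: rot_character[OF z(1) v])
  also have "\<dots> = ?\<chi>" by (rule rot_cnj(2)[OF z(1,1)])
  finally show ?thesis .
qed

end

theorem theorem5p3:
  fixes q :: real
    and \<alpha> \<gamma> :: "'a::cstar_algebra"
    and tens :: "'a \<Rightarrow> 'a \<Rightarrow> 'c::cstar_algebra"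
    and \<Phi> :: "'a \<Rightarrow> 'c"
    and \<rho> :: "'a \<Rightarrow> (circle \<Rightarrow>\<^sub>C complex)"
  assumes "0 < q\<^sup>2" and "q\<^sup>2 < 1"
    and "is_SUq2 q \<alpha> \<gamma>"
    and "min_tensor tens"
    and "is_SUq2_comult q \<alpha> \<gamma> tens \<Phi>"
    and "is_canonical_surjection \<alpha> \<gamma> \<rho>"
  shows "Aut tens \<Phi> = Aut_chi tens \<Phi> \<and> (\<forall>\<theta> \<in> Aut tens \<Phi>. \<rho> \<circ> \<theta> = id \<circ> \<rho> \<and> id \<circ> \<rho> = \<rho>)"
proof -
  interpret suq2_group q \<alpha> \<gamma> tens \<Phi>
    by unfold_locales (rule assms)+
  have "Aut tens \<Phi> \<subseteq> Aut_chi tens \<Phi>"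
    unfolding Aut_chi_def irreducible_unitary_rep_def using Aut_fixes_character by blast
  moreover have "Aut_chi tens \<Phi> \<subseteq> Aut tens \<Phi>"
    by (auto simp: Aut_chi_def)
  moreover have "\<rho> \<circ> \<theta> = \<rho>" if \<theta>: "\<theta> \<in> Aut tens \<Phi>" for \<theta>
  proof
    fix x
    have \<rho>: "star_hom \<rho>" "\<rho> \<gamma> = 0" using assms(6) by (simp_all add: is_canonical_surjection_def)
    obtain \<mu> where \<mu>: "\<theta> \<alpha> = \<alpha>" "\<theta> \<gamma> = \<mu> *\<^sub>C \<gamma>" using Aut_gens[OF \<theta>] by blast
    have "\<rho> (\<theta> x) = \<rho> x"
      by (rule hom_eqI[OF star_hom_comp[OF \<rho>(1) AutD(1)[OF \<theta>]] \<rho>(1)])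
        (simp_all add: \<mu> \<rho> star_hom_scaleC[OF \<rho>(1)])
    then show "(\<rho> \<circ> \<theta>) x = \<rho> x" by simp
  qed
  ultimately show ?thesis by auto
qed

end
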